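(* Let $R$ be a $\mathbb{Z}_{(p)}$-algebra, let $(R,P)\to(S,Q)$ be a morphism of pre-log rings, and let $\{W_m\Lambda^\bullet_{(S,Q)/(R,P)}\}_{m\in\mathbb{N}}$ be the log de Rham-Witt complex (constructed recursively as recalled in the context). Let $\{E_m^\bullet,D_m,\partial_m\}_{m\in\mathbb{N}}$ be a log $F$-$V$-procomplex over $(S,Q)/(R,P)$. Then there is a unique morphism of log $F$-$V$-procomplexes $$\{W_m\Lambda_{(S,Q)/(R,P)}^\bullet\}\to\{E_m^\bullet\}$$ over $(S,Q)/(R,P)$.
   Context: Fix a prime $p$. A pre-log ring $(A,P)=(A,P,\alpha)$ is a commutative ring $A$, a fine commutative monoid $P$ and a monoid map $\alpha:P\to(A,\cdot)$. For a $\mathbb{Z}_{(p)}$-algebra $A$, $W_m(A,P)$ is the pre-log ring $(W_m(A),P,q\mapsto[\alpha(q)])$, with $[\cdot]$ the Teichmüller lift. The ideal ${}^VW_{m-1}(A)\subset W_m(A)$ carries the pd-structure $\gamma_n({}^V\xi)=\frac{p^{n-1}}{n!}{}^V(\xi^n)$. Log differential graded algebras. A log differential graded $(S,Q)/(R,P)$-algebra is $(E^\bullet,d,\partial)$, where $E^\bullet=\bigoplus_{i\ge0}E^i$ is a unitary graded $S$-algebra with an $R$-linear differential $d$ of degree 1, with $\omega\eta=(-1)^{ij}\eta\omega$ for $\omega\in E^i,\eta\in E^j$, $\omega\cdot\omega=0$ for $\omega$ of odd degree, the graded Leibniz rule, $d^2=0$; and $\partial:Q\to E^1$ is a monoid homomorphism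 with $d\partial=0$, $d(\alpha(q))=\alpha(q)\partial(q)$ for $q\in Q$, and $\partial=0$ on the image of $P$. Log $F$-$V$-procomplexes. A log $F$-$V$-procomplex over $(S,Q)/(R,P)$ is a projective system $\{E_m^\bullet=(E_m^\bullet,D_m,\partial_m),\ \pi_m:E^\bullet_{m+1}\to E^\bullet_m\}_{m\ge0}$ of log differential graded $W_m(S,Q)/W_m(R,P)$-algebras with $E_0^\bullet=0$, together with homomorphisms of graded abelian groups $F:E_{m+1}^\bullet\to E_m^\bullet$, $V:E_m^\bullet\to E_{m+1}^\bullet$ such that: (i) $\partial_m=\pi_m\circ\partial_{m+1}$; (ii) the maps $W_m(S)\to E_m^0$ are compatible with $F$ and $V$; (iii) the $\pi_m$ are compatible with $F$ and $V$; (iv) $F$ is a homomorphism of graded $W_{m+1}(S)$-algebras $E_{m+1}^\bullet\to E^\bullet_{m,[F]}$ (restriction of scalars along $F:W_{m+1}(S)\to W_m(S)$); (v) ${}^{FV}\omega=p\omega$, ${}^FD_{m+1}{}^V\omega=D_m\omega$, ${}^FD_{m+1}[x]=[x^{p-1}]D_m[x]$ for $x\in S$, ${}^V(\omega\,{}^F\eta)=({}^V\omega)\eta$, and ${}^F\partial_{m+1}(q)=\partial_m(q)$ for $q\in Q$. A morphism of log $F$-$V$-procomplexes is a morphism of the projective systems of log differential graded $W_m(S,Q)/W_m(R,P)$-algebras compatible with $F$ and $V$. Construction of $W_m\Lambda^\bullet=W_m\Lambda^\bullet_{(S,Q)/(R,P)}$. Let $\Lambda^\bullet_{W_m(S,Q)/W_m(R,P)}$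 be the log de Rham complex and let $\breve\Lambda^\bullet_{W_m(S,Q)/W_m(R,P)}$ be the universal log pd-differential graded algebra, with $\breve\Lambda^1$ the quotient of $\Lambda^1$ by the submodule generated by all $d(\gamma_n(b))-\gamma_{n-1}(b)db$, $b\in{}^VW_{m-1}(S)$, $n\ge1$. There is a map $F:\breve\Lambda^\bullet_{W_{m+1}(S,Q)/W_{m+1}(R,P)}\to\breve\Lambda^\bullet_{W_m(S,Q)/W_m(R,P)}$, extending $F$ on Witt vectors, with ${}^F d[x]=[x]^{p-1}d[x]$, ${}^Fd\,{}^V\xi=d\xi$, ${}^Fd\log q=d\log q$. Set $W_0\Lambda^\bullet=0$ and $W_1\Lambda^\bullet=\Lambda^\bullet_{(S,Q)/(R,P)}$. Given $W_n\Lambda^\bullet$ for $n\le m$ (quotients of $\breve\Lambda^\bullet_{W_n(S,Q)/W_n(R,P)}$, with restriction maps, $F$ and $V$), let $I\subset\breve\Lambda^\bullet_{W_{m+1}(S,Q)/W_{m+1}(R,P)}$ be the ideal generated, for every relation $$\sum_l\xi^{(l)}d\log q_1^{(l)}\cdots d\log q_{r_l}^{(l)}\,d\eta_{r_l+1}^{(l)}\cdots d\eta_i^{(l)}=0\quad\text{in }W_m\Lambda^\bullet$$ ($\xi^{(l)},\eta^{(l)}_j\in W_m(S)$, $q^{(l)}_j\in Q$), by the elements $$\sum_l{}^V\xi^{(l)}d\log q_1^{(l)}\cdots d\log q_{r_l}^{(l)}\,d{}^V\eta_{r_l+1}^{(l)}\cdots d{}^V\eta_i^{(l)},\qquad \sum_l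 d{}^V\xi^{(l)}d\log q_1^{(l)}\cdots d\log q_{r_l}^{(l)}\,d{}^V\eta_{r_l+1}^{(l)}\cdots d{}^V\eta_i^{(l)}.$$ Put $\bar\Lambda^\bullet_{m+1}=\breve\Lambda^\bullet_{W_{m+1}(S,Q)/W_{m+1}(R,P)}/I$. Then $F$ induces $F:\bar\Lambda^\bullet_{m+1}\to W_m\Lambda^\bullet$, and there is an additive map $V:W_m\Lambda^\bullet\to\bar\Lambda^\bullet_{m+1}$, $\xi\,d\log q_1\cdots d\log q_r\,d\eta_{r+1}\cdots d\eta_i\mapsto{}^V\xi\,d\log q_1\cdots d\log q_r\,d{}^V\eta_{r+1}\cdots d{}^V\eta_i$. Let $J\subset\bar\Lambda^\bullet_{m+1}$ be the ideal generated by all ${}^V(\omega\,{}^F\eta)-{}^V\omega\,\eta$ and $d({}^V(\omega\,{}^F\eta)-{}^V\omega\,\eta)$ for $\omega\in W_m\Lambda^\bullet$, $\eta\in\bar\Lambda^\bullet_{m+1}$, and set $W_{m+1}\Lambda^\bullet=\bar\Lambda^\bullet_{m+1}/J$ with the induced $F$, $V$. The system so obtained is a log $F$-$V$-procomplex (with $\partial_m=d\log$). *)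

theory Defs
  imports
    Complex_Main
    "HOL-Computational_Algebra.Primes"
    "HOL-Algebra.QuotRing"
    "HOL-Library.Poly_Mapping"
begin

section \<open>Pre-log rings\<close>

definition fine_monoid :: "'q monoid \<Rightarrow> bool" where
  "fine_monoid M \<longleftrightarrow> comm_monoid M
     \<and> (\<exists>X. finite X \<and> X \<subseteq> carrier M \<and> (\<forall>H. submonoid H M \<and> X \<subseteq> H \<longrightarrow> H = carrier M))
     \<and> (\<forall>a\<in>carrier M. \<forall>b\<in>carrier M. \<forall>c\<in>carrier M. a \<otimes>\<^bsub>M\<^esub> b = a \<otimes>\<^bsub>M\<^esub> c \<longrightarrow> b = c)"

text \<open>\<^const>\<open>hom\<close> does not require preservation of the unit.\<close>

definition monoid_map :: "('a, 'm) monoid_scheme \<Rightarrow> ('b, 'n) monoid_scheme \<Rightarrow> ('a \<Rightarrow> 'b) \<Rightarrow> bool" where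
  "monoid_map M N f \<longleftrightarrow> f \<in> hom M N \<and> f \<one>\<^bsub>M\<^esub> = \<one>\<^bsub>N\<^esub>"

record ('a, 'q) prelog =
  lring :: "'a ring"
  lmon :: "'q monoid"
  lmap :: "'q \<Rightarrow> 'a"

definition prelog_ring :: "('a, 'q) prelog \<Rightarrow> bool" where
  "prelog_ring X \<longleftrightarrow> cring (lring X) \<and> fine_monoid (lmon X) \<and> monoid_map (lmon X) (lring X) (lmap X)"

definition prelog_hom ::
  "('r, 'p) prelog \<Rightarrow> ('s, 'q) prelog \<Rightarrow> ('r \<Rightarrow> 's) \<Rightarrow> ('p \<Rightarrow> 'q) \<Rightarrow> bool" where
  "prelog_hom X Y \<phi> \<psi> \<longleftrightarrow> prelog_ring X \<and> prelog_ring Y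
     \<and> \<phi> \<in> ring_hom (lring X) (lring Y) \<and> monoid_map (lmon X) (lmon Y) \<psi>
     \<and> (\<forall>a\<in>carrier (lmon X). lmap Y (\<psi> a) = \<phi> (lmap X a))"

definition Z_local :: "nat \<Rightarrow> rat ring" where
  "Z_local p = \<lparr>carrier = {x. \<not> int p dvd snd (quotient_of x)},
     monoid.mult = (*), one = 1, zero = 0, add = (+)\<rparr>"

definition Z_local_algebra :: "nat \<Rightarrow> 'a ring \<Rightarrow> bool" where
  "Z_local_algebra p A \<longleftrightarrow> cring A \<and> (\<exists>h. h \<in> ring_hom (Z_local p) A)"

text \<open>The image of a fraction in a ring in which its (reduced) denominator is invertible; for a
  \<open>Z\<^sub>(\<^sub>p\<^sub>)\<close>-algebra this is the structure map.\<close>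

definition rat_in :: "'a ring \<Rightarrow> rat \<Rightarrow> 'a" where
  "rat_in A c = (case quotient_of c of (a, b) \<Rightarrow>
     ([a] \<cdot>\<^bsub>A\<^esub> \<one>\<^bsub>A\<^esub>) \<otimes>\<^bsub>A\<^esub> inv\<^bsub>A\<^esub> ([b] \<cdot>\<^bsub>A\<^esub> \<one>\<^bsub>A\<^esub>))"


section \<open>Truncated Witt vectors\<close>

text \<open>Integral polynomials in variables \<open>'v\<close>: finitely supported coefficient functions on
  finitely supported exponent functions.\<close>

type_synonym 'v zpoly = "('v \<Rightarrow>\<^sub>0 nat) \<Rightarrow>\<^sub>0 int"

definition zvar :: "'v \<Rightarrow> 'v zpoly" where
  "zvar v = Poly_Mapping.single (Poly_Mapping.single v 1) 1"

definition zeval :: "'a ring \<Rightarrow> 'v zpoly \<Rightarrow> ('v \<Rightarrow> 'a) \<Rightarrow> 'a" where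
  "zeval A f \<rho> = (\<Oplus>\<^bsub>A\<^esub>m\<in>Poly_Mapping.keys f. [(Poly_Mapping.lookup f m)] \<cdot>\<^bsub>A\<^esub>
     (\<Otimes>\<^bsub>A\<^esub>v\<in>Poly_Mapping.keys m. \<rho> v [^]\<^bsub>A\<^esub> Poly_Mapping.lookup m v))"

definition ghost :: "nat \<Rightarrow> nat \<Rightarrow> (nat \<Rightarrow> 'b::comm_ring_1) \<Rightarrow> 'b" where
  "ghost p n x = (\<Sum>i\<le>n. of_nat p ^ i * x i ^ (p ^ (n - i)))"

text \<open>The integral polynomials with prescribed ghost components. They are unique since
  \<open>p\<close> is a non-zero-divisor; existence for the three families below is Witt's theorem.\<close>

definition with_ghost :: "nat \<Rightarrow> (nat \<Rightarrow> 'v zpoly) \<Rightarrow> nat \<Rightarrow> 'v zpoly" where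
  "with_ghost p T = (THE s. \<forall>n. ghost p n s = T n)"

definition witt_add_poly :: "nat \<Rightarrow> nat \<Rightarrow> (nat + nat) zpoly" where
  "witt_add_poly p =
     with_ghost p (\<lambda>n. ghost p n (\<lambda>i. zvar (Inl i)) + ghost p n (\<lambda>i. zvar (Inr i)))"

definition witt_mult_poly :: "nat \<Rightarrow> nat \<Rightarrow> (nat + nat) zpoly" where
  "witt_mult_poly p =
     with_ghost p (\<lambda>n. ghost p n (\<lambda>i. zvar (Inl i)) * ghost p n (\<lambda>i. zvar (Inr i)))"

definition witt_frob_poly :: "nat \<Rightarrow> nat \<Rightarrow> nat zpoly" where
  "witt_frob_poly p = with_ghost p (\<lambda>n. ghost p (Suc n) zvar)"

definition teich :: "nat \<Rightarrow> 'a ring \<Rightarrow> 'a \<Rightarrow> 'a list" where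
  "teich m A x = map (\<lambda>i. if i = 0 then x else \<zero>\<^bsub>A\<^esub>) [0..<m]"

text \<open>Elements of \<open>W\<^sub>m(A)\<close> are lists of length \<open>m\<close>, so \<open>W\<^sub>0(A)\<close> is the zero ring and
  \<open>W\<^sub>1(A)\<close> is \<open>A\<close> (as singleton lists). The \<open>n\<close>-th polynomials only involve variables of
  index at most \<open>n\<close> (at most \<open>n + 1\<close> for the Frobenius), so no list is accessed out of range.\<close>

definition witt :: "nat \<Rightarrow> nat \<Rightarrow> 'a ring \<Rightarrow> 'a list ring" where
  "witt p m A = \<lparr>carrier = {a. length a = m \<and> set a \<subseteq> carrier A},
     monoid.mult = (\<lambda>a b. map (\<lambda>n. zeval A (witt_mult_poly p n) (case_sum (nth a) (nth b))) [0..<m]),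
     one = teich m A \<one>\<^bsub>A\<^esub>,
     zero = replicate m \<zero>\<^bsub>A\<^esub>,
     add = (\<lambda>a b. map (\<lambda>n. zeval A (witt_add_poly p n) (case_sum (nth a) (nth b))) [0..<m])\<rparr>"

definition witt_F :: "nat \<Rightarrow> nat \<Rightarrow> 'a ring \<Rightarrow> 'a list \<Rightarrow> 'a list" where
  \<comment> \<open>\<open>W\<^bsub>m+1\<^esub>(A) \<rightarrow> W\<^sub>m(A)\<close>\<close>
  "witt_F p m A a = map (\<lambda>n. zeval A (witt_frob_poly p n) (nth a)) [0..<m]"

definition witt_V :: "'a ring \<Rightarrow> 'a list \<Rightarrow> 'a list" where
  \<comment> \<open>\<open>W\<^sub>m(A) \<rightarrow> W\<^bsub>m+1\<^esub>(A)\<close>\<close>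
  "witt_V A a = \<zero>\<^bsub>A\<^esub> # a"

abbreviation witt_res :: "'a list \<Rightarrow> 'a list" where
  \<comment> \<open>\<open>W\<^bsub>m+1\<^esub>(A) \<rightarrow> W\<^sub>m(A)\<close>\<close>
  "witt_res \<equiv> butlast"

text \<open>The divided powers \<open>\<gamma>\<^sub>n(V \<xi>) = p\<^sup>n\<^sup>-\<^sup>1/n! V(\<xi>\<^sup>n)\<close>, \<open>n \<ge> 1\<close>, and \<open>\<gamma>\<^sub>0 = 1\<close>, as elements of
  \<open>W\<^bsub>m+1\<^esub>(A)\<close> for \<open>\<xi>\<close> in \<open>W\<^sub>m(A)\<close>.\<close>

definition witt_pd :: "nat \<Rightarrow> nat \<Rightarrow> 'a ring \<Rightarrow> nat \<Rightarrow> 'a list \<Rightarrow> 'a list" where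
  "witt_pd p m A n \<xi> = (if n = 0 then \<one>\<^bsub>witt p (Suc m) A\<^esub> else
     rat_in (witt p (Suc m) A) (of_nat p ^ (n - 1) / fact n)
       \<otimes>\<^bsub>witt p (Suc m) A\<^esub> witt_V A (\<xi> [^]\<^bsub>witt p m A\<^esub> n))"

definition witt_prelog :: "nat \<Rightarrow> nat \<Rightarrow> ('a, 'q) prelog \<Rightarrow> ('a list, 'q) prelog" where
  "witt_prelog p m X = \<lparr>lring = witt p m (lring X), lmon = lmon X,
     lmap = (\<lambda>q. teich m (lring X) (lmap X q))\<rparr>"


section \<open>Log differential graded algebras\<close>

text \<open>\<open>E = \<Oplus>\<^sub>i E\<^sup>i\<close> is graded internally by subgroups \<open>gr E i\<close>; \<open>str\<close> is the structure map
  \<open>S \<rightarrow> E\<^sup>0\<close>, \<open>dif\<close> the differential and \<open>dlog\<close> the monoid map \<open>\<partial>\<close>.\<close>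

record ('e, 's, 'q) ldga = "'e ring" +
  gr :: "nat \<Rightarrow> 'e set"
  str :: "'s \<Rightarrow> 'e"
  dif :: "'e \<Rightarrow> 'e"
  dlog :: "'q \<Rightarrow> 'e"

locale log_dga = ring E
  for X :: "('r, 'p) prelog" and Y :: "('s, 'q) prelog"
    and \<phi> :: "'r \<Rightarrow> 's" and \<psi> :: "'p \<Rightarrow> 'q"
    and E :: "('e, 's, 'q) ldga" (structure) +
  assumes gr_subgroup: "\<And>i. additive_subgroup (gr E i) E"
    and gr_direct: "\<And>x. x \<in> carrier E \<Longrightarrow>
      \<exists>!c. (\<forall>i. c i \<in> gr E i) \<and> finite {i. c i \<noteq> \<zero>} \<and> x = (\<Oplus>i\<in>{i. c i \<noteq> \<zero>}. c i)"
    and gr_one: "\<one> \<in> gr E 0"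
    and gr_mult: "\<And>i j \<omega> \<eta>. \<omega> \<in> gr E i \<Longrightarrow> \<eta> \<in> gr E j \<Longrightarrow> \<omega> \<otimes> \<eta> \<in> gr E (i + j)"
    and str_hom: "str E \<in> ring_hom (lring Y) E"
    and str_gr: "\<And>s. s \<in> carrier (lring Y) \<Longrightarrow> str E s \<in> gr E 0"
    and graded_comm: "\<And>i j \<omega> \<eta>. \<omega> \<in> gr E i \<Longrightarrow> \<eta> \<in> gr E j \<Longrightarrow>
      \<omega> \<otimes> \<eta> = [((-1::int) ^ (i * j))] \<cdot> (\<eta> \<otimes> \<omega>)"
    and odd_square: "\<And>i \<omega>. odd i \<Longrightarrow> \<omega> \<in> gr E i \<Longrightarrow> \<omega> \<otimes> \<omega> = \<zero>"
    and dif_gr: "\<And>i \<omega>. \<omega> \<in> gr E i \<Longrightarrow> dif E \<omega> \<in> gr E (Suc i)"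
    and dif_add: "\<And>\<omega> \<eta>. \<omega> \<in> carrier E \<Longrightarrow> \<eta> \<in> carrier E \<Longrightarrow> dif E (\<omega> \<oplus> \<eta>) = dif E \<omega> \<oplus> dif E \<eta>"
    and dif_linear: "\<And>r \<omega>. r \<in> carrier (lring X) \<Longrightarrow> \<omega> \<in> carrier E \<Longrightarrow>
      dif E (str E (\<phi> r) \<otimes> \<omega>) = str E (\<phi> r) \<otimes> dif E \<omega>"
    and dif_leibniz: "\<And>i \<omega> \<eta>. \<omega> \<in> gr E i \<Longrightarrow> \<eta> \<in> carrier E \<Longrightarrow>
      dif E (\<omega> \<otimes> \<eta>) = dif E \<omega> \<otimes> \<eta> \<oplus> [((-1::int) ^ i)] \<cdot> (\<omega> \<otimes> dif E \<eta>)"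
    and dif_dif: "\<And>\<omega>. \<omega> \<in> carrier E \<Longrightarrow> dif E (dif E \<omega>) = \<zero>"
    and dlog_gr: "\<And>q. q \<in> carrier (lmon Y) \<Longrightarrow> dlog E q \<in> gr E 1"
    and dlog_hom: "monoid_map (lmon Y) (add_monoid E) (dlog E)"
    and dif_dlog: "\<And>q. q \<in> carrier (lmon Y) \<Longrightarrow> dif E (dlog E q) = \<zero>"
    and dif_lmap: "\<And>q. q \<in> carrier (lmon Y) \<Longrightarrow>
      dif E (str E (lmap Y q)) = str E (lmap Y q) \<otimes> dlog E q"
    and dlog_base: "\<And>a. a \<in> carrier (lmon X) \<Longrightarrow> dlog E (\<psi> a) = \<zero>"

text \<open>Maps of log differential graded algebras along a map \<open>\<tau>\<close> of coefficient rings.\<close>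

definition log_dga_map ::
  "('s, 'q) prelog \<Rightarrow> ('s \<Rightarrow> 't) \<Rightarrow> ('e, 's, 'q) ldga \<Rightarrow> ('f, 't, 'q) ldga \<Rightarrow> ('e \<Rightarrow> 'f) \<Rightarrow> bool" where
  "log_dga_map Y \<tau> E E' f \<longleftrightarrow> f \<in> ring_hom E E'
     \<and> (\<forall>i. f ` gr E i \<subseteq> gr E' i)
     \<and> (\<forall>s\<in>carrier (lring Y). f (str E s) = str E' (\<tau> s))
     \<and> (\<forall>\<omega>\<in>carrier E. f (dif E \<omega>) = dif E' (f \<omega>))
     \<and> (\<forall>q\<in>carrier (lmon Y). f (dlog E q) = dlog E' q)"


section \<open>Log F-V-procomplexes\<close>

record ('e, 's, 'q) procomplex =
  lev :: "nat \<Rightarrow> ('e, 's list, 'q) ldga"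
  res :: "nat \<Rightarrow> 'e \<Rightarrow> 'e"
  Frob :: "nat \<Rightarrow> 'e \<Rightarrow> 'e"
  Ver :: "nat \<Rightarrow> 'e \<Rightarrow> 'e"

definition graded_hom :: "('e, 's, 'q) ldga \<Rightarrow> ('f, 't, 'q) ldga \<Rightarrow> ('e \<Rightarrow> 'f) \<Rightarrow> bool" where
  "graded_hom E E' f \<longleftrightarrow> f \<in> hom (add_monoid E) (add_monoid E') \<and> (\<forall>i. f ` gr E i \<subseteq> gr E' i)"

text \<open>Over \<open>W\<^sub>m(R,P) \<rightarrow> W\<^sub>m(S,Q)\<close>, whose ring component is \<open>map \<phi>\<close>.
  \<open>res C m\<close>, \<open>Frob C m\<close> map level \<open>m + 1\<close> to level \<open>m\<close>, and \<open>Ver C m\<close> level \<open>m\<close> to level \<open>m + 1\<close>.\<close>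

locale log_FV_procomplex =
  fixes p :: nat and X :: "('r, 'p) prelog" and Y :: "('s, 'q) prelog"
    and \<phi> :: "'r \<Rightarrow> 's" and \<psi> :: "'p \<Rightarrow> 'q"
    and C :: "('e, 's, 'q) procomplex"
  assumes lev_dga: "\<And>m. log_dga (witt_prelog p m X) (witt_prelog p m Y) (map \<phi>) \<psi> (lev C m)"
    and lev_0: "carrier (lev C 0) = {\<zero>\<^bsub>lev C 0\<^esub>}"
    and res_map: "\<And>m. log_dga_map (witt_prelog p (Suc m) Y) witt_res (lev C (Suc m)) (lev C m) (res C m)"
    and F_graded: "\<And>m. graded_hom (lev C (Suc m)) (lev C m) (Frob C m)"
    and V_graded: "\<And>m. graded_hom (lev C m) (lev C (Suc m)) (Ver C m)"
    and F_str: "\<And>m \<xi>. \<xi> \<in> carrier (witt p (Suc m) (lring Y)) \<Longrightarrow>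
      Frob C m (str (lev C (Suc m)) \<xi>) = str (lev C m) (witt_F p m (lring Y) \<xi>)"
    and V_str: "\<And>m \<xi>. \<xi> \<in> carrier (witt p m (lring Y)) \<Longrightarrow>
      Ver C m (str (lev C m) \<xi>) = str (lev C (Suc m)) (witt_V (lring Y) \<xi>)"
    and res_F: "\<And>m \<omega>. \<omega> \<in> carrier (lev C (Suc (Suc m))) \<Longrightarrow>
      res C m (Frob C (Suc m) \<omega>) = Frob C m (res C (Suc m) \<omega>)"
    and res_V: "\<And>m \<omega>. \<omega> \<in> carrier (lev C (Suc m)) \<Longrightarrow>
      res C (Suc m) (Ver C (Suc m) \<omega>) = Ver C m (res C m \<omega>)"
    and F_ring_hom: "\<And>m. Frob C m \<in> ring_hom (lev C (Suc m)) (lev C m)"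
    and F_V: "\<And>m \<omega>. \<omega> \<in> carrier (lev C m) \<Longrightarrow> Frob C m (Ver C m \<omega>) = [p] \<cdot>\<^bsub>lev C m\<^esub> \<omega>"
    and F_d_V: "\<And>m \<omega>. \<omega> \<in> carrier (lev C m) \<Longrightarrow>
      Frob C m (dif (lev C (Suc m)) (Ver C m \<omega>)) = dif (lev C m) \<omega>"
    and F_d_teich: "\<And>m x. x \<in> carrier (lring Y) \<Longrightarrow>
      Frob C m (dif (lev C (Suc m)) (str (lev C (Suc m)) (teich (Suc m) (lring Y) x)))
        = str (lev C m) (teich m (lring Y) (x [^]\<^bsub>lring Y\<^esub> (p - 1)))
          \<otimes>\<^bsub>lev C m\<^esub> dif (lev C m) (str (lev C m) (teich m (lring Y) x))"
    and V_F: "\<And>m \<omega> \<eta>. \<omega> \<in> carrier (lev C m) \<Longrightarrow> \<eta> \<in> carrier (lev C (Suc m)) \<Longrightarrow>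
      Ver C m (\<omega> \<otimes>\<^bsub>lev C m\<^esub> Frob C m \<eta>) = Ver C m \<omega> \<otimes>\<^bsub>lev C (Suc m)\<^esub> \<eta>"
    and F_dlog: "\<And>m q. q \<in> carrier (lmon Y) \<Longrightarrow>
      Frob C m (dlog (lev C (Suc m)) q) = dlog (lev C m) q"

text \<open>Maps are restricted to the carriers (\<^const>\<open>extensional\<close>) so that equality of
  morphisms is equality of families of functions.\<close>

definition FV_morphism ::
  "nat \<Rightarrow> ('s, 'q) prelog \<Rightarrow> ('e, 's, 'q) procomplex \<Rightarrow> ('f, 's, 'q) procomplex
     \<Rightarrow> (nat \<Rightarrow> 'e \<Rightarrow> 'f) \<Rightarrow> bool" where
  "FV_morphism p Y C C' f \<longleftrightarrow> (\<forall>m.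
     f m \<in> extensional (carrier (lev C m))
     \<and> log_dga_map (witt_prelog p m Y) id (lev C m) (lev C' m) (f m)
     \<and> (\<forall>\<omega>\<in>carrier (lev C (Suc m)). f m (res C m \<omega>) = res C' m (f (Suc m) \<omega>))
     \<and> (\<forall>\<omega>\<in>carrier (lev C (Suc m)). f m (Frob C m \<omega>) = Frob C' m (f (Suc m) \<omega>))
     \<and> (\<forall>\<omega>\<in>carrier (lev C m). f (Suc m) (Ver C m \<omega>) = Ver C' m (f m \<omega>)))"


section \<open>The free graded ring on symbols for scalars, differentials and dlog\<close>

datatype ('s, 'q) letter = Sc 's | Dd 's | Dl 'q

text \<open>Words are wrapped lists because \<^const>\<open>times\<close> on \<open>'a \<Rightarrow>\<^sub>0 int\<close> needs a
  \<^class>\<open>monoid_add\<close> structure on \<open>'a\<close>, here concatenation.\<close>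

datatype ('s, 'q) word = Word (letters: "('s, 'q) letter list")

instantiation word :: (type, type) monoid_add
begin

definition zero_word :: "('a, 'b) word" where "zero_word = Word []"

definition plus_word :: "('a, 'b) word \<Rightarrow> ('a, 'b) word \<Rightarrow> ('a, 'b) word" where
  "plus_word u v = Word (letters u @ letters v)"

instance by standard (simp_all add: zero_word_def plus_word_def)

end

type_synonym ('s, 'q) free = "('s, 'q) word \<Rightarrow>\<^sub>0 int"

abbreviation wrd :: "('s, 'q) letter list \<Rightarrow> ('s, 'q) free" where
  "wrd w \<equiv> frag_of (Word w)"

abbreviation gen :: "('s, 'q) letter \<Rightarrow> ('s, 'q) free" where
  "gen l \<equiv> wrd [l]"

fun letter_in :: "('s, 'q) prelog \<Rightarrow> ('s, 'q) letter \<Rightarrow> bool" where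
  "letter_in Y (Sc s) \<longleftrightarrow> s \<in> carrier (lring Y)"
| "letter_in Y (Dd s) \<longleftrightarrow> s \<in> carrier (lring Y)"
| "letter_in Y (Dl q) \<longleftrightarrow> q \<in> carrier (lmon Y)"

definition free_ring :: "('s, 'q) prelog \<Rightarrow> ('s, 'q) free ring" where
  "free_ring Y = \<lparr>carrier = {x. \<forall>w\<in>Poly_Mapping.keys x. \<forall>l\<in>set (letters w). letter_in Y l},
     monoid.mult = (*), one = 1, zero = 0, add = (+)\<rparr>"

fun letter_deg :: "('s, 'q) letter \<Rightarrow> nat" where
  "letter_deg (Sc s) = 0"
| "letter_deg (Dd s) = 1"
| "letter_deg (Dl q) = 1"

definition homog :: "('s, 'q) prelog \<Rightarrow> nat \<Rightarrow> ('s, 'q) free set" where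
  "homog Y i = {x \<in> carrier (free_ring Y).
     \<forall>w\<in>Poly_Mapping.keys x. sum_list (map letter_deg (letters w)) = i}"

definition free_hom ::
  "(('s, 'q) letter \<Rightarrow> ('t, 'u) free) \<Rightarrow> ('s, 'q) free \<Rightarrow> ('t, 'u) free" where
  "free_hom h = frag_extend (\<lambda>w. prod_list (map h (letters w)))"

text \<open>The graded derivation with \<open>s \<mapsto> ds\<close>, \<open>ds \<mapsto> 0\<close>, \<open>dlog q \<mapsto> 0\<close>.\<close>

fun d_word :: "('s, 'q) letter list \<Rightarrow> ('s, 'q) free" where
  "d_word [] = 0"
| "d_word (Sc s # w) = wrd (Dd s # w) + gen (Sc s) * d_word w"
| "d_word (Dd s # w) = - (gen (Dd s) * d_word w)"
| "d_word (Dl q # w) = - (gen (Dl q) * d_word w)"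

definition d_free :: "('s, 'q) free \<Rightarrow> ('s, 'q) free" where
  "d_free = frag_extend (\<lambda>w. d_word (letters w))"

text \<open>The map between quotients induced by a map \<open>f\<close> of free rings, evaluated on a
  representative; \<open>I'\<close> is the target ideal. It is only used for maps that are compatible with the
  ideals on both sides, where the choice of representative is irrelevant.\<close>

definition induced ::
  "('t, 'u) prelog \<Rightarrow> ('t, 'u) free set \<Rightarrow> (('s, 'q) free \<Rightarrow> ('t, 'u) free)
     \<Rightarrow> ('s, 'q) free set \<Rightarrow> ('t, 'u) free set" where
  "induced Y' I' f c = I' +>\<^bsub>free_ring Y'\<^esub> f (SOME x. x \<in> c)"

definition quot_dga :: "('s, 'q) prelog \<Rightarrow> ('s, 'q) free set \<Rightarrow> (('s, 'q) free set, 's, 'q) ldga" where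
  "quot_dga Y I = (let A = free_ring Y; B = A Quot I in
     \<lparr>carrier = carrier B, monoid.mult = monoid.mult B, one = one B, zero = zero B, add = add B,
      gr = (\<lambda>i. {I +>\<^bsub>A\<^esub> x | x. x \<in> homog Y i}),
      str = (\<lambda>s. I +>\<^bsub>A\<^esub> gen (Sc s)),
      dif = induced Y I d_free,
      dlog = (\<lambda>q. I +>\<^bsub>A\<^esub> gen (Dl q))\<rparr>)"


section \<open>The log de Rham complex\<close>

text \<open>The relations presenting the log de Rham complex, that is, the exterior \<open>S\<close>-algebra on the
  module of log differentials, with differential induced by \<^const>\<open>d_free\<close>: the first two groups of
  relations make the free ring the tensor algebra of the free \<open>S\<close>-module on the symbols
  \<open>ds\<close> and \<open>dlog q\<close>, the next two are the relations of the module of log differentials, and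
  the last group makes the tensor algebra exterior.\<close>

definition scalar_rels :: "('s, 'q) prelog \<Rightarrow> ('s, 'q) free set" where
  "scalar_rels Y = (let S = lring Y in
     {gen (Sc (a \<oplus>\<^bsub>S\<^esub> b)) - (gen (Sc a) + gen (Sc b)) | a b. a \<in> carrier S \<and> b \<in> carrier S}
     \<union> {gen (Sc (a \<otimes>\<^bsub>S\<^esub> b)) - gen (Sc a) * gen (Sc b) | a b. a \<in> carrier S \<and> b \<in> carrier S}
     \<union> {gen (Sc \<one>\<^bsub>S\<^esub>) - 1})"

definition central_rels :: "('s, 'q) prelog \<Rightarrow> ('s, 'q) free set" where
  "central_rels Y = {gen (Sc a) * gen l - gen l * gen (Sc a) | a l.
     a \<in> carrier (lring Y) \<and> letter_in Y l}"

definition kaehler_rels :: "('r, 'p) prelog \<Rightarrow> ('s, 'q) prelog \<Rightarrow> ('r \<Rightarrow> 's) \<Rightarrow> ('s, 'q) free set" where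
  "kaehler_rels X Y \<phi> = (let S = lring Y in
     {gen (Dd (a \<oplus>\<^bsub>S\<^esub> b)) - (gen (Dd a) + gen (Dd b)) | a b. a \<in> carrier S \<and> b \<in> carrier S}
     \<union> {gen (Dd (a \<otimes>\<^bsub>S\<^esub> b)) - (gen (Sc a) * gen (Dd b) + gen (Sc b) * gen (Dd a)) | a b.
          a \<in> carrier S \<and> b \<in> carrier S}
     \<union> {gen (Dd (\<phi> r)) | r. r \<in> carrier (lring X)})"

definition dlog_rels :: "('r, 'p) prelog \<Rightarrow> ('s, 'q) prelog \<Rightarrow> ('p \<Rightarrow> 'q) \<Rightarrow> ('s, 'q) free set" where
  "dlog_rels X Y \<psi> = (let Q = lmon Y in
     {gen (Dl (a \<otimes>\<^bsub>Q\<^esub> b)) - (gen (Dl a) + gen (Dl b)) | a b. a \<in> carrier Q \<and> b \<in> carrier Q}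
     \<union> {gen (Dl (\<psi> a)) | a. a \<in> carrier (lmon X)}
     \<union> {gen (Dd (lmap Y q)) - gen (Sc (lmap Y q)) * gen (Dl q) | q. q \<in> carrier Q})"

definition alternating_rels :: "('s, 'q) prelog \<Rightarrow> ('s, 'q) free set" where
  "alternating_rels Y = {x * x | x. x \<in> homog Y 1}"

definition log_dR_rels ::
  "('r, 'p) prelog \<Rightarrow> ('s, 'q) prelog \<Rightarrow> ('r \<Rightarrow> 's) \<Rightarrow> ('p \<Rightarrow> 'q) \<Rightarrow> ('s, 'q) free set" where
  "log_dR_rels X Y \<phi> \<psi> = scalar_rels Y \<union> central_rels Y \<union> kaehler_rels X Y \<phi>
     \<union> dlog_rels X Y \<psi> \<union> alternating_rels Y"

section \<open>The log de Rham-Witt complex\<close>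

text \<open>All complexes of level \<open>m\<close> are presented as quotients of the free ring over \<open>W\<^sub>m(S,Q)\<close>; an
  iterated quotient \<open>(A/I)/J\<close> is presented as \<open>A/(I + J)\<close>, and maps between complexes by maps
  between the free rings.\<close>

abbreviation wfree :: "nat \<Rightarrow> nat \<Rightarrow> ('s, 'q) prelog \<Rightarrow> ('s list, 'q) free ring" where
  "wfree p m Y \<equiv> free_ring (witt_prelog p m Y)"

definition wdR_rels :: "nat \<Rightarrow> nat \<Rightarrow> ('r, 'p) prelog \<Rightarrow> ('s, 'q) prelog \<Rightarrow> ('r \<Rightarrow> 's) \<Rightarrow> ('p \<Rightarrow> 'q)
    \<Rightarrow> ('s list, 'q) free set" where
  "wdR_rels p m X Y \<phi> \<psi> = log_dR_rels (witt_prelog p m X) (witt_prelog p m Y) (map \<phi>) \<psi>"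

text \<open>\<open>d\<gamma>\<^sub>n(b) = \<gamma>\<^sub>n\<^sub>-\<^sub>1(b) db\<close> in level \<open>m + 1\<close>, for \<open>b = V \<xi>\<close> and \<open>n \<ge> 1\<close>.\<close>

definition pd_rels :: "nat \<Rightarrow> nat \<Rightarrow> ('s, 'q) prelog \<Rightarrow> ('s list, 'q) free set" where
  "pd_rels p m Y = (let S = lring Y in
     {gen (Dd (witt_pd p m S n \<xi>)) - gen (Sc (witt_pd p m S (n - 1) \<xi>)) * gen (Dd (witt_V S \<xi>))
      | n \<xi>. n \<ge> 1 \<and> \<xi> \<in> carrier (witt p m S)})"

text \<open>\<open>F\<close> from level \<open>m + 1\<close> to level \<open>m\<close>. Since \<open>(x\<^sub>0, x\<^sub>1, \<dots>) = [x\<^sub>0] + V(x\<^sub>1, x\<^sub>2, \<dots>)\<close>, the rules for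
  \<open>F d[x]\<close> and \<open>F dV\<xi>\<close> amount to \<open>F d\<xi> = [x\<^sub>0]\<^sup>p\<^sup>-\<^sup>1 d[x\<^sub>0] + d(x\<^sub>1, x\<^sub>2, \<dots>)\<close>.\<close>

fun F_letter :: "nat \<Rightarrow> nat \<Rightarrow> ('s, 'q) prelog \<Rightarrow> ('s list, 'q) letter \<Rightarrow> ('s list, 'q) free" where
  "F_letter p m Y (Sc \<xi>) = gen (Sc (witt_F p m (lring Y) \<xi>))"
| "F_letter p m Y (Dd \<xi>) = (let x = teich m (lring Y) (hd \<xi>) in
     gen (Sc x) ^ (p - 1) * gen (Dd x) + gen (Dd (tl \<xi>)))"
| "F_letter p m Y (Dl q) = gen (Dl q)"

definition F_free :: "nat \<Rightarrow> nat \<Rightarrow> ('s, 'q) prelog \<Rightarrow> ('s list, 'q) free \<Rightarrow> ('s list, 'q) free" where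
  "F_free p m Y = free_hom (F_letter p m Y)"

text \<open>\<open>V\<close> from level \<open>m\<close> to level \<open>m + 1\<close>: a word whose scalar letters multiply to \<open>\<xi>\<close> goes to
  \<open>V \<xi>\<close> times its remaining letters, in the same order, with each \<open>d\<eta>\<close> replaced by \<open>dV\<eta>\<close>.\<close>

definition scalar_part :: "'a ring \<Rightarrow> ('a, 'q) letter list \<Rightarrow> 'a" where
  "scalar_part A w = foldr (\<lambda>l a. case l of Sc \<xi> \<Rightarrow> \<xi> \<otimes>\<^bsub>A\<^esub> a | _ \<Rightarrow> a) w \<one>\<^bsub>A\<^esub>"

fun V_letter :: "'s ring \<Rightarrow> ('s list, 'q) letter \<Rightarrow> ('s list, 'q) letter list" where
  "V_letter S (Sc \<xi>) = []"
| "V_letter S (Dd \<xi>) = [Dd (witt_V S \<xi>)]"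
| "V_letter S (Dl q) = [Dl q]"

definition V_free :: "nat \<Rightarrow> nat \<Rightarrow> ('s, 'q) prelog \<Rightarrow> ('s list, 'q) free \<Rightarrow> ('s list, 'q) free" where
  "V_free p m Y = frag_extend (\<lambda>w.
     wrd (Sc (witt_V (lring Y) (scalar_part (witt p m (lring Y)) (letters w)))
            # concat (map (V_letter (lring Y)) (letters w))))"

fun res_letter :: "('s list, 'q) letter \<Rightarrow> ('s list, 'q) free" where
  "res_letter (Sc \<xi>) = gen (Sc (witt_res \<xi>))"
| "res_letter (Dd \<xi>) = gen (Dd (witt_res \<xi>))"
| "res_letter (Dl q) = gen (Dl q)"

definition res_free :: "('s list, 'q) free \<Rightarrow> ('s list, 'q) free" where
  "res_free = free_hom res_letter"

text \<open>A list of triples \<open>(\<xi>, [q\<^sub>1, \<dots>, q\<^sub>r], [\<eta>\<^sub>r\<^sub>+\<^sub>1, \<dots>, \<eta>\<^sub>i])\<close> encodes a sum of terms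
  \<open>\<xi> dlog q\<^sub>1 \<dots> dlog q\<^sub>r d\<eta>\<^sub>r\<^sub>+\<^sub>1 \<dots> d\<eta>\<^sub>i\<close>.\<close>

type_synonym ('s, 'q) terms = "('s list \<times> 'q list \<times> 's list list) list"

definition terms_ok :: "nat \<Rightarrow> nat \<Rightarrow> ('s, 'q) prelog \<Rightarrow> nat \<Rightarrow> ('s, 'q) terms \<Rightarrow> bool" where
  "terms_ok p m Y i L \<longleftrightarrow> (\<forall>(\<xi>, qs, \<eta>s)\<in>set L.
     \<xi> \<in> carrier (witt p m (lring Y)) \<and> set qs \<subseteq> carrier (lmon Y)
     \<and> set \<eta>s \<subseteq> carrier (witt p m (lring Y)) \<and> length qs + length \<eta>s = i)"

definition terms_sum :: "('s, 'q) terms \<Rightarrow> ('s list, 'q) free" where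
  "terms_sum L = (\<Sum>(\<xi>, qs, \<eta>s)\<leftarrow>L. wrd (Sc \<xi> # map Dl qs @ map Dd \<eta>s))"

definition terms_V :: "'s ring \<Rightarrow> ('s, 'q) terms \<Rightarrow> ('s list, 'q) free" where
  "terms_V S L = (\<Sum>(\<xi>, qs, \<eta>s)\<leftarrow>L.
     wrd (Sc (witt_V S \<xi>) # map Dl qs @ map (\<lambda>\<eta>. Dd (witt_V S \<eta>)) \<eta>s))"

definition terms_dV :: "'s ring \<Rightarrow> ('s, 'q) terms \<Rightarrow> ('s list, 'q) free" where
  "terms_dV S L = (\<Sum>(\<xi>, qs, \<eta>s)\<leftarrow>L.
     wrd (Dd (witt_V S \<xi>) # map Dl qs @ map (\<lambda>\<eta>. Dd (witt_V S \<eta>)) \<eta>s))"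

text \<open>Generators of \<open>I\<close> in level \<open>m + 1\<close>, where \<open>N\<close> is the ideal defining level \<open>m\<close>.\<close>

definition I_gens :: "nat \<Rightarrow> nat \<Rightarrow> ('s, 'q) prelog \<Rightarrow> ('s list, 'q) free set
    \<Rightarrow> ('s list, 'q) free set" where
  "I_gens p m Y N =
     {terms_V (lring Y) L | L i. terms_ok p m Y i L \<and> terms_sum L \<in> N}
     \<union> {terms_dV (lring Y) L | L i. terms_ok p m Y i L \<and> terms_sum L \<in> N}"

definition VF_defect :: "nat \<Rightarrow> nat \<Rightarrow> ('s, 'q) prelog
    \<Rightarrow> ('s list, 'q) free \<Rightarrow> ('s list, 'q) free \<Rightarrow> ('s list, 'q) free" where
  "VF_defect p m Y \<omega> \<eta> = V_free p m Y (\<omega> * F_free p m Y \<eta>) - V_free p m Y \<omega> * \<eta>"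

definition J_gens :: "nat \<Rightarrow> nat \<Rightarrow> ('s, 'q) prelog \<Rightarrow> ('s list, 'q) free set" where
  "J_gens p m Y =
     {VF_defect p m Y \<omega> \<eta> | \<omega> \<eta>. \<omega> \<in> carrier (wfree p m Y) \<and> \<eta> \<in> carrier (wfree p (Suc m) Y)}
     \<union> {d_free (VF_defect p m Y \<omega> \<eta>) | \<omega> \<eta>.
          \<omega> \<in> carrier (wfree p m Y) \<and> \<eta> \<in> carrier (wfree p (Suc m) Y)}"

text \<open>The ideal of the free ring over \<open>W\<^sub>m(S,Q)\<close> with quotient \<open>W\<^sub>m\<Lambda>\<close>. In the last equation the
  relations \<open>wdR_rels\<close> and \<open>pd_rels\<close> present the universal log pd-differential graded algebra,
  \<open>I_gens\<close> cuts out the target of \<open>V\<close>, and \<open>J_gens\<close> cuts out \<open>W\<^bsub>m+2\<^esub>\<Lambda>\<close>.\<close>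

fun dRW_ideal :: "nat \<Rightarrow> ('r, 'p) prelog \<Rightarrow> ('s, 'q) prelog \<Rightarrow> ('r \<Rightarrow> 's) \<Rightarrow> ('p \<Rightarrow> 'q)
    \<Rightarrow> nat \<Rightarrow> ('s list, 'q) free set" where
  "dRW_ideal p X Y \<phi> \<psi> 0 = carrier (wfree p 0 Y)"
| "dRW_ideal p X Y \<phi> \<psi> (Suc 0) = Idl\<^bsub>wfree p 1 Y\<^esub> (wdR_rels p 1 X Y \<phi> \<psi>)"
| "dRW_ideal p X Y \<phi> \<psi> (Suc (Suc m)) = Idl\<^bsub>wfree p (Suc (Suc m)) Y\<^esub>
     (wdR_rels p (Suc (Suc m)) X Y \<phi> \<psi> \<union> pd_rels p (Suc m) Y
      \<union> I_gens p (Suc m) Y (dRW_ideal p X Y \<phi> \<psi> (Suc m)) \<union> J_gens p (Suc m) Y)"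

definition dRW :: "nat \<Rightarrow> ('r, 'p) prelog \<Rightarrow> ('s, 'q) prelog \<Rightarrow> ('r \<Rightarrow> 's) \<Rightarrow> ('p \<Rightarrow> 'q)
    \<Rightarrow> (('s list, 'q) free set, 's, 'q) procomplex" where
  "dRW p X Y \<phi> \<psi> = (let N = dRW_ideal p X Y \<phi> \<psi>; W = (\<lambda>m. witt_prelog p m Y) in
     \<lparr>lev = (\<lambda>m. quot_dga (W m) (N m)),
      res = (\<lambda>m. induced (W m) (N m) res_free),
      Frob = (\<lambda>m. induced (W m) (N m) (F_free p m Y)),
      Ver = (\<lambda>m. induced (W (Suc m)) (N (Suc m)) (V_free p m Y))\<rparr>)"

end

theory Submission
  imports Defs
begin

text \<open>Every level of the log de Rham-Witt complex is a quotient of a free ring on symbols \<open>s\<close>, \<open>ds\<close>,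
  \<open>dlog q\<close>. A procomplex \<open>E\<close> evaluates these symbols, and the axioms of \<open>E\<close> force the evaluation
  \<open>\<Phi>\<close> to commute with \<open>d\<close>, \<open>F\<close>, \<open>V\<close> and restriction; hence \<open>\<Phi>\<close> kills, level by level, every
  relation except perhaps \<open>d\<gamma>\<^sub>n(V\<xi>) = \<gamma>\<^sub>n\<^sub>-\<^sub>1(V\<xi>) dV\<xi>\<close>. The latter follows from \<open>p dV = V d\<close> and
  \<open>V(\<xi>\<^sup>n\<^sup>-\<^sup>1 d\<xi>) = V(\<xi>\<^sup>n\<^sup>-\<^sup>1) dV\<xi>\<close> whenever \<open>p\<close> divides \<open>p\<^sup>n\<^sup>-\<^sup>1/n!\<close>, and otherwise, for \<open>p = 2\<close>, from
  \<open>dV(\<xi>\<^sup>2) = V(\<xi> d\<xi>)\<close>, where \<open>dV(1) = 0\<close> because \<open>V(1)\<close> lies in the base. That the coefficients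
  \<open>p\<^sup>n\<^sup>-\<^sup>1/n!\<close> make sense needs the ring structure of \<open>W\<^sub>m(S)\<close>, which rests on Dwork's criterion for
  ghost components. Uniqueness holds because the symbols generate, once the defining ideals
  are known to be stable under \<open>d\<close>.\<close>

section \<open>Linear extension\<close>

text \<open>The obstacle is \<open>p\<close>-torsion. In \<open>S\<close> it prevents checking Witt
  vector identities on ghost components, so vectors are lifted to sequences of integral polynomials,
  which their ghost components determine. In \<open>E\<close> it prevents cancelling
  \<open>p\<close> from \<open>p dV = V d\<close>. With n! = p^k u, the relation for \<gamma>_n is
  proved after multiplication by the invertible u, and a factor \<open>p\<close> of p^(n-1-k) is
  spent on trading dV for V d. For n \<ge> 2 no factor is left exactly if k = n - 1; then p = 2 and
  n = 2j, and the formula for the square of \<xi>^j takes over.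

  Maps of quotients are evaluated on a representative chosen by \<open>SOME\<close>. For existence
  the choice is harmless once the evaluation vanishes on the defining ideals. For uniqueness it
  matters: a morphism is prescribed on the class of s and commutes with the differential, but this
  determines it on the class of ds only if d of an arbitrary representative of the first class lies
  in the second.\<close>

definition lin_ext :: "('a, 'm) ring_scheme \<Rightarrow> ('w \<Rightarrow> 'a) \<Rightarrow> ('w \<Rightarrow>\<^sub>0 int) \<Rightarrow> 'a" where
  "lin_ext A v f = (\<Oplus>\<^bsub>A\<^esub>w\<in>Poly_Mapping.keys f. [Poly_Mapping.lookup f w] \<cdot>\<^bsub>A\<^esub> v w)"

lemma frag_of_times: "frag_of (m::'w::monoid_add) * frag_of n = frag_of (m + n)"
  by (simp add: mult_single)

lemma frag_of_0: "frag_of (0::'w::monoid_add) = 1"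
  by (simp add: single_one)

context ring
begin

lemma lin_ext_superset:
  assumes "v \<in> UNIV \<rightarrow> carrier R" "finite K" "Poly_Mapping.keys f \<subseteq> K"
  shows "lin_ext R v f = (\<Oplus>w\<in>K. [Poly_Mapping.lookup f w] \<cdot> v w)"
  unfolding lin_ext_def
proof (rule add.finprod_mono_neutral_cong_left)
  show "(\<lambda>w. [Poly_Mapping.lookup f w] \<cdot> v w) \<in> K \<rightarrow> carrier R"
    using assms(1) by (auto intro!: add.int_pow_closed)
qed (use assms in \<open>auto simp: in_keys_iff add_pow_def\<close>)

lemma lin_ext_closed: "v \<in> UNIV \<rightarrow> carrier R \<Longrightarrow> lin_ext R v f \<in> carrier R"
  unfolding lin_ext_def by (auto intro!: add.finprod_closed add.int_pow_closed)

lemma lin_ext_add: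
  assumes "v \<in> UNIV \<rightarrow> carrier R"
  shows "lin_ext R v (f + g) = lin_ext R v f \<oplus> lin_ext R v g"
proof -
  let ?K = "Poly_Mapping.keys f \<union> Poly_Mapping.keys g"
  have c: "v w \<in> carrier R" for w using assms by auto
  have "lin_ext R v (f + g) = (\<Oplus>w\<in>?K. [Poly_Mapping.lookup (f + g) w] \<cdot> v w)"
    by (rule lin_ext_superset) (simp_all add: assms keys_add)
  also have "\<dots> = (\<Oplus>w\<in>?K. [Poly_Mapping.lookup f w] \<cdot> v w \<oplus> [Poly_Mapping.lookup g w] \<cdot> v w)"
    by (rule add.finprod_cong') (auto simp: c lookup_add add.int_pow_mult)
  also have "\<dots> = lin_ext R v f \<oplus> lin_ext R v g"
    by (subst add.finprod_multf)
       (auto simp: c intro!: arg_cong2[of _ _ _ _ "(\<oplus>)"] lin_ext_superset[symmetric] assms)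
  finally show ?thesis .
qed

lemma lin_ext_zero [simp]: "lin_ext R v 0 = \<zero>"
  by (simp add: lin_ext_def)

lemma lin_ext_diff:
  assumes "v \<in> UNIV \<rightarrow> carrier R"
  shows "lin_ext R v (f - g) = lin_ext R v f \<ominus> lin_ext R v g"
proof -
  have "lin_ext R v f = lin_ext R v (f - g) \<oplus> lin_ext R v g"
    by (simp add: lin_ext_add[OF assms, symmetric])
  then show ?thesis
    using lin_ext_closed[OF assms] by (simp add: a_minus_def a_assoc r_neg)
qed

lemma lin_ext_frag_of:
  assumes "v w \<in> carrier R"
  shows "lin_ext R v (frag_of w) = v w"
  by (simp add: lin_ext_def keys_frag_of assms add.finprod_singleton)

text \<open>The index monoid may be non-commutative: exponent functions give the evaluation of
  polynomials, words that of the free ring on symbols.\<close>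

lemma lin_ext_mult:
  fixes f g :: "'w::monoid_add \<Rightarrow>\<^sub>0 int"
  assumes v: "v \<in> UNIV \<rightarrow> carrier R" and m: "\<And>u w. v (u + w) = v u \<otimes> v w"
  shows "lin_ext R v (f * g) = lin_ext R v f \<otimes> lin_ext R v g"
proof -
  note c = lin_ext_closed[OF v]
  note d = lin_ext_diff[OF v]
  have vc: "lin_ext R v (frag_of w) = v w" for w by (rule lin_ext_frag_of) (use v in auto)
  have md: "x \<otimes> (y \<ominus> z) = x \<otimes> y \<ominus> x \<otimes> z" "(y \<ominus> z) \<otimes> x = y \<otimes> x \<ominus> z \<otimes> x"
    if "x \<in> carrier R" "y \<in> carrier R" "z \<in> carrier R" for x y z
    using that by (auto simp: a_minus_def r_distr l_distr r_minus l_minus)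
  have 1: "lin_ext R v (frag_of u * g) = lin_ext R v (frag_of u) \<otimes> lin_ext R v g" for u
    using subset_UNIV[of "Poly_Mapping.keys g"]
  proof (induction g rule: frag_induction)
    case (one x)
    then show ?case by (simp only: frag_of_times vc m)
  next
    case (diff a b)
    then show ?case by (simp only: right_diff_distrib d c md)
  qed (simp add: c)
  show ?thesis using subset_UNIV[of "Poly_Mapping.keys f"]
  proof (induction f rule: frag_induction)
    case (one x)
    show ?case by (rule 1)
  next
    case (diff a b)
    then show ?case by (simp only: left_diff_distrib d c md)
  qed (simp add: c)
qed

end

lemma lin_ext_hom:
  assumes "ring A" "ring B" "h \<in> ring_hom A B" "v \<in> UNIV \<rightarrow> carrier A"
  shows "h (lin_ext A v f) = lin_ext B (h \<circ> v) f"
proof -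
  interpret ring_hom_ring A B h using assms by (intro ring_hom_ringI2)
  have hv: "h \<circ> v \<in> UNIV \<rightarrow> carrier B" using assms(4) by (auto intro!: ring_hom_closed[OF assms(3)])
  have vc: "v w \<in> carrier A" for w using assms(4) by auto
  show ?thesis using subset_UNIV[of "Poly_Mapping.keys f"]
  proof (induction f rule: frag_induction)
    case (one x)
    then show ?case by (simp add: R.lin_ext_frag_of S.lin_ext_frag_of vc)
  next
    case (diff a b)
    then show ?case
      by (simp add: R.lin_ext_diff[OF assms(4)] S.lin_ext_diff[OF hv, unfolded comp_def] R.lin_ext_closed[OF assms(4)]
          a_minus_def)
  qed simp
qed

section \<open>Evaluation of integral polynomials in a commutative ring\<close>

lemma zeval_lin_ext:
  "zeval A f \<rho> = lin_ext A (\<lambda>m. \<Otimes>\<^bsub>A\<^esub>v\<in>Poly_Mapping.keys m. \<rho> v [^]\<^bsub>A\<^esub> Poly_Mapping.lookup m v) f"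
  by (simp add: zeval_def lin_ext_def)

text \<open>\<open>zeval\<close> takes a ring record without further fields, so the type is fixed
  accordingly.\<close>

locale plain_cring = cring R for R :: "'a ring" (structure)
begin

definition monom_val :: "('v \<Rightarrow> 'a) \<Rightarrow> ('v \<Rightarrow>\<^sub>0 nat) \<Rightarrow> 'a" where
  "monom_val \<rho> m = (\<Otimes>v\<in>Poly_Mapping.keys m. \<rho> v [^] Poly_Mapping.lookup m v)"

lemma zeval_monom_val: "zeval R f \<rho> = lin_ext R (monom_val \<rho>) f"
  by (simp add: zeval_lin_ext monom_val_def[abs_def])

lemma monom_val_superset:
  assumes "\<rho> \<in> UNIV \<rightarrow> carrier R" "finite K" "Poly_Mapping.keys f \<subseteq> K"
  shows "monom_val \<rho> f = (\<Otimes>w\<in>K. \<rho> w [^] Poly_Mapping.lookup f w)"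
  unfolding monom_val_def
  by (rule finprod_mono_neutral_cong_left) (use assms in \<open>auto simp: in_keys_iff\<close>)

lemma monom_val_closed: "\<rho> \<in> UNIV \<rightarrow> carrier R \<Longrightarrow> monom_val \<rho> \<in> UNIV \<rightarrow> carrier R"
  unfolding monom_val_def by (auto intro!: finprod_closed)

lemma monom_val_add:
  assumes "\<rho> \<in> UNIV \<rightarrow> carrier R"
  shows "monom_val \<rho> (m + n) = monom_val \<rho> m \<otimes> monom_val \<rho> n"
proof -
  let ?K = "Poly_Mapping.keys m \<union> Poly_Mapping.keys n"
  have c: "\<rho> w \<in> carrier R" for w using assms by auto
  have "monom_val \<rho> (m + n) = (\<Otimes>w\<in>?K. \<rho> w [^] Poly_Mapping.lookup (m + n) w)"
    by (rule monom_val_superset) (simp_all add: assms keys_add)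
  also have "\<dots> = (\<Otimes>w\<in>?K. \<rho> w [^] Poly_Mapping.lookup m w \<otimes> \<rho> w [^] Poly_Mapping.lookup n w)"
    by (rule finprod_cong') (auto simp: c lookup_add nat_pow_mult)
  also have "\<dots> = monom_val \<rho> m \<otimes> monom_val \<rho> n"
    by (subst finprod_multf)
       (auto simp: c intro!: arg_cong2[of _ _ _ _ "(\<otimes>)"] monom_val_superset[symmetric] assms)
  finally show ?thesis .
qed

context
  fixes \<rho> :: "'v \<Rightarrow> 'a"
  assumes \<rho>: "\<rho> \<in> UNIV \<rightarrow> carrier R"
begin

lemma zeval_closed: "zeval R f \<rho> \<in> carrier R"
  by (simp add: zeval_monom_val lin_ext_closed monom_val_closed \<rho>)

lemma zeval_add: "zeval R (f + g) \<rho> = zeval R f \<rho> \<oplus> zeval R g \<rho>"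
  by (simp add: zeval_monom_val lin_ext_add monom_val_closed \<rho>)

lemma zeval_mult: "zeval R (f * g) \<rho> = zeval R f \<rho> \<otimes> zeval R g \<rho>"
  by (simp add: zeval_monom_val lin_ext_mult monom_val_closed monom_val_add \<rho>)

lemma zeval_one: "zeval R 1 \<rho> = \<one>"
proof -
  have "monom_val \<rho> 0 = \<one>" by (simp add: monom_val_def)
  then show ?thesis
    by (simp add: zeval_monom_val frag_of_0[symmetric] lin_ext_frag_of del: single_one)
qed

lemma zeval_var: "zeval R (zvar v) \<rho> = \<rho> v"
proof -
  have "\<rho> v \<in> carrier R" using \<rho> by auto
  then have "monom_val \<rho> (Poly_Mapping.single v 1) = \<rho> v"
    by (simp add: monom_val_def)
  with \<open>\<rho> v \<in> carrier R\<close> show ?thesis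
    by (simp add: zeval_monom_val zvar_def lin_ext_frag_of)
qed

end

text \<open>Only \<open>\<rho>'\<close> has to be total with values in the carrier. Thus
  \<open>nth\<close> of a list, unspecified beyond its length, may be replaced by a genuine
  assignment as long as the polynomial uses only indices within the list.\<close>

lemma zeval_cong:
  assumes "\<And>m v. m \<in> Poly_Mapping.keys f \<Longrightarrow> v \<in> Poly_Mapping.keys m \<Longrightarrow> \<rho> v = \<rho>' v"
    and "\<rho>' \<in> UNIV \<rightarrow> carrier R"
  shows "zeval R f \<rho> = zeval R f \<rho>'"
proof -
  have "monom_val \<rho> m = monom_val \<rho>' m" if "m \<in> Poly_Mapping.keys f" for m
    unfolding monom_val_def by (rule finprod_cong') (use assms that in auto)
  then show ?thesis
    unfolding zeval_monom_val lin_ext_def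
    using monom_val_closed[OF assms(2)]
    by (intro add.finprod_cong') (auto intro!: add.int_pow_closed)
qed

end

lemma zeval_hom:
  assumes "cring A" "cring B" "h \<in> ring_hom A B" "\<rho> \<in> UNIV \<rightarrow> carrier A"
  shows "h (zeval A f \<rho>) = zeval B f (h \<circ> \<rho>)"
proof -
  interpret ring_hom_cring A B h using assms by (intro RingHom.ring_hom_cringI ring_hom_ringI2 cring.axioms(1)) auto
  interpret R: plain_cring A by unfold_locales
  have hr: "ring_hom_ring A B h"
    using assms by (intro ring_hom_ringI2 cring.axioms(1))
  interpret S: plain_cring B by unfold_locales
  have "h (R.monom_val \<rho> m) = S.monom_val (h \<circ> \<rho>) m" for m
    unfolding R.monom_val_def S.monom_val_def
    by (subst hom_finprod) (use assms(4) in \<open>auto simp: Pi_iff ring_hom_ring.hom_nat_pow[OF hr] intro!: S.finprod_cong'\<close>)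
  then have "h \<circ> R.monom_val \<rho> = S.monom_val (h \<circ> \<rho>)" by auto
  then show ?thesis
    using lin_ext_hom[OF R.ring_axioms S.ring_axioms assms(3) R.monom_val_closed[OF assms(4)]]
    by (simp add: R.zeval_monom_val S.zeval_monom_val)
qed

text \<open>Presents a \<open>comm_ring_1\<close> type as a ring record, so that
  \<open>zeval\<close> can also substitute polynomials into polynomials.\<close>

definition type_ring :: "'b::comm_ring_1 ring" where
  "type_ring = \<lparr>carrier = UNIV, monoid.mult = (*), one = 1, zero = 0, add = (+)\<rparr>"

lemma type_ring_simps [simp]:
  "carrier type_ring = UNIV" "monoid.mult type_ring = (*)" "one type_ring = 1"
  "zero type_ring = 0" "add type_ring = (+)"
  by (simp_all add: type_ring_def)

lemma cring_type_ring: "cring (type_ring :: 'b::comm_ring_1 ring)"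
proof (rule cringI)
  show "abelian_group (type_ring :: 'b ring)"
  proof (rule abelian_groupI)
    fix x :: 'b assume "x \<in> carrier type_ring"
    show "\<exists>y\<in>carrier type_ring. y \<oplus>\<^bsub>type_ring\<^esub> x = \<zero>\<^bsub>type_ring\<^esub>"
      by (rule bexI[of _ "- x"]) auto
  qed (auto simp: algebra_simps)
qed (auto simp: algebra_simps intro!: comm_monoidI)

section \<open>Integral polynomials with prescribed ghost components\<close>

interpretation type_ring: plain_cring "type_ring :: 'b::comm_ring_1 ring"
  by (intro plain_cring.intro cring_type_ring)

lemma type_ring_pow [simp]: "x [^]\<^bsub>type_ring\<^esub> (n::nat) = x ^ n"
  by (induction n) (auto simp: mult.commute)

lemma type_ring_finprod: "finite K \<Longrightarrow> finprod type_ring f K = prod f K"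
  by (induction K rule: finite_induct) auto

section \<open>Homomorphisms and monomials in the polynomial ring\<close>

abbreviation "class_hom \<equiv> ring_hom type_ring type_ring"

lemma class_hom_simps:
  assumes "h \<in> class_hom"
  shows "h (x + y) = h x + h y" "h (x * y) = h x * h y" "h 1 = 1"
  using ring_hom_add[OF assms] ring_hom_mult[OF assms] ring_hom_one[OF assms] by auto

lemma class_hom_zero: "h \<in> class_hom \<Longrightarrow> h 0 = 0"
  using class_hom_simps(1)[of h 0 0] by simp

lemma class_hom_diff: "h \<in> class_hom \<Longrightarrow> h (x - y) = h x - h y"
  using class_hom_simps(1)[of h "x - y" y] by (simp add: algebra_simps)

lemma class_hom_power: "h \<in> class_hom \<Longrightarrow> h (x ^ n) = h x ^ n"
  by (induction n) (simp_all add: class_hom_simps)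

lemma class_hom_of_nat: "h \<in> class_hom \<Longrightarrow> h (of_nat n) = of_nat n"
  by (induction n) (simp_all add: class_hom_simps class_hom_zero)

lemma class_hom_sum: "h \<in> class_hom \<Longrightarrow> h (sum f K) = (\<Sum>x\<in>K. h (f x))"
  by (induction K rule: infinite_finite_induct) (simp_all add: class_hom_simps class_hom_zero)

lemma zeval_class_hom: "(\<lambda>f. zeval type_ring f \<rho>) \<in> class_hom"
  by (rule ring_hom_memI)
     (simp_all add: type_ring.zeval_add type_ring.zeval_mult type_ring.zeval_one)

lemma ghost_hom: "h \<in> class_hom \<Longrightarrow> h (ghost p n x) = ghost p n (h \<circ> x)"
  by (simp add: ghost_def class_hom_sum class_hom_simps class_hom_power class_hom_of_nat)

lemma lookup_of_nat_times:
  "Poly_Mapping.lookup (of_nat k * f) w = int k * Poly_Mapping.lookup f w"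
  for f :: "'w::monoid_add \<Rightarrow>\<^sub>0 int"
  by (induction k) (auto simp: lookup_add algebra_simps)

lemma of_nat_times_cancel:
  fixes f g :: "'w::monoid_add \<Rightarrow>\<^sub>0 int"
  assumes "of_nat k * f = of_nat k * g" "k > 0"
  shows "f = g"
proof (rule poly_mapping_eqI)
  fix w
  have "int k * Poly_Mapping.lookup f w = int k * Poly_Mapping.lookup g w"
    by (simp only: lookup_of_nat_times[symmetric] assms(1))
  then show "Poly_Mapping.lookup f w = Poly_Mapping.lookup g w" using assms(2) by simp
qed

lemma zvar_power: "zvar v ^ n = frag_of (Poly_Mapping.single v n)"
proof (induction n)
  case (Suc n)
  have "zvar v * frag_of (Poly_Mapping.single v n) = frag_of (Poly_Mapping.single v 1 + Poly_Mapping.single v n)"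
    by (simp only: zvar_def frag_of_times)
  then show ?case using Suc by (simp add: single_add[symmetric])
qed (simp add: frag_of_0[symmetric] del: single_one)

lemma frag_of_sum: "finite K \<Longrightarrow> frag_of (\<Sum>v\<in>K. g v) = (\<Prod>v\<in>K. frag_of (g v))"
  for g :: "'k \<Rightarrow> 'w::comm_monoid_add"
  by (induction K rule: finite_induct) (simp_all add: frag_of_times[symmetric] frag_of_0)

lemma poly_mapping_as_sum:
  "(\<Sum>v\<in>Poly_Mapping.keys m. Poly_Mapping.single v (Poly_Mapping.lookup m v)) = m"
  by (rule poly_mapping_eqI) (simp add: lookup_sum lookup_single when_def in_keys_iff sum.delta)

lemma prod_zvar: "(\<Prod>v\<in>Poly_Mapping.keys m. zvar v ^ Poly_Mapping.lookup m v) = frag_of m"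
  by (simp add: zvar_power frag_of_sum[symmetric] poly_mapping_as_sum)

section \<open>Congruences modulo powers of \<open>p\<close> and Dwork's criterion\<close>

lemma binomial_power_cong:
  fixes a b :: "'b::comm_ring_1"
  assumes "Factorial_Ring.prime p"
  shows "of_nat p dvd (a + b) ^ p - (a ^ p + b ^ p)"
proof -
  have p0: "p > 0" using assms prime_gt_0_nat by blast
  have "(a + b) ^ p = (\<Sum>k\<le>p. of_nat (p choose k) * a ^ k * b ^ (p - k))"
    by (rule binomial_ring)
  also have "{..p} = insert 0 (insert p {0<..<p})" using p0 by auto
  also have "(\<Sum>k\<in>\<dots>. of_nat (p choose k) * a ^ k * b ^ (p - k))
      = b ^ p + a ^ p + (\<Sum>k\<in>{0<..<p}. of_nat (p choose k) * a ^ k * b ^ (p - k))"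
    using p0 by simp
  finally have "(a + b) ^ p - (a ^ p + b ^ p) =
      (\<Sum>k\<in>{0<..<p}. of_nat (p choose k) * a ^ k * b ^ (p - k))" by simp
  moreover have "of_nat p dvd (\<Sum>k\<in>{0<..<p}. of_nat (p choose k) * a ^ k * b ^ (p - k))"
  proof (rule dvd_sum)
    fix k assume "k \<in> {0<..<p}"
    then have "p dvd p choose k" using assms by (intro dvd_choose_prime) auto
    then have "of_nat p dvd (of_nat (p choose k) :: 'b)" by (auto elim!: dvdE)
    then show "of_nat p dvd of_nat (p choose k) * a ^ k * b ^ (p - k)"
      by (simp only: mult.assoc dvd_mult2)
  qed
  ultimately show ?thesis by simp
qed

text \<open>x^p - y^p is x - y times the sum of the y^(p-1-i) x^i. Modulo \<open>p\<close> one has x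
  = y, so this sum is p y^(p-1) = 0 and contributes one more factor \<open>p\<close>.\<close>

lemma power_cong_prime_power:
  fixes x y :: "'b::comm_ring_1"
  assumes "of_nat p ^ Suc k dvd x - y"
  shows "of_nat p ^ Suc (Suc k) dvd x ^ p - y ^ p"
proof -
  have px: "of_nat p dvd x ^ i - y ^ i" for i
  proof -
    have "of_nat p dvd x - y" using assms dvd_mult_left by fastforce
    also have "x - y dvd x ^ i - y ^ i" by (simp add: power_diff_sumr2)
    finally show ?thesis .
  qed
  have "(\<Sum>i<p. y ^ (p - Suc i) * x ^ i)
      = (\<Sum>i<p. y ^ (p - Suc i) * (x ^ i - y ^ i)) + (\<Sum>i<p. y ^ (p - Suc i) * y ^ i)"
    by (simp add: algebra_simps sum_subtractf)
  also have "(\<Sum>i<p. y ^ (p - Suc i) * y ^ i) = of_nat p * y ^ (p - 1)"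
    by (simp add: power_add[symmetric])
  finally have "of_nat p dvd (\<Sum>i<p. y ^ (p - Suc i) * x ^ i)"
    using px by (auto intro!: dvd_add dvd_sum)
  with assms have "of_nat p ^ Suc k * of_nat p dvd (x - y) * (\<Sum>i<p. y ^ (p - Suc i) * x ^ i)"
    by (rule mult_dvd_mono)
  then show ?thesis by (simp add: power_diff_sumr2 mult_ac)
qed

lemma power_cong_iterate:
  fixes x y :: "'b::comm_ring_1"
  assumes "of_nat p dvd x - y"
  shows "of_nat p ^ Suc n dvd x ^ p ^ n - y ^ p ^ n"
proof (induction n)
  case (Suc n)
  from power_cong_prime_power[OF this] show ?case by (simp add: power_mult[symmetric] mult.commute)
qed (use assms in simp)

text \<open>A lift to characteristic zero of the Frobenius of the polynomials modulo
  \<open>p\<close>, as Dwork's criterion requires.\<close>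

definition frob_lift :: "nat \<Rightarrow> 'v zpoly \<Rightarrow> 'v zpoly" where
  "frob_lift p f = zeval type_ring f (\<lambda>v. zvar v ^ p)"

lemma frob_lift_hom: "frob_lift p \<in> class_hom"
  unfolding frob_lift_def[abs_def] by (rule zeval_class_hom)

lemma frob_lift_var: "frob_lift p (zvar v) = zvar v ^ p"
  by (simp add: frob_lift_def type_ring.zeval_var)

lemma frob_lift_cong:
  assumes "Factorial_Ring.prime p"
  shows "of_nat p dvd f ^ p - frob_lift p f"
  using subset_UNIV[of "Poly_Mapping.keys f"]
proof (induction f rule: frag_induction)
  case zero
  then show ?case using assms by (simp add: class_hom_zero[OF frob_lift_hom] zero_power prime_gt_0_nat)
next
  case (one m)
  have "frob_lift p (frag_of m) = frag_of m ^ p"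
    unfolding frob_lift_def type_ring.zeval_monom_val prod_zvar[of m, symmetric]
    unfolding prod_zvar
    by (subst type_ring.lin_ext_frag_of)
       (simp_all add: type_ring.monom_val_def type_ring_finprod power_mult[symmetric]
         prod_zvar[of m, symmetric] prod_power_distrib mult.commute del: single_one)
  then show ?case by simp
next
  case (diff a b)
  \<comment> \<open>Expanding a = (a - b) + b instead of a - b uses the binomial congruence for sums
    and leaves no sign (-1)^p to discuss.\<close>
  have "(a - b) ^ p - (frob_lift p a - frob_lift p b) = (a ^ p - frob_lift p a) - (b ^ p - frob_lift p b)
      - (((a - b) + b) ^ p - ((a - b) ^ p + b ^ p))" by simp
  also have "of_nat p dvd \<dots>"
    by (rule dvd_diff[OF dvd_diff[OF diff] binomial_power_cong[OF assms]])
  finally show ?case by (simp add: class_hom_diff[OF frob_lift_hom])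
qed

lemma ghost_last: "ghost p n x = (\<Sum>i<n. of_nat p ^ i * x i ^ (p ^ (n - i))) + of_nat p ^ n * x n"
  by (simp add: ghost_def lessThan_Suc_atMost[symmetric])

lemma ghost_cong: "(\<And>i. i \<le> n \<Longrightarrow> x i = y i) \<Longrightarrow> ghost p n x = ghost p n y"
  by (simp add: ghost_def)

text \<open>The k-th ghost component is p^k times the k-th entry plus terms in earlier entries, and
  p^k can be cancelled in a polynomial ring over the integers.\<close>

lemma ghost_inj_upto:
  fixes s t :: "nat \<Rightarrow> 'v zpoly"
  assumes "p > 0" "\<And>k. k \<le> n \<Longrightarrow> ghost p k s = ghost p k t"
  shows "k \<le> n \<Longrightarrow> s k = t k"
proof (induction k rule: less_induct)
  case (less k)
  have "(\<Sum>i<k. of_nat p ^ i * s i ^ (p ^ (k - i))) = (\<Sum>i<k. of_nat p ^ i * t i ^ (p ^ (k - i)))"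
    using less by (intro sum.cong) auto
  with assms(2)[OF less.prems] have "of_nat (p ^ k) * s k = of_nat (p ^ k) * t k"
    by (simp add: ghost_last)
  then show ?case by (rule of_nat_times_cancel) (use assms(1) in simp)
qed

lemma ghost_inj:
  fixes s t :: "nat \<Rightarrow> 'v zpoly"
  assumes "p > 0" "\<And>k. ghost p k s = ghost p k t"
  shows "s = t"
  using ghost_inj_upto[of p _ s t] assms by (metis ext order_refl)

text \<open>Dwork's criterion. The entry of index n + 1 must be T(n+1) minus the terms p^i
  s_i^(p^(n+1-i)), i \<le> n, divided by p^(n+1). Modulo p^(n+1) those terms add up to the Frobenius
  lift of T(n): s_i^p agrees with the lift of s_i modulo \<open>p\<close>, raising to the power
  p^(n-i) gains n - i factors, and the coefficient p^i gives the others.\<close>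

lemma ghost_surj:
  fixes T :: "nat \<Rightarrow> 'v zpoly"
  assumes p: "Factorial_Ring.prime p"
    and T: "\<And>n. of_nat p ^ Suc n dvd T (Suc n) - frob_lift p (T n)"
  shows "\<exists>s. \<forall>n. ghost p n s = T n"
proof -
  have p0: "p > 0" using p prime_gt_0_nat by blast
  have ex: "\<exists>s. \<forall>k\<le>n. ghost p k s = T k" for n
  proof (induction n)
    case 0
    then show ?case by (intro exI[of _ "\<lambda>_. T 0"]) (simp add: ghost_def)
  next
    case (Suc n)
    then obtain s where s: "\<And>k. k \<le> n \<Longrightarrow> ghost p k s = T k" by blast
    let ?B = "\<Sum>i\<le>n. of_nat p ^ i * s i ^ (p ^ (Suc n - i))"
    have "frob_lift p (T n) = (\<Sum>i\<le>n. of_nat p ^ i * frob_lift p (s i) ^ p ^ (n - i))"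
      unfolding s[OF order_refl, symmetric] ghost_hom[OF frob_lift_hom] by (simp add: ghost_def)
    then have "?B - frob_lift p (T n) = (\<Sum>i\<le>n. of_nat p ^ i *
        ((s i ^ p) ^ p ^ (n - i) - frob_lift p (s i) ^ p ^ (n - i)))"
      by (simp add: sum_subtractf right_diff_distrib Suc_diff_le power_mult)
    also have "of_nat p ^ Suc n dvd \<dots>"
    proof (rule dvd_sum)
      fix i assume i: "i \<in> {..n}"
      have "of_nat p ^ i * of_nat p ^ Suc (n - i) dvd of_nat p ^ i *
          ((s i ^ p) ^ p ^ (n - i) - frob_lift p (s i) ^ p ^ (n - i))"
        by (intro mult_dvd_mono dvd_refl power_cong_iterate frob_lift_cong p)
      then show "of_nat p ^ Suc n dvd of_nat p ^ i *
          ((s i ^ p) ^ p ^ (n - i) - frob_lift p (s i) ^ p ^ (n - i))"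
        using i by (simp add: power_add[symmetric] del: power_Suc)
    qed
    finally have "of_nat p ^ Suc n dvd (T (Suc n) - frob_lift p (T n)) - (?B - frob_lift p (T n))"
      using T[of n] by (rule dvd_diff[rotated])
    then obtain q where q: "T (Suc n) - ?B = of_nat p ^ Suc n * q" by (auto elim!: dvdE)
    define s' where "s' = s(Suc n := q)"
    have "ghost p (Suc n) s' = (\<Sum>i<Suc n. of_nat p ^ i * s i ^ (p ^ (Suc n - i))) + of_nat p ^ Suc n * q"
      unfolding ghost_last s'_def by (intro arg_cong2[of _ _ _ _ "(+)"] sum.cong) auto
    also have "\<dots> = T (Suc n)" using q by (simp add: lessThan_Suc_atMost algebra_simps)
    finally have "ghost p (Suc n) s' = T (Suc n)" .
    moreover have "ghost p k s' = T k" if "k \<le> n" for k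
      using s[OF that] that by (subst ghost_cong[of k s' s]) (auto simp: s'_def)
    ultimately show ?case by (auto simp: le_Suc_eq)
  qed
  then obtain S where S: "\<And>n k. k \<le> n \<Longrightarrow> ghost p k (S n) = T k" by metis
  \<comment> \<open>The solutions obtained for different n are a priori unrelated; injectivity of
    the ghost map makes them agree, so that the diagonal solves all equations at once.\<close>
  have diag: "S n k = S k k" if "k \<le> n" for n k
    using ghost_inj_upto[of p k "S n" "S k" k] S that p0 by auto
  have "ghost p n (\<lambda>k. S k k) = ghost p n (S n)" for n
    by (rule ghost_cong) (rule diag[symmetric])
  then have "ghost p n (\<lambda>k. S k k) = T n" for n
    using S[OF order_refl, of n] by simp
  then show ?thesis by blast
qed

lemma ghost_with_ghost:
  assumes "Factorial_Ring.prime p" "\<And>n. of_nat p ^ Suc n dvd T (Suc n) - frob_lift p (T n)"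
  shows "ghost p n (with_ghost p T) = T n"
proof -
  have p0: "p > 0" using assms prime_gt_0_nat by blast
  obtain s where s: "\<And>n. ghost p n s = T n" using ghost_surj[OF assms] by blast
  have "with_ghost p T = s"
    unfolding with_ghost_def
    by (rule the_equality) (use s in \<open>auto intro: ghost_inj[OF p0]\<close>)
  then show ?thesis using s by simp
qed

text \<open>On variables, the lift of the n-th ghost component is the component of index n + 1
  without its last term, which carries the factor p^(n+1).\<close>

lemma frob_lift_ghost_var:
  "of_nat p ^ Suc n dvd ghost p (Suc n) (\<lambda>i. zvar (c i)) - frob_lift p (ghost p n (\<lambda>i. zvar (c i)))"
proof -
  have "frob_lift p (ghost p n (\<lambda>i. zvar (c i)))
      = (\<Sum>i<Suc n. of_nat p ^ i * zvar (c i) ^ (p ^ (Suc n - i)))"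
    unfolding ghost_hom[OF frob_lift_hom]
    by (simp add: ghost_def frob_lift_var power_mult[symmetric] Suc_diff_le
        lessThan_Suc_atMost[symmetric])
  then show ?thesis by (simp only: ghost_last[of p "Suc n"]) simp
qed

context
  fixes p :: nat
  assumes prime_p: "Factorial_Ring.prime p"
begin

lemma ghost_add_poly:
  "ghost p n (witt_add_poly p) = ghost p n (\<lambda>i. zvar (Inl i)) + ghost p n (\<lambda>i. zvar (Inr i))"
  unfolding witt_add_poly_def
proof (rule ghost_with_ghost[OF prime_p], goal_cases)
  case (1 n)
  show ?case
    using dvd_add[OF frob_lift_ghost_var[of p n Inl] frob_lift_ghost_var[of p n Inr]]
    by (simp add: class_hom_simps[OF frob_lift_hom] algebra_simps)
qed

lemma ghost_mult_poly:
  "ghost p n (witt_mult_poly p) = ghost p n (\<lambda>i. zvar (Inl i)) * ghost p n (\<lambda>i. zvar (Inr i))"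
  unfolding witt_mult_poly_def
proof (rule ghost_with_ghost[OF prime_p], goal_cases)
  case (1 n)
  have e: "a * b - a' * b' = a * (b - b') + (a - a') * b'" for a b a' b' :: "'b zpoly"
    by (simp add: algebra_simps)
  show ?case
    unfolding class_hom_simps[OF frob_lift_hom] e
    by (intro dvd_add dvd_mult dvd_mult2 frob_lift_ghost_var)
qed

lemma ghost_frob_poly: "ghost p n (witt_frob_poly p) = ghost p (Suc n) zvar"
  unfolding witt_frob_poly_def
proof (rule ghost_with_ghost[OF prime_p], goal_cases)
  case (1 n)
  show ?case
    by (rule dvd_trans[OF _ frob_lift_ghost_var[of p "Suc n" "\<lambda>i. i"]]) (simp add: dvd_def mult_ac)
qed

text \<open>Provides additive inverses of Witt vectors. For p = 2 negation is not componentwise,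
  hence the appeal to Dwork's criterion.\<close>

lemma ghost_neg_poly: "\<exists>s. \<forall>n. ghost p n s = - ghost p n zvar"
proof (rule ghost_surj[OF prime_p])
  fix n
  have "frob_lift p (- f) = - frob_lift p f" for f :: "nat zpoly"
    using class_hom_diff[OF frob_lift_hom, of p 0 f] by (simp add: class_hom_zero[OF frob_lift_hom])
  then have "- ghost p (Suc n) zvar - frob_lift p (- ghost p n zvar)
      = - (ghost p (Suc n) zvar - frob_lift p (ghost p n zvar))" by simp
  then show "of_nat p ^ Suc n dvd - ghost p (Suc n) zvar - frob_lift p (- ghost p n zvar)"
    using frob_lift_ghost_var[of p n "\<lambda>i. i"] by (metis dvd_minus_iff)
qed

end

section \<open>Variables occurring in the Witt polynomials\<close>

definition vars_in :: "'v set \<Rightarrow> 'v zpoly \<Rightarrow> bool" where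
  "vars_in V f \<longleftrightarrow> (\<forall>m\<in>Poly_Mapping.keys f. Poly_Mapping.keys m \<subseteq> V)"

lemma vars_in_add: "vars_in V f \<Longrightarrow> vars_in V g \<Longrightarrow> vars_in V (f + g)"
  using keys_add[of f g] by (auto simp: vars_in_def)

lemma vars_in_diff: "vars_in V f \<Longrightarrow> vars_in V g \<Longrightarrow> vars_in V (f - g)"
  using keys_diff[of f g] by (auto simp: vars_in_def)

lemma vars_in_mult:
  assumes "vars_in V f" "vars_in V g"
  shows "vars_in V (f * g)"
  unfolding vars_in_def
proof
  fix m assume "m \<in> Poly_Mapping.keys (f * g)"
  with keys_mult[of f g] obtain a b where
    "a \<in> Poly_Mapping.keys f" "b \<in> Poly_Mapping.keys g" "m = a + b" by blast
  then show "Poly_Mapping.keys m \<subseteq> V"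
    using assms keys_add[of a b] by (fastforce simp: vars_in_def)
qed

lemma vars_in_one: "vars_in V 1" by (simp add: vars_in_def)

lemma vars_in_power: "vars_in V f \<Longrightarrow> vars_in V (f ^ n)"
  by (induction n) (auto intro: vars_in_mult vars_in_one)

lemma vars_in_sum: "(\<And>i. i \<in> K \<Longrightarrow> vars_in V (f i)) \<Longrightarrow> vars_in V (sum f K)"
  by (induction K rule: infinite_finite_induct) (auto intro: vars_in_add simp: vars_in_def[of _ 0])

lemma vars_in_of_nat: "vars_in V (of_nat n)"
  by (induction n) (auto intro: vars_in_add vars_in_one simp: vars_in_def[of _ 0])

lemma vars_in_zvar: "v \<in> V \<Longrightarrow> vars_in V (zvar v)"
  by (simp add: vars_in_def zvar_def)

lemma vars_in_mono: "vars_in V f \<Longrightarrow> V \<subseteq> W \<Longrightarrow> vars_in W f"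
  by (auto simp: vars_in_def)

lemma vars_in_cancel: "vars_in V (of_nat k * f) \<Longrightarrow> k > 0 \<Longrightarrow> vars_in V f"
  by (auto simp: vars_in_def in_keys_iff lookup_of_nat_times)

lemma vars_in_ghost: "(\<And>i. i \<le> n \<Longrightarrow> vars_in V (x i)) \<Longrightarrow> vars_in V (ghost p n x)"
  unfolding ghost_def of_nat_power[symmetric]
  by (intro vars_in_sum vars_in_mult vars_in_power vars_in_of_nat) auto

text \<open>The n-th entry is the n-th ghost component minus terms in earlier entries, divided by
  p^n, and division by an integer leaves the set of monomials unchanged.\<close>

lemma vars_in_of_ghost:
  assumes "p > 0" "\<And>n. vars_in (V n) (ghost p n s)" "mono V"
  shows "vars_in (V n) (s n)"
proof (induction n rule: less_induct)
  case (less n)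
  have "vars_in (V n) (s i)" if "i < n" for i
    using less[OF that] monoD[OF assms(3), of i n] that by (auto intro: vars_in_mono)
  then have "vars_in (V n) (ghost p n s - (\<Sum>i<n. of_nat (p ^ i) * s i ^ (p ^ (n - i))))"
    using assms by (intro vars_in_diff vars_in_sum vars_in_mult vars_in_power vars_in_of_nat) auto
  then have "vars_in (V n) (of_nat (p ^ n) * s n)"
    by (simp add: ghost_last)
  then show ?case by (rule vars_in_cancel) (use assms in simp)
qed

lemma vars_in_witt_add:
  "Factorial_Ring.prime p \<Longrightarrow> vars_in (Inl ` {..n} \<union> Inr ` {..n}) (witt_add_poly p n)"
  by (rule vars_in_of_ghost[of p "\<lambda>n. Inl ` {..n} \<union> Inr ` {..n}"])
     (auto simp: prime_gt_0_nat ghost_add_poly mono_def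
       intro!: vars_in_add vars_in_ghost vars_in_zvar)

lemma vars_in_witt_mult:
  "Factorial_Ring.prime p \<Longrightarrow> vars_in (Inl ` {..n} \<union> Inr ` {..n}) (witt_mult_poly p n)"
  by (rule vars_in_of_ghost[of p "\<lambda>n. Inl ` {..n} \<union> Inr ` {..n}"])
     (auto simp: prime_gt_0_nat ghost_mult_poly mono_def
       intro!: vars_in_mult vars_in_ghost vars_in_zvar)

lemma vars_in_witt_frob:
  "Factorial_Ring.prime p \<Longrightarrow> vars_in {..Suc n} (witt_frob_poly p n)"
  by (rule vars_in_of_ghost[of p "\<lambda>n. {..Suc n}"])
     (auto simp: prime_gt_0_nat ghost_frob_poly mono_def
       intro!: vars_in_ghost vars_in_zvar)

section \<open>The ring of truncated Witt vectors\<close>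

lemma witt_simps:
  "carrier (witt p m A) = {a. length a = m \<and> set a \<subseteq> carrier A}"
  "a \<otimes>\<^bsub>witt p m A\<^esub> b = map (\<lambda>n. zeval A (witt_mult_poly p n) (case_sum (nth a) (nth b))) [0..<m]"
  "\<one>\<^bsub>witt p m A\<^esub> = teich m A \<one>\<^bsub>A\<^esub>"
  "\<zero>\<^bsub>witt p m A\<^esub> = replicate m \<zero>\<^bsub>A\<^esub>"
  "a \<oplus>\<^bsub>witt p m A\<^esub> b = map (\<lambda>n. zeval A (witt_add_poly p n) (case_sum (nth a) (nth b))) [0..<m]"
  by (simp_all add: witt_def)

text \<open>The Witt vector operations over a polynomial ring, on untruncated sequences; it is to
  these that the injectivity of the ghost map applies.\<close>

definition seq_add :: "nat \<Rightarrow> (nat \<Rightarrow> 'v zpoly) \<Rightarrow> (nat \<Rightarrow> 'v zpoly) \<Rightarrow> nat \<Rightarrow> 'v zpoly" where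
  "seq_add p a b = (\<lambda>n. zeval type_ring (witt_add_poly p n) (case_sum a b))"

definition seq_mult :: "nat \<Rightarrow> (nat \<Rightarrow> 'v zpoly) \<Rightarrow> (nat \<Rightarrow> 'v zpoly) \<Rightarrow> nat \<Rightarrow> 'v zpoly" where
  "seq_mult p a b = (\<lambda>n. zeval type_ring (witt_mult_poly p n) (case_sum a b))"

definition seq_frob :: "nat \<Rightarrow> (nat \<Rightarrow> 'v zpoly) \<Rightarrow> nat \<Rightarrow> 'v zpoly" where
  "seq_frob p a = (\<lambda>n. zeval type_ring (witt_frob_poly p n) a)"

lemma ghost_zeval:
  "ghost p n (\<lambda>i. zeval type_ring (s i) \<rho>) = zeval type_ring (ghost p n s) \<rho>"
  using ghost_hom[OF zeval_class_hom[of \<rho>], of p n s] by (simp add: comp_def)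

lemma zeval_ghost_var:
  "zeval type_ring (ghost p n (\<lambda>i. zvar (c i))) \<rho> = ghost p n (\<lambda>i. \<rho> (c i))"
  by (simp add: ghost_zeval[symmetric] type_ring.zeval_var)

locale witt_base = plain_cring R for R :: "'a ring" (structure) +
  fixes p :: nat
  assumes prime_p: "Factorial_Ring.prime p"
begin

lemma p_pos: "p > 0" using prime_p prime_gt_0_nat by blast

lemma ghost_seq_add: "ghost p n (seq_add p a b) = ghost p n a + ghost p n b"
  unfolding seq_add_def ghost_zeval ghost_add_poly[OF prime_p]
  by (simp add: type_ring.zeval_add zeval_ghost_var)

lemma ghost_seq_mult: "ghost p n (seq_mult p a b) = ghost p n a * ghost p n b"
  unfolding seq_mult_def ghost_zeval ghost_mult_poly[OF prime_p]
  by (simp add: type_ring.zeval_mult zeval_ghost_var)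

lemma ghost_seq_frob: "ghost p n (seq_frob p a) = ghost p (Suc n) a"
  unfolding seq_frob_def ghost_zeval ghost_frob_poly[OF prime_p]
  by (simp add: zeval_ghost_var)

lemma ghost_seq_neg: "\<exists>b. \<forall>n. ghost p n b = - ghost p n a"
proof -
  obtain s where s: "\<And>n. ghost p n s = - ghost p n zvar"
    using ghost_neg_poly[OF prime_p] by blast
  have "zeval type_ring (- f) a = - zeval type_ring f a" for f
    using class_hom_diff[OF zeval_class_hom, of 0 f a] class_hom_zero[OF zeval_class_hom, of a] by simp
  then have "ghost p n (\<lambda>i. zeval type_ring (s i) a) = - ghost p n a" for n
    by (simp add: ghost_zeval s zeval_ghost_var)
  then show ?thesis by blast
qed

lemma zero_power_p: "0 ^ p ^ k = (0::'b::comm_ring_1)"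
  by (rule zero_power) (use p_pos in simp)

lemma ghost_zero: "ghost p n (\<lambda>_. 0) = 0"
  by (simp add: ghost_def zero_power_p)

text \<open>\<open>case_nat x (\<lambda>_. 0)\<close> is the Teichmueller lift of x as a sequence,
  and in what follows \<open>case_nat 0 a\<close> is the Verschiebung of a.\<close>

lemma ghost_teich: "ghost p n (case_nat x (\<lambda>_. 0)) = x ^ p ^ n"
proof -
  have "ghost p n (case_nat x (\<lambda>_. 0)) = (\<Sum>i\<in>{0}. of_nat p ^ i * case_nat x (\<lambda>_. 0) i ^ p ^ (n - i))"
    unfolding ghost_def
    by (rule sum.mono_neutral_right) (auto simp: zero_power_p split: nat.split)
  then show ?thesis by simp
qed

lemma ghost_V: "ghost p (Suc n) (case_nat 0 a) = of_nat p * ghost p n a"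
  unfolding ghost_def sum.atMost_Suc_shift
  by (simp add: sum_distrib_left mult.assoc zero_power_p del: power_Suc)
    (simp add: mult.assoc)

lemma ghost_V_0: "ghost p 0 (case_nat 0 a) = 0"
  by (simp add: ghost_def)

text \<open>Every truncated Witt vector over \<open>R\<close> is the image of a sequence of polynomials in the
  variables \<open>x \<in> R\<close>, a ring without \<open>p\<close>-torsion, where identities may be checked on ghost
  components.\<close>

definition ev :: "'a zpoly \<Rightarrow> 'a" where
  "ev f = zeval R f (\<lambda>x. if x \<in> carrier R then x else \<zero>)"

definition trunc :: "nat \<Rightarrow> (nat \<Rightarrow> 'a zpoly) \<Rightarrow> 'a list" where
  "trunc m a = map (\<lambda>i. ev (a i)) [0..<m]"

text \<open>Variables outside the carrier are sent to zero, which makes \<open>ev\<close> a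
  homomorphism on all polynomials over the type.\<close>

lemma ev_hom: "ev \<in> ring_hom type_ring R"
  unfolding ev_def[abs_def]
  by (rule ring_hom_memI) (simp_all add: zeval_closed zeval_add zeval_mult zeval_one)

lemma ev_closed: "ev f \<in> carrier R"
  by (simp add: ev_def zeval_closed)

lemma ev_simps: "ev (f + g) = ev f \<oplus> ev g" "ev (f * g) = ev f \<otimes> ev g" "ev 1 = \<one>" "ev 0 = \<zero>"
  using ring_hom_add[OF ev_hom] ring_hom_mult[OF ev_hom] ring_hom_one[OF ev_hom]
    ring_hom_zero[OF ev_hom type_ring.ring_axioms ring_axioms] by auto

lemma ev_var: "x \<in> carrier R \<Longrightarrow> ev (zvar x) = x"
  by (simp add: ev_def zeval_var)

lemma ev_zeval: "ev (zeval type_ring f \<rho>) = zeval R f (ev \<circ> \<rho>)"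
  by (rule zeval_hom) (auto simp: ev_hom cring_type_ring is_cring)

lemma trunc_carrier: "trunc m a \<in> carrier (witt p m R)"
  by (auto simp: witt_simps trunc_def ev_closed)

lemma trunc_surj:
  assumes "x \<in> carrier (witt p m R)"
  obtains a where "x = trunc m a"
proof
  \<comment> \<open>Each entry is lifted to the variable it names. Entries of index at least m are
    arbitrary but cut off by \<open>trunc\<close>.\<close>
  show "x = trunc m (\<lambda>i. zvar (x ! i))"
    using assms by (intro nth_equalityI) (auto simp: witt_simps trunc_def ev_var subset_iff)
qed

text \<open>The n-th polynomial only sees entries of index at most n, so evaluation on the truncated
  lists agrees with evaluation on the whole sequences. For the Frobenius, which looks one index
  further, one entry is lost.\<close>

lemma trunc_add: "trunc m a \<oplus>\<^bsub>witt p m R\<^esub> trunc m b = trunc m (seq_add p a b)"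
proof -
  have "zeval R (witt_add_poly p n) (case_sum (nth (trunc m a)) (nth (trunc m b)))
      = zeval R (witt_add_poly p n) (ev \<circ> case_sum a b)" if "n < m" for n
    using vars_in_witt_add[OF prime_p, of n] that
    by (intro zeval_cong) (fastforce simp: vars_in_def trunc_def ev_closed)+
  then show ?thesis
    by (simp add: witt_simps trunc_def seq_add_def ev_zeval)
qed

lemma trunc_mult: "trunc m a \<otimes>\<^bsub>witt p m R\<^esub> trunc m b = trunc m (seq_mult p a b)"
proof -
  have "zeval R (witt_mult_poly p n) (case_sum (nth (trunc m a)) (nth (trunc m b)))
      = zeval R (witt_mult_poly p n) (ev \<circ> case_sum a b)" if "n < m" for n
    using vars_in_witt_mult[OF prime_p, of n] that
    by (intro zeval_cong) (fastforce simp: vars_in_def trunc_def ev_closed)+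
  then show ?thesis
    by (simp add: witt_simps trunc_def seq_mult_def ev_zeval)
qed

lemma trunc_frob: "witt_F p m R (trunc (Suc m) a) = trunc m (seq_frob p a)"
proof -
  have "zeval R (witt_frob_poly p n) (nth (trunc (Suc m) a))
      = zeval R (witt_frob_poly p n) (ev \<circ> a)" if "n < m" for n
    using vars_in_witt_frob[OF prime_p, of n] that
    by (intro zeval_cong) (fastforce simp: vars_in_def trunc_def ev_closed simp del: upt_Suc)+
  then show ?thesis
    by (simp add: witt_F_def trunc_def seq_frob_def ev_zeval)
qed

lemma trunc_V: "witt_V R (trunc m a) = trunc (Suc m) (case_nat 0 a)"
  by (simp add: witt_V_def trunc_def map_upt_Suc ev_simps del: upt_Suc)

lemma trunc_teich: "teich m R (ev x) = trunc m (case_nat x (\<lambda>_. 0))"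
  by (auto simp: teich_def trunc_def ev_simps split: nat.split)

lemma trunc_zero: "\<zero>\<^bsub>witt p m R\<^esub> = trunc m (\<lambda>_. 0)"
  by (auto simp: witt_simps trunc_def ev_simps intro: nth_equalityI)

lemma trunc_one: "\<one>\<^bsub>witt p m R\<^esub> = trunc m (case_nat 1 (\<lambda>_. 0))"
  by (simp add: witt_simps trunc_teich[symmetric] ev_simps)

lemma seq_eqI: "(\<And>n. ghost p n a = ghost p n b) \<Longrightarrow> a = b"
  for a b :: "nat \<Rightarrow> 'v zpoly"
  by (rule ghost_inj[OF p_pos])

lemmas ghost_seq = ghost_seq_add ghost_seq_mult ghost_seq_frob ghost_teich ghost_zero

text \<open>On lifted sequences, the ghost components turn both sides of each axiom into the
  corresponding identity of a commutative ring; injectivity of the ghost map and truncation bring it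
  back.\<close>

lemma cring_witt: "cring (witt p m R)"
proof (rule cringI)
  show "abelian_group (witt p m R)"
  proof (rule abelian_groupI)
    fix x y assume "x \<in> carrier (witt p m R)" "y \<in> carrier (witt p m R)"
    then obtain a b where ab: "x = trunc m a" "y = trunc m b" by (metis trunc_surj)
    show "x \<oplus>\<^bsub>witt p m R\<^esub> y \<in> carrier (witt p m R)"
      by (simp add: ab trunc_add trunc_carrier)
    show "x \<oplus>\<^bsub>witt p m R\<^esub> y = y \<oplus>\<^bsub>witt p m R\<^esub> x"
      unfolding ab trunc_add
      by (rule arg_cong[of _ _ "trunc m"], rule seq_eqI) (simp add: ghost_seq)
    fix z assume "z \<in> carrier (witt p m R)"
    then obtain c where c: "z = trunc m c" by (metis trunc_surj)
    show "x \<oplus>\<^bsub>witt p m R\<^esub> y \<oplus>\<^bsub>witt p m R\<^esub> z = x \<oplus>\<^bsub>witt p m R\<^esub> (y \<oplus>\<^bsub>witt p m R\<^esub> z)"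
      unfolding ab c trunc_add
      by (rule arg_cong[of _ _ "trunc m"], rule seq_eqI) (simp add: ghost_seq)
  next
    fix x assume "x \<in> carrier (witt p m R)"
    then obtain a where a: "x = trunc m a" by (metis trunc_surj)
    show "\<zero>\<^bsub>witt p m R\<^esub> \<oplus>\<^bsub>witt p m R\<^esub> x = x"
      unfolding a trunc_add trunc_zero
      by (rule arg_cong[of _ _ "trunc m"], rule seq_eqI) (simp add: ghost_seq)
    obtain b where b: "\<And>n. ghost p n b = - ghost p n a" using ghost_seq_neg[of a] by blast
    have "trunc m b \<oplus>\<^bsub>witt p m R\<^esub> x = \<zero>\<^bsub>witt p m R\<^esub>"
      unfolding a trunc_add trunc_zero
      by (rule arg_cong[of _ _ "trunc m"], rule seq_eqI) (simp add: ghost_seq b)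
    then show "\<exists>y\<in>carrier (witt p m R). y \<oplus>\<^bsub>witt p m R\<^esub> x = \<zero>\<^bsub>witt p m R\<^esub>"
      using trunc_carrier by blast
  qed (simp add: trunc_zero trunc_carrier)
  show "comm_monoid (witt p m R)"
  proof (rule comm_monoidI)
    fix x y assume "x \<in> carrier (witt p m R)" "y \<in> carrier (witt p m R)"
    then obtain a b where ab: "x = trunc m a" "y = trunc m b" by (metis trunc_surj)
    show "x \<otimes>\<^bsub>witt p m R\<^esub> y \<in> carrier (witt p m R)"
      by (simp add: ab trunc_mult trunc_carrier)
    show "x \<otimes>\<^bsub>witt p m R\<^esub> y = y \<otimes>\<^bsub>witt p m R\<^esub> x"
      unfolding ab trunc_mult
      by (rule arg_cong[of _ _ "trunc m"], rule seq_eqI) (simp add: ghost_seq)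
    fix z assume "z \<in> carrier (witt p m R)"
    then obtain c where c: "z = trunc m c" by (metis trunc_surj)
    show "x \<otimes>\<^bsub>witt p m R\<^esub> y \<otimes>\<^bsub>witt p m R\<^esub> z = x \<otimes>\<^bsub>witt p m R\<^esub> (y \<otimes>\<^bsub>witt p m R\<^esub> z)"
      unfolding ab c trunc_mult
      by (rule arg_cong[of _ _ "trunc m"], rule seq_eqI) (simp add: ghost_seq)
  next
    fix x assume "x \<in> carrier (witt p m R)"
    then obtain a where a: "x = trunc m a" by (metis trunc_surj)
    show "\<one>\<^bsub>witt p m R\<^esub> \<otimes>\<^bsub>witt p m R\<^esub> x = x"
      unfolding a trunc_mult trunc_one
      by (rule arg_cong[of _ _ "trunc m"], rule seq_eqI) (simp add: ghost_seq)
  qed (simp add: trunc_one trunc_carrier)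
  fix x y z
  assume "x \<in> carrier (witt p m R)" "y \<in> carrier (witt p m R)" "z \<in> carrier (witt p m R)"
  then obtain a b c where abc: "x = trunc m a" "y = trunc m b" "z = trunc m c" by (metis trunc_surj)
  show "(x \<oplus>\<^bsub>witt p m R\<^esub> y) \<otimes>\<^bsub>witt p m R\<^esub> z =
      x \<otimes>\<^bsub>witt p m R\<^esub> z \<oplus>\<^bsub>witt p m R\<^esub> y \<otimes>\<^bsub>witt p m R\<^esub> z"
    unfolding abc trunc_add trunc_mult
    by (rule arg_cong[of _ _ "trunc m"], rule seq_eqI) (simp add: ghost_seq algebra_simps)
qed

section \<open>Teichmueller lifts, Verschiebung and division in truncated Witt vectors\<close>

lemma teich_closed: "x \<in> carrier R \<Longrightarrow> teich m R x \<in> carrier (witt p m R)"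
  by (auto simp: witt_simps teich_def)

lemma witt_V_closed: "\<xi> \<in> carrier (witt p m R) \<Longrightarrow> witt_V R \<xi> \<in> carrier (witt p (Suc m) R)"
  by (auto simp: witt_simps witt_V_def)

lemma witt_F_closed:
  assumes "\<xi> \<in> carrier (witt p (Suc m) R)"
  shows "witt_F p m R \<xi> \<in> carrier (witt p m R)"
  using assms by (metis trunc_surj trunc_frob trunc_carrier)

lemma teich_mult:
  assumes "x \<in> carrier R" "y \<in> carrier R"
  shows "teich m R (x \<otimes> y) = teich m R x \<otimes>\<^bsub>witt p m R\<^esub> teich m R y"
proof -
  have "seq_mult p (case_nat a (\<lambda>_. 0)) (case_nat b (\<lambda>_. 0)) = case_nat (a * b) (\<lambda>_. 0)"
    for a b :: "'a zpoly"
    by (rule seq_eqI) (simp add: ghost_seq power_mult_distrib)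
  then have "teich m R (ev (zvar x * zvar y))
      = teich m R (ev (zvar x)) \<otimes>\<^bsub>witt p m R\<^esub> teich m R (ev (zvar y))"
    unfolding trunc_teich trunc_mult by simp
  then show ?thesis using assms by (simp add: ev_simps ev_var)
qed

lemma teich_pow:
  assumes "x \<in> carrier R"
  shows "teich m R (x [^] (n::nat)) = teich m R x [^]\<^bsub>witt p m R\<^esub> n"
  by (induction n) (simp_all add: assms teich_mult, simp add: witt_simps)

lemma witt_F_teich:
  assumes "x \<in> carrier R"
  shows "witt_F p m R (teich (Suc m) R x) = teich m R (x [^] p)"
proof -
  have pw: "ev (a ^ n) = ev a [^] n" for a n
    by (induction n) (simp_all add: ev_simps m_comm ev_closed)
  have "seq_frob p (case_nat a (\<lambda>_. 0)) = case_nat (a ^ p) (\<lambda>_. 0)" for a :: "'a zpoly"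
    by (rule seq_eqI) (simp add: ghost_seq power_mult)
  then have "witt_F p m R (teich (Suc m) R (ev (zvar x))) = teich m R (ev (zvar x ^ p))"
    unfolding trunc_teich trunc_frob by simp
  then show ?thesis using assms by (simp add: pw ev_var)
qed

lemma witt_V_add:
  assumes "\<xi> \<in> carrier (witt p m R)" "\<eta> \<in> carrier (witt p m R)"
  shows "witt_V R (\<xi> \<oplus>\<^bsub>witt p m R\<^esub> \<eta>) = witt_V R \<xi> \<oplus>\<^bsub>witt p (Suc m) R\<^esub> witt_V R \<eta>"
proof -
  obtain a b where ab: "\<xi> = trunc m a" "\<eta> = trunc m b" using assms by (metis trunc_surj)
  have "case_nat 0 (seq_add p a b) = seq_add p (case_nat 0 a) (case_nat 0 b)"
  proof (rule seq_eqI)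
    fix n show "ghost p n (case_nat 0 (seq_add p a b)) = ghost p n (seq_add p (case_nat 0 a) (case_nat 0 b))"
      by (cases n) (simp_all add: ghost_seq ghost_V ghost_V_0 algebra_simps)
  qed
  then show ?thesis by (simp add: ab trunc_add trunc_V)
qed

text \<open>In each ghost component, [x_0] accounts for the summand of index 0, and V of the shifted
  sequence, which multiplies ghost components by \<open>p\<close> and moves them up by one, for all
  others.\<close>

lemma witt_decomp:
  assumes "\<xi> \<in> carrier (witt p (Suc m) R)"
  shows "\<xi> = teich (Suc m) R (hd \<xi>) \<oplus>\<^bsub>witt p (Suc m) R\<^esub> witt_V R (tl \<xi>)"
proof -
  obtain a where a: "\<xi> = trunc (Suc m) a" using assms by (metis trunc_surj)
  have "a = seq_add p (case_nat (a 0) (\<lambda>_. 0)) (case_nat 0 (\<lambda>i. a (Suc i)))"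
  proof (rule seq_eqI)
    fix n show "ghost p n a = ghost p n (seq_add p (case_nat (a 0) (\<lambda>_. 0)) (case_nat 0 (\<lambda>i. a (Suc i))))"
    proof (cases n)
      case (Suc k)
      then show ?thesis
        unfolding ghost_seq Suc ghost_V unfolding ghost_def sum.atMost_Suc_shift
        by (simp add: sum_distrib_left mult.assoc)
    qed (simp add: ghost_seq ghost_V_0, simp add: ghost_def)
  qed
  then have "\<xi> = teich (Suc m) R (ev (a 0)) \<oplus>\<^bsub>witt p (Suc m) R\<^esub> witt_V R (trunc m (\<lambda>i. a (Suc i)))"
    unfolding trunc_teich trunc_V trunc_add a by simp
  moreover have "hd \<xi> = ev (a 0)" "tl \<xi> = trunc m (\<lambda>i. a (Suc i))"
    unfolding a trunc_def by (simp_all add: map_upt_Suc del: upt_Suc)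
  ultimately show ?thesis by simp
qed

text \<open>The ghost component of index 0 is the first entry itself.\<close>

lemma hd_witt_add:
  assumes "\<xi> \<in> carrier (witt p (Suc m) R)" "\<eta> \<in> carrier (witt p (Suc m) R)"
  shows "hd (\<xi> \<oplus>\<^bsub>witt p (Suc m) R\<^esub> \<eta>) = hd \<xi> \<oplus> hd \<eta>"
proof -
  obtain a b where ab: "\<xi> = trunc (Suc m) a" "\<eta> = trunc (Suc m) b" using assms by (metis trunc_surj)
  have h: "hd (trunc (Suc m) c) = ev (c 0)" for c
    unfolding trunc_def by (simp add: map_upt_Suc del: upt_Suc)
  have "seq_add p a b 0 = a 0 + b 0"
    using ghost_seq_add[of 0 a b] by (simp add: ghost_def)
  then show ?thesis by (simp add: ab trunc_add h ev_simps)
qed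

lemma hd_witt_pow:
  assumes "\<xi> \<in> carrier (witt p (Suc m) R)"
  shows "hd ([(n::nat)] \<cdot>\<^bsub>witt p (Suc m) R\<^esub> \<xi>) = [n] \<cdot> hd \<xi>"
proof -
  interpret W: cring "witt p (Suc m) R" by (rule cring_witt)
  show ?thesis
    using assms by (induction n) (simp_all add: hd_witt_add W.add.nat_pow_closed, simp add: witt_simps)
qed

lemma witt_V_zero: "witt_V R \<zero>\<^bsub>witt p m R\<^esub> = \<zero>\<^bsub>witt p (Suc m) R\<^esub>"
  by (simp add: witt_V_def witt_simps)

lemma witt_V_pow:
  assumes "\<xi> \<in> carrier (witt p m R)"
  shows "witt_V R ([(n::nat)] \<cdot>\<^bsub>witt p m R\<^esub> \<xi>) = [n] \<cdot>\<^bsub>witt p (Suc m) R\<^esub> witt_V R \<xi>"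
proof -
  interpret W: cring "witt p m R" by (rule cring_witt)
  interpret W': cring "witt p (Suc m) R" by (rule cring_witt)
  show ?thesis
    using assms by (induction n) (simp_all add: witt_V_add W.add.nat_pow_closed witt_V_zero)
qed

text \<open>Subtracting b [y], where b y is the first entry, leaves a vector with first entry zero,
  that is, V of a shorter vector. This one is divisible by induction, and V is additive.\<close>

lemma witt_divisible:
  assumes b: "\<And>x. x \<in> carrier R \<Longrightarrow> \<exists>y\<in>carrier R. [(b::nat)] \<cdot> y = x"
  shows "\<xi> \<in> carrier (witt p m R) \<Longrightarrow> \<exists>\<eta>\<in>carrier (witt p m R). [b] \<cdot>\<^bsub>witt p m R\<^esub> \<eta> = \<xi>"
proof (induction m arbitrary: \<xi>)
  case 0
  interpret W: cring "witt p 0 R" by (rule cring_witt)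
  have "[b] \<cdot>\<^bsub>witt p 0 R\<^esub> [] = []"
    using W.add.nat_pow_closed[of "[]" b] by (simp add: witt_simps)
  with 0 show ?case by (auto simp: witt_simps)
next
  case (Suc m)
  interpret W: cring "witt p m R" by (rule cring_witt)
  interpret W': cring "witt p (Suc m) R" by (rule cring_witt)
  let ?W = "witt p (Suc m) R"
  have car: "hd \<xi> \<in> carrier R" "tl \<xi> \<in> carrier (witt p m R)"
    if "\<xi> \<in> carrier ?W" for \<xi>
    using that by (cases \<xi>; auto simp: witt_simps)+
  obtain y where y: "y \<in> carrier R" "[b] \<cdot> y = hd \<xi>" using b car(1)[OF Suc.prems] by blast
  define \<zeta> where "\<zeta> = \<xi> \<ominus>\<^bsub>?W\<^esub> [b] \<cdot>\<^bsub>?W\<^esub> teich (Suc m) R y"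
  have tc: "teich (Suc m) R y \<in> carrier ?W" using y by (simp add: teich_closed)
  have bt: "[b] \<cdot>\<^bsub>?W\<^esub> teich (Suc m) R y \<in> carrier ?W" using tc by (rule W'.add.nat_pow_closed)
  have zc: "\<zeta> \<in> carrier ?W" using bt Suc.prems by (simp add: \<zeta>_def)
  have sum: "\<xi> = \<zeta> \<oplus>\<^bsub>?W\<^esub> [b] \<cdot>\<^bsub>?W\<^esub> teich (Suc m) R y"
    using bt Suc.prems by (simp add: \<zeta>_def a_minus_def W'.minus_eq W'.a_assoc W'.l_neg)
  have "hd (teich (Suc m) R y) = y" by (simp add: teich_def map_upt_Suc del: upt_Suc)
  then have "hd \<xi> = hd \<zeta> \<oplus> hd \<xi>"
    using hd_witt_add[OF zc bt] hd_witt_pow[OF tc] y(2) sum by simp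
  then have "hd \<zeta> = \<zero>"
    using car(1)[OF zc] car(1)[OF Suc.prems] add.right_cancel[of "hd \<xi>" "hd \<zeta>" \<zero>] by simp
  then have "\<zeta> = witt_V R (tl \<zeta>)" using zc by (cases \<zeta>) (auto simp: witt_V_def witt_simps)
  moreover obtain \<eta> where \<eta>: "\<eta> \<in> carrier (witt p m R)" "[b] \<cdot>\<^bsub>witt p m R\<^esub> \<eta> = tl \<zeta>"
    using Suc.IH[OF car(2)[OF zc]] by blast
  ultimately have "\<zeta> = [b] \<cdot>\<^bsub>?W\<^esub> witt_V R \<eta>" using witt_V_pow[OF \<eta>(1), of b] by simp
  then have "[b] \<cdot>\<^bsub>?W\<^esub> (witt_V R \<eta> \<oplus>\<^bsub>?W\<^esub> teich (Suc m) R y) = \<xi>"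
    using sum tc witt_V_closed[OF \<eta>(1)] by (simp add: W'.add.nat_pow_distrib)
  then show ?case using tc witt_V_closed[OF \<eta>(1)] W'.a_closed by blast
qed

end

section \<open>Prime-to-\<open>p\<close> denominators\<close>

text \<open>\<open>Z_local\<close> and \<open>rat_in\<close> refer to the reduced fraction, whereas
  the coefficients at hand come with an unreduced denominator; this compares the two.\<close>

lemma quotient_of_dvd:
  assumes "quotient_of (of_int a / of_nat b) = (c, d)" "b > 0"
  shows "d > 0" "d dvd int b" "a * d = c * int b"
proof -
  show d: "d > 0" using assms(1) by (rule quotient_of_denom_pos)
  have "(of_int a / of_nat b :: rat) = of_int c / of_int d" using assms(1) by (rule quotient_of_div)
  then have "(of_int a * of_int d :: rat) = of_int c * of_nat b"
    using d assms(2) by (simp add: field_simps)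
  then have "(of_int (a * d) :: rat) = of_int (c * int b)" by simp
  then show eq: "a * d = c * int b" by (simp only: of_int_eq_iff)
  have "coprime c d" using assms(1) by (rule quotient_of_coprime)
  moreover have "d dvd c * int b" using eq by (metis dvd_triv_right)
  ultimately show "d dvd int b" by (simp add: coprime_commute coprime_dvd_mult_right_iff)
qed

lemma Z_local_mem:
  assumes "\<not> p dvd b" "b > 0"
  shows "of_nat n / of_nat b \<in> carrier (Z_local p)"
proof -
  obtain c d where cd: "quotient_of (of_int (int n) / of_nat b) = (c, d)" by fastforce
  have "\<not> int p dvd d" using quotient_of_dvd(2)[OF cd assms(2)] assms(1)
    by (meson dvd_trans int_dvd_int_iff)
  then show ?thesis using cd by (simp add: Z_local_def)
qed

text \<open>The part of a \<open>Z_(p)\<close>-algebra structure used from here on. As an existence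
  statement about additive multiples it passes along ring homomorphisms and to Witt vectors without
  carrying a structure map.\<close>

definition inverts :: "nat \<Rightarrow> ('a, 'm) ring_scheme \<Rightarrow> bool" where
  "inverts p A \<longleftrightarrow> (\<forall>b. \<not> p dvd b \<longrightarrow> (\<exists>u\<in>carrier A. [(b::nat)] \<cdot>\<^bsub>A\<^esub> u = \<one>\<^bsub>A\<^esub>))"

text \<open>The inverse of b is the image of 1/b: its n-th multiple is the image of n/b by
  additivity, and n = b gives the image of 1.\<close>

lemma inverts_Z_local_algebra:
  assumes "Z_local_algebra p A" "\<phi> \<in> ring_hom A B" "ring B" "Factorial_Ring.prime p"
  shows "inverts p B"
  unfolding inverts_def
proof (intro allI impI)
  interpret B: ring B by fact
  fix b assume b: "\<not> p dvd b"
  then have b0: "b > 0" by (cases b) auto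
  obtain h where h: "h \<in> ring_hom (Z_local p) A" using assms(1) by (auto simp: Z_local_algebra_def)
  let ?g = "\<lambda>n. \<phi> (h (of_nat n / of_nat b))"
  note c = Z_local_mem[OF b b0]
  have gc: "?g n \<in> carrier B" for n
    by (intro ring_hom_closed[OF assms(2)] ring_hom_closed[OF h] c)
  have step: "?g (n + 1) = ?g n \<oplus>\<^bsub>B\<^esub> ?g 1" for n
  proof -
    have "of_nat (n + 1) / of_nat b = of_nat n / of_nat b \<oplus>\<^bsub>Z_local p\<^esub> (of_nat 1 / of_nat b)"
      by (simp add: Z_local_def add_divide_distrib)
    then have "h (of_nat (n + 1) / of_nat b) = h (of_nat n / of_nat b) \<oplus>\<^bsub>A\<^esub> h (of_nat 1 / of_nat b)"
      by (simp only: ring_hom_add[OF h c c])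
    then show ?thesis
      by (simp only: ring_hom_add[OF assms(2) ring_hom_closed[OF h c] ring_hom_closed[OF h c]])
  qed
  \<comment> \<open>The induction starts at 1, since membership in \<open>ring_hom\<close> only
    speaks of sums, products and 1, not of zero.\<close>
  have "?g n = [n] \<cdot>\<^bsub>B\<^esub> ?g 1" if "n \<ge> 1" for n
    using that
  proof (induction n rule: nat_induct_at_least)
    case base
    show ?case using gc[of 1] by simp
  next
    case (Suc n)
    then show ?case using step[of n] by (simp only: Suc_eq_plus1[symmetric] B.add.nat_pow_Suc)
  qed
  from this[of b] have "[b] \<cdot>\<^bsub>B\<^esub> ?g 1 = \<phi> (h 1)" using b0 by simp
  also have "\<dots> = \<one>\<^bsub>B\<^esub>"
    using ring_hom_one[OF h] ring_hom_one[OF assms(2)] by (simp add: Z_local_def)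
  finally show "\<exists>u\<in>carrier B. [b] \<cdot>\<^bsub>B\<^esub> u = \<one>\<^bsub>B\<^esub>" using gc by blast
qed

context ring
begin

lemma inverts_divisible:
  assumes "inverts p R" "\<not> p dvd b" "x \<in> carrier R"
  shows "\<exists>y\<in>carrier R. [(b::nat)] \<cdot> y = x"
proof -
  obtain u where "u \<in> carrier R" "[b] \<cdot> u = \<one>" using assms by (auto simp: inverts_def)
  then show ?thesis using assms(3) by (intro bexI[of _ "u \<otimes> x"]) (auto simp: add_pow_ldistr[symmetric])
qed

end

lemma inverts_hom:
  assumes "ring A" "ring B" "h \<in> ring_hom A B" "inverts p A"
  shows "inverts p B"
  unfolding inverts_def
proof (intro allI impI)
  interpret ring_hom_ring A B h using assms by (intro ring_hom_ringI2)
  fix b assume "\<not> p dvd b"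
  then obtain u where u: "u \<in> carrier A" "[b] \<cdot>\<^bsub>A\<^esub> u = \<one>\<^bsub>A\<^esub>" using assms(4) by (auto simp: inverts_def)
  have "h ([(n::nat)] \<cdot>\<^bsub>A\<^esub> u) = [n] \<cdot>\<^bsub>B\<^esub> h u" for n
    using u by (induction n) simp_all
  from this[of b] show "\<exists>v\<in>carrier B. [b] \<cdot>\<^bsub>B\<^esub> v = \<one>\<^bsub>B\<^esub>" using u by (intro bexI[of _ "h u"]) auto
qed

text \<open>If c/d is the reduced form of a/b, then b = d e and a = c e for some e, so the equation
  for d, where \<open>rat_in\<close> inverts, has only to be multiplied by e.\<close>

lemma rat_in_spec:
  assumes "cring A" "inverts p A" "\<not> p dvd b"
  shows "rat_in A (of_nat a / of_nat b) \<in> carrier A"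
    and "[b] \<cdot>\<^bsub>A\<^esub> rat_in A (of_nat a / of_nat b) = [a] \<cdot>\<^bsub>A\<^esub> \<one>\<^bsub>A\<^esub>"
proof -
  interpret cring A by fact
  have b0: "b > 0" using assms(3) by (cases b) auto
  obtain c d where cd: "quotient_of (of_int (int a) / of_nat b) = (c, d)" by fastforce
  note q = quotient_of_dvd[OF cd b0]
  define D where "D = nat d"
  have D1: "d = int D" using q by (simp add: D_def)
  then have D: "d = int D" "D dvd b" using q(2) by auto
  then obtain e where e: "b = D * e" by blast
  have ce: "int a = c * int e" using q(1,3) by (simp add: D(1) e)
  have "\<not> p dvd D" using assms(3) D(2) dvd_trans by blast
  then obtain u where u: "u \<in> carrier A" "[D] \<cdot>\<^bsub>A\<^esub> u = \<one>\<^bsub>A\<^esub>" using assms(2) by (auto simp: inverts_def)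
  have D1: "[d] \<cdot>\<^bsub>A\<^esub> \<one>\<^bsub>A\<^esub> = [D] \<cdot>\<^bsub>A\<^esub> \<one>\<^bsub>A\<^esub>" by (simp add: D(1) add_pow_int_ge)
  have "([D] \<cdot>\<^bsub>A\<^esub> \<one>\<^bsub>A\<^esub>) \<otimes>\<^bsub>A\<^esub> u = \<one>\<^bsub>A\<^esub>"
    using u by (simp add: add_pow_ldistr)
  then have un: "[D] \<cdot>\<^bsub>A\<^esub> \<one>\<^bsub>A\<^esub> \<in> Units A"
    using u by (auto simp: Units_def m_comm)
  have ri: "rat_in A (of_nat a / of_nat b) = ([c] \<cdot>\<^bsub>A\<^esub> \<one>\<^bsub>A\<^esub>) \<otimes>\<^bsub>A\<^esub> inv\<^bsub>A\<^esub> ([D] \<cdot>\<^bsub>A\<^esub> \<one>\<^bsub>A\<^esub>)"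
    using cd by (simp add: rat_in_def D1)
  have cc: "[c] \<cdot>\<^bsub>A\<^esub> \<one>\<^bsub>A\<^esub> \<in> carrier A" by (rule add.int_pow_closed) simp
  have ic: "inv\<^bsub>A\<^esub> ([D] \<cdot>\<^bsub>A\<^esub> \<one>\<^bsub>A\<^esub>) \<in> carrier A" using un by simp
  show rc: "rat_in A (of_nat a / of_nat b) \<in> carrier A" unfolding ri using cc ic by simp
  have "[D] \<cdot>\<^bsub>A\<^esub> rat_in A (of_nat a / of_nat b)
      = ([c] \<cdot>\<^bsub>A\<^esub> \<one>\<^bsub>A\<^esub>) \<otimes>\<^bsub>A\<^esub> (([D] \<cdot>\<^bsub>A\<^esub> \<one>\<^bsub>A\<^esub>) \<otimes>\<^bsub>A\<^esub> inv\<^bsub>A\<^esub> ([D] \<cdot>\<^bsub>A\<^esub> \<one>\<^bsub>A\<^esub>))"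
    unfolding ri using cc ic
    by (simp add: add_pow_ldistr[of "\<one>\<^bsub>A\<^esub>" "inv\<^bsub>A\<^esub> ([D] \<cdot>\<^bsub>A\<^esub> \<one>\<^bsub>A\<^esub>)" D] add_pow_rdistr)
  also have "\<dots> = [c] \<cdot>\<^bsub>A\<^esub> \<one>\<^bsub>A\<^esub>" using un cc by (simp only: Units_r_inv r_one)
  finally have "[b] \<cdot>\<^bsub>A\<^esub> rat_in A (of_nat a / of_nat b) = [e] \<cdot>\<^bsub>A\<^esub> ([c] \<cdot>\<^bsub>A\<^esub> \<one>\<^bsub>A\<^esub>)"
    using add.nat_pow_pow[OF rc, of e D] by (simp add: e)
  also have "\<dots> = [int e] \<cdot>\<^bsub>A\<^esub> ([c] \<cdot>\<^bsub>A\<^esub> \<one>\<^bsub>A\<^esub>)" by (simp add: add_pow_int_ge)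
  also have "\<dots> = [int a] \<cdot>\<^bsub>A\<^esub> \<one>\<^bsub>A\<^esub>" by (simp add: add.int_pow_pow ce)
  finally show "[b] \<cdot>\<^bsub>A\<^esub> rat_in A (of_nat a / of_nat b) = [a] \<cdot>\<^bsub>A\<^esub> \<one>\<^bsub>A\<^esub>"
    by (simp add: add_pow_int_ge)
qed

lemma (in witt_base) inverts_witt:
  assumes "inverts p R"
  shows "inverts p (witt p m R)"
proof -
  interpret W: cring "witt p m R" by (rule cring_witt)
  show ?thesis
    using witt_divisible[OF inverts_divisible[OF assms], of _ "\<one>\<^bsub>witt p m R\<^esub>" m]
    by (auto simp: inverts_def)
qed

text \<open>Legendre's formula in recursive form. Passing from n to n + 1 changes both sides only if
  \<open>p\<close> divides n + 1, in which case (n + 1)/p becomes a new factor of the smaller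
  factorial.\<close>

lemma multiplicity_fact_div:
  assumes p: "Factorial_Ring.prime (p::nat)"
  shows "multiplicity p (fact n) = n div p + multiplicity p (fact (n div p) :: nat)"
proof (induction n)
  case (Suc n)
  have pe: "prime_elem p" using p by simp
  have ms: "multiplicity p (fact (Suc k) :: nat) = multiplicity p (Suc k) + multiplicity p (fact k :: nat)" for k
    using prime_elem_multiplicity_mult_distrib[OF pe, of "Suc k" "fact k"] by (simp del: mult_Suc)
  show ?case
  proof (cases "p dvd Suc n")
    case True
    then obtain q where q: "Suc n = p * q" by blast
    then have q0: "q > 0" by (cases q) auto
    have sd: "Suc n div p = Suc (n div p)" using True by (simp add: div_Suc dvd_eq_mod_eq_0)
    then have "q = Suc (n div p)" using q p by (metis nonzero_mult_div_cancel_left not_prime_0)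
    then have "multiplicity p (Suc n) = Suc (multiplicity p (Suc (n div p)))"
      using q q0 p prime_elem_multiplicity_mult_distrib[OF pe, of p q] by simp
    then show ?thesis unfolding sd ms Suc.IH by simp
  next
    case False
    then have "Suc n div p = n div p" by (simp add: div_Suc dvd_eq_mod_eq_0)
    then show ?thesis unfolding ms Suc.IH using False by (simp add: not_dvd_imp_multiplicity_0)
  qed
qed simp

text \<open>With m = n div p \<ge> 1, Legendre's recursion and the bound for m give at most (p - 1)
  m + (m - 1) = p m - 1 \<le> n - 1; for m = 0 the valuation vanishes.\<close>

lemma multiplicity_fact_bound:
  assumes p: "Factorial_Ring.prime (p::nat)"
  shows "n \<ge> 1 \<Longrightarrow> (p - 1) * multiplicity p (fact n :: nat) \<le> n - 1"
proof (induction n rule: less_induct)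
  case (less n)
  have p2: "p \<ge> 2" using p prime_ge_2_nat by blast
  show ?case
  proof (cases "n div p = 0")
    case True
    then show ?thesis by (simp add: multiplicity_fact_div[OF p, of n])
  next
    case False
    let ?m = "n div p"
    have "?m < n" using p2 less.prems by simp
    then have "(p - 1) * multiplicity p (fact ?m :: nat) \<le> ?m - 1" using less.IH False by simp
    then have "(p - 1) * multiplicity p (fact n :: nat) \<le> (p - 1) * ?m + (?m - 1)"
      by (simp add: multiplicity_fact_div[OF p, of n] distrib_left)
    also have "\<dots> = p * ?m - 1" using p2 False by (simp add: diff_mult_distrib)
    also have "\<dots> \<le> n - 1" by (intro diff_le_mono) simp
    finally show ?thesis .
  qed
qed

text \<open>The coefficient \<open>p\<^sup>n\<^sup>-\<^sup>1/n!\<close> of \<open>\<gamma>\<^sub>n\<close> is \<open>p\<^sup>n\<^sup>-\<^sup>1\<^sup>-\<^sup>k/u\<close> for the decomposition \<open>n! = p\<^sup>k u\<close>, and it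
  is divisible by \<open>p\<close> unless \<open>p = 2\<close> and \<open>n\<close> is even (or \<open>n = 1\<close>).\<close>

lemma fact_decomp:
  assumes p: "Factorial_Ring.prime (p::nat)" and n: "n \<ge> 1"
  obtains k u where "(fact n :: nat) = p ^ k * u" "\<not> p dvd u" "k \<le> n - 1"
    "n \<ge> 2 \<Longrightarrow> p \<noteq> 2 \<or> odd n \<Longrightarrow> k \<le> n - 2"
proof -
  let ?k = "multiplicity p (fact n :: nat)"
  have p2: "p \<ge> 2" using p prime_ge_2_nat by blast
  obtain u where u: "(fact n :: nat) = p ^ ?k * u" "\<not> p dvd u"
    using multiplicity_decompose'[of "fact n" p] p by (metis fact_nonzero not_prime_unit)
  note b = multiplicity_fact_bound[OF p]
  have "1 * ?k \<le> (p - 1) * ?k" using p2 by (intro mult_le_mono1) auto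
  then have k1: "?k \<le> n - 1" using order_trans[OF _ b[OF n]] by (simp only: mult_1)
  \<comment> \<open>For odd \<open>p\<close> the bound reads 2 k \<le> n - 1. For p = 2 and odd n,
    n! and (n-1)! have the same valuation, so the bound for n - 1 applies.\<close>
  have k2: "?k \<le> n - 2" if "n \<ge> 2" "p \<noteq> 2 \<or> odd n"
  proof (cases "p = 2")
    case True
    then have "odd n" using that by auto
    define l where "l = n - 1"
    have l: "n = Suc l" "l \<ge> 1" using \<open>n \<ge> 2\<close> by (auto simp: l_def)
    have "(fact n :: nat) = n * fact l" using l by simp
    then have "?k = multiplicity p n + multiplicity p (fact l :: nat)"
      using prime_elem_multiplicity_mult_distrib[of p n "fact l"] p l by simp
    also have "multiplicity p n = 0" using True \<open>odd n\<close> by (simp add: not_dvd_imp_multiplicity_0)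
    finally show ?thesis using b[OF l(2)] l True by simp
  next
    case False
    then have "2 * ?k \<le> (p - 1) * ?k" using p2 by (intro mult_le_mono1) auto
    then have "2 * ?k \<le> n - 1" by (rule order_trans[OF _ b[OF n]])
    then show ?thesis using that by linarith
  qed
  show ?thesis using that[OF u k1 k2] .
qed

section \<open>The free ring on symbols\<close>

definition word_in :: "('s, 'q) prelog \<Rightarrow> ('s, 'q) letter list \<Rightarrow> bool" where
  "word_in Y w \<longleftrightarrow> (\<forall>l\<in>set w. letter_in Y l)"

lemma word_in_simps [simp]:
  "word_in Y []" "word_in Y (l # w) \<longleftrightarrow> letter_in Y l \<and> word_in Y w"
  "word_in Y (v @ w) \<longleftrightarrow> word_in Y v \<and> word_in Y w"
  by (auto simp: word_in_def)

lemma free_ring_simps [simp]: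
  "monoid.mult (free_ring Y) = (*)" "one (free_ring Y) = 1"
  "zero (free_ring Y) = 0" "add (free_ring Y) = (+)"
  by (simp_all add: free_ring_def)

lemma free_ring_carrier:
  "x \<in> carrier (free_ring Y) \<longleftrightarrow> Poly_Mapping.keys x \<subseteq> {w. word_in Y (letters w)}"
  by (auto simp: free_ring_def word_in_def)

lemma wrd_Nil: "wrd [] = 1"
  unfolding zero_word_def[symmetric] by (rule frag_of_0)

lemma wrd_append: "wrd (u @ v) = wrd u * wrd v"
  using frag_of_times[of "Word u" "Word v"] by (simp add: plus_word_def)

lemma wrd_Cons: "wrd (l # w) = gen l * wrd w"
  using wrd_append[of "[l]" w] by simp

lemma wrd_in: "wrd w \<in> carrier (free_ring Y) \<longleftrightarrow> word_in Y w"
  by (auto simp: free_ring_carrier)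

lemma free_zero_in: "0 \<in> carrier (free_ring Y)"
  by (simp add: free_ring_carrier)

lemma free_one_in: "1 \<in> carrier (free_ring Y)"
  using wrd_in[of "[]" Y] by (simp add: wrd_Nil del: single_one)

lemma free_add_in:
  "x \<in> carrier (free_ring Y) \<Longrightarrow> y \<in> carrier (free_ring Y) \<Longrightarrow> x + y \<in> carrier (free_ring Y)"
  using keys_add[of x y] by (fastforce simp: free_ring_carrier)

lemma free_uminus_in: "x \<in> carrier (free_ring Y) \<Longrightarrow> - x \<in> carrier (free_ring Y)"
  by (simp add: free_ring_carrier)

lemma free_diff_in:
  "x \<in> carrier (free_ring Y) \<Longrightarrow> y \<in> carrier (free_ring Y) \<Longrightarrow> x - y \<in> carrier (free_ring Y)"
  using keys_diff[of x y] by (fastforce simp: free_ring_carrier)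

lemma free_mult_in:
  assumes "x \<in> carrier (free_ring Y)" "y \<in> carrier (free_ring Y)"
  shows "x * y \<in> carrier (free_ring Y)"
  unfolding free_ring_carrier
proof
  fix m assume "m \<in> Poly_Mapping.keys (x * y)"
  with keys_mult[of x y] obtain a b where
    "a \<in> Poly_Mapping.keys x" "b \<in> Poly_Mapping.keys y" "m = a + b" by blast
  then show "m \<in> {w. word_in Y (letters w)}"
    using assms by (fastforce simp: free_ring_carrier plus_word_def)
qed

lemma free_power_in: "x \<in> carrier (free_ring Y) \<Longrightarrow> x ^ n \<in> carrier (free_ring Y)"
  by (induction n) (auto intro: free_mult_in free_one_in)

lemmas free_in = free_zero_in free_one_in free_add_in free_uminus_in free_diff_in free_mult_in
  free_power_in

lemma free_induct [consumes 1, case_names zero word diff]: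
  assumes "x \<in> carrier (free_ring Y)"
    and "P 0" "\<And>w. word_in Y w \<Longrightarrow> P (wrd w)"
    and "\<And>a b. a \<in> carrier (free_ring Y) \<Longrightarrow> b \<in> carrier (free_ring Y) \<Longrightarrow> P a \<Longrightarrow> P b \<Longrightarrow> P (a - b)"
  shows "P x"
proof -
  from assms(1) have "Poly_Mapping.keys x \<subseteq> {w. word_in Y (letters w)}"
    by (simp add: free_ring_carrier)
  then have "x \<in> carrier (free_ring Y) \<and> P x"
  proof (induction x rule: frag_induction)
    case (one w)
    then show ?case using assms(3)[of "letters w"] wrd_in[of "letters w" Y] by simp
  qed (use assms in \<open>auto intro: free_zero_in free_diff_in\<close>)
  then show ?thesis by simp
qed

lemma ring_free_ring: "ring (free_ring Y)"
proof (rule ringI)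
  show "abelian_group (free_ring Y)"
  proof (rule abelian_groupI)
    fix x assume "x \<in> carrier (free_ring Y)"
    then show "\<exists>y\<in>carrier (free_ring Y). y \<oplus>\<^bsub>free_ring Y\<^esub> x = \<zero>\<^bsub>free_ring Y\<^esub>"
      by (intro bexI[of _ "- x"]) (auto intro: free_in)
  qed (auto simp: add_ac intro: free_in)
  show "Group.monoid (free_ring Y)"
    by (rule monoidI) (auto simp: mult.assoc intro: free_in)
qed (auto simp: algebra_simps)

lemma free_ring_a_inv: "x \<in> carrier (free_ring Y) \<Longrightarrow> \<ominus>\<^bsub>free_ring Y\<^esub> x = - x"
proof -
  interpret ring "free_ring Y" by (rule ring_free_ring)
  show "x \<in> carrier (free_ring Y) \<Longrightarrow> \<ominus>\<^bsub>free_ring Y\<^esub> x = - x"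
    using minus_equality[of "- x" x] by (simp add: free_uminus_in)
qed

lemma frag_extend_uminus: "frag_extend b (- x) = - frag_extend b x"
  using frag_extend_diff[of b 0 x] by simp

lemma frag_extend_mult:
  fixes b :: "'w::monoid_add \<Rightarrow> 'v::monoid_add \<Rightarrow>\<^sub>0 int"
  assumes m: "\<And>u w. b (u + w) = b u * b w"
  shows "frag_extend b (x * y) = frag_extend b x * frag_extend b y"
proof -
  have 1: "frag_extend b (frag_of u * y) = frag_extend b (frag_of u) * frag_extend b y" for u
    using subset_UNIV[of "Poly_Mapping.keys y"]
    by (induction y rule: frag_induction)
       (simp_all only: frag_of_times frag_extend_of m right_diff_distrib frag_extend_diff
          frag_extend_0 mult_zero_right)
  show ?thesis using subset_UNIV[of "Poly_Mapping.keys x"]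
    by (induction x rule: frag_induction)
       (simp_all only: 1 left_diff_distrib frag_extend_diff frag_extend_0 mult_zero_left)
qed

lemma free_hom_wrd: "free_hom h (wrd w) = prod_list (map h w)"
  by (simp add: free_hom_def)

lemma free_hom_diff: "free_hom h (x - y) = free_hom h x - free_hom h y"
  by (simp add: free_hom_def frag_extend_diff)

lemma free_hom_zero: "free_hom h 0 = 0"
  by (simp add: free_hom_def)

lemma free_hom_in:
  assumes "x \<in> carrier (free_ring Y)" "\<And>l. letter_in Y l \<Longrightarrow> h l \<in> carrier (free_ring Z)"
  shows "free_hom h x \<in> carrier (free_ring Z)"
  using assms(1)
proof (induction x rule: free_induct)
  case (word w)
  then show ?case unfolding free_hom_wrd by (induction w) (auto intro: free_in assms(2))
qed (auto simp: free_hom_zero free_hom_diff intro: free_in)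

section \<open>The grading of the free ring by word degree\<close>

definition wdeg :: "('s, 'q) letter list \<Rightarrow> nat" where
  "wdeg w = sum_list (map letter_deg w)"

lemma wdeg_simps [simp]: "wdeg [] = 0" "wdeg (l # w) = letter_deg l + wdeg w"
  "wdeg (v @ w) = wdeg v + wdeg w"
  by (simp_all add: wdeg_def)

lemma homog_iff:
  "x \<in> homog Y i \<longleftrightarrow> Poly_Mapping.keys x \<subseteq> {w. word_in Y (letters w) \<and> wdeg (letters w) = i}"
  by (auto simp: homog_def free_ring_carrier wdeg_def)

lemma homog_in: "x \<in> homog Y i \<Longrightarrow> x \<in> carrier (free_ring Y)"
  by (simp add: homog_def)

lemma homog_wrd: "word_in Y w \<Longrightarrow> wdeg w = i \<Longrightarrow> wrd w \<in> homog Y i"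
  by (simp add: homog_iff keys_frag_of)

lemma homog_add: "x \<in> homog Y i \<Longrightarrow> y \<in> homog Y i \<Longrightarrow> x + y \<in> homog Y i"
  using keys_add[of x y] by (fastforce simp: homog_iff)

lemma homog_diff: "x \<in> homog Y i \<Longrightarrow> y \<in> homog Y i \<Longrightarrow> x - y \<in> homog Y i"
  using keys_diff[of x y] by (fastforce simp: homog_iff)

lemma homog_zero: "0 \<in> homog Y i"
  by (simp add: homog_iff)

lemma homog_mult: "x \<in> homog Y i \<Longrightarrow> y \<in> homog Y j \<Longrightarrow> x * y \<in> homog Y (i + j)"
  unfolding homog_iff
proof
  fix m assume x: "Poly_Mapping.keys x \<subseteq> {w. word_in Y (letters w) \<and> wdeg (letters w) = i}"
    and y: "Poly_Mapping.keys y \<subseteq> {w. word_in Y (letters w) \<and> wdeg (letters w) = j}"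
    and "m \<in> Poly_Mapping.keys (x * y)"
  with keys_mult[of x y] obtain a b where
    "a \<in> Poly_Mapping.keys x" "b \<in> Poly_Mapping.keys y" "m = a + b" by blast
  then show "m \<in> {w. word_in Y (letters w) \<and> wdeg (letters w) = i + j}"
    using x y by (fastforce simp: plus_word_def)
qed

lemma homog_induct [consumes 1, case_names zero word diff]:
  assumes "x \<in> homog Y i"
    and "P 0" "\<And>w. word_in Y w \<Longrightarrow> wdeg w = i \<Longrightarrow> P (wrd w)"
    and "\<And>a b. a \<in> homog Y i \<Longrightarrow> b \<in> homog Y i \<Longrightarrow> P a \<Longrightarrow> P b \<Longrightarrow> P (a - b)"
  shows "P x"
proof -
  from assms(1) have "Poly_Mapping.keys x \<subseteq> {w. word_in Y (letters w) \<and> wdeg (letters w) = i}"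
    by (simp add: homog_iff)
  then have "x \<in> homog Y i \<and> P x"
  proof (induction x rule: frag_induction)
    case (one w)
    then show ?case using assms(3)[of "letters w"] homog_wrd[of Y "letters w"] by simp
  qed (use assms in \<open>auto intro: homog_zero homog_diff\<close>)
  then show ?thesis by simp
qed

lemma d_free_wrd: "d_free (wrd w) = d_word w"
  by (simp add: d_free_def)

lemma d_free_zero: "d_free 0 = 0"
  by (simp add: d_free_def)

lemma d_free_diff: "d_free (x - y) = d_free x - d_free y"
  by (simp add: d_free_def frag_extend_diff)

lemma d_free_add: "d_free (x + y) = d_free x + d_free y"
  by (simp add: d_free_def frag_extend_add)

lemma d_free_uminus: "d_free (- x) = - d_free x"
  by (simp add: d_free_def frag_extend_uminus)

lemma d_word_in: "word_in Y w \<Longrightarrow> d_word w \<in> carrier (free_ring Y)"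
  by (induction w rule: d_word.induct) (auto intro!: free_in simp: wrd_in)

lemma d_free_in: "x \<in> carrier (free_ring Y) \<Longrightarrow> d_free x \<in> carrier (free_ring Y)"
  by (induction x rule: free_induct)
     (auto simp: d_free_zero d_free_diff d_free_wrd intro: free_in d_word_in)

lemma V_free_wrd: "V_free p m Y (wrd w) =
    wrd (Sc (witt_V (lring Y) (scalar_part (witt p m (lring Y)) w)) # concat (map (V_letter (lring Y)) w))"
  by (simp add: V_free_def)

lemma V_free_diff: "V_free p m Y (x - y) = V_free p m Y x - V_free p m Y y"
  by (simp add: V_free_def frag_extend_diff)

lemma V_free_zero: "V_free p m Y 0 = 0"
  by (simp add: V_free_def)

section \<open>Evaluation of the free ring in a log differential graded algebra\<close>

text \<open>Collects what the relations of the log de Rham complex use of a morphism of pre-log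
  rings, in a form that is checked directly for \<open>W_m(R,P) \<rightarrow> W_m(S,Q)\<close>. The
  condition \<open>phi_one\<close> yields d1 = 0.\<close>

locale prelog_pair =
  fixes X :: "('r, 'p) prelog" and Y :: "('s, 'q) prelog"
    and \<phi> :: "'r \<Rightarrow> 's" and \<psi> :: "'p \<Rightarrow> 'q"
  assumes cring_Y: "cring (lring Y)" and monoid_Y: "Group.monoid (lmon Y)"
    and phi_closed: "\<And>r. r \<in> carrier (lring X) \<Longrightarrow> \<phi> r \<in> carrier (lring Y)"
    and phi_one: "\<exists>r\<in>carrier (lring X). \<phi> r = \<one>\<^bsub>lring Y\<^esub>"
    and psi_closed: "\<And>a. a \<in> carrier (lmon X) \<Longrightarrow> \<psi> a \<in> carrier (lmon Y)"
    and lmap_closed: "\<And>q. q \<in> carrier (lmon Y) \<Longrightarrow> lmap Y q \<in> carrier (lring Y)"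
begin

sublocale S: cring "lring Y" by (rule cring_Y)
sublocale Q: Group.monoid "lmon Y" by (rule monoid_Y)

end

context log_dga
begin

lemma gr_carrier: "\<omega> \<in> gr E i \<Longrightarrow> \<omega> \<in> carrier E"
  using additive_subgroup.a_subset[OF gr_subgroup[of i]] by auto

lemma str_closed: "s \<in> carrier (lring Y) \<Longrightarrow> str E s \<in> carrier E"
  using str_hom ring_hom_closed by fast

lemma dif_closed_gr: "\<omega> \<in> gr E i \<Longrightarrow> dif E \<omega> \<in> carrier E"
  using dif_gr gr_carrier by blast

lemma dif_str_gr: "s \<in> carrier (lring Y) \<Longrightarrow> dif E (str E s) \<in> gr E 1"
  using dif_gr[OF str_gr] by simp

lemma str_central:
  assumes "s \<in> carrier (lring Y)" "\<omega> \<in> gr E i"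
  shows "str E s \<otimes> \<omega> = \<omega> \<otimes> str E s"
  using graded_comm[OF str_gr[OF assms(1)] assms(2)] gr_carrier[OF assms(2)] str_closed[OF assms(1)]
  by (simp add: add_pow_int_ge)

lemma gr_zero: "\<zero> \<in> gr E i"
  using additive_subgroup.zero_closed[OF gr_subgroup] .

lemma gr_diff: "\<omega> \<in> gr E i \<Longrightarrow> \<eta> \<in> gr E i \<Longrightarrow> \<omega> \<ominus> \<eta> \<in> gr E i"
  using additive_subgroup.a_closed[OF gr_subgroup] additive_subgroup.a_inv_closed[OF gr_subgroup]
  by (simp add: a_minus_def)

lemma dif_zero: "dif E \<zero> = \<zero>"
  using dif_add[of \<zero> \<zero>] dif_closed_gr[OF gr_zero] by simp

lemma int_minus_one: "\<omega> \<in> carrier E \<Longrightarrow> [(- 1 :: int)] \<cdot> \<omega> = \<ominus> \<omega>"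
  by (simp add: add_pow_int_lt)

lemma int_one: "\<omega> \<in> carrier E \<Longrightarrow> [(1 :: int)] \<cdot> \<omega> = \<omega>"
  by (simp add: add_pow_int_ge)

text \<open>Letters with entries outside the carriers get the value zero, so that the extension to
  words is a total map into the carrier and \<open>Phi\<close> is multiplicative on the whole
  type.\<close>

definition letter_val :: "('s, 'q) letter \<Rightarrow> 'e" where
  "letter_val l = (if letter_in Y l then
     (case l of Sc s \<Rightarrow> str E s | Dd s \<Rightarrow> dif E (str E s) | Dl q \<Rightarrow> dlog E q) else \<zero>)"

definition word_val :: "('s, 'q) word \<Rightarrow> 'e" where
  "word_val w = foldr (\<lambda>l a. letter_val l \<otimes> a) (letters w) \<one>"

definition Phi :: "('s, 'q) free \<Rightarrow> 'e" where
  "Phi = lin_ext E word_val"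

lemma letter_val_gr: "letter_val l \<in> gr E (letter_deg l)"
  by (cases l) (auto simp: letter_val_def gr_zero str_gr dif_str_gr[simplified] dlog_gr[simplified])

lemma letter_val_closed: "letter_val l \<in> carrier E"
  using letter_val_gr gr_carrier by blast

lemma word_val_closed: "word_val w \<in> carrier E"
proof -
  have "foldr (\<lambda>l a. letter_val l \<otimes> a) v \<one> \<in> carrier E" for v
    by (induction v) (auto simp: letter_val_closed)
  then show ?thesis by (simp add: word_val_def)
qed

lemma word_val_Pi: "word_val \<in> UNIV \<rightarrow> carrier E"
  by (simp add: word_val_closed)

lemma word_val_add: "word_val (u + w) = word_val u \<otimes> word_val w"
proof -
  have c: "foldr (\<lambda>l a. letter_val l \<otimes> a) v \<one> \<in> carrier E" for v
    by (induction v) (auto simp: letter_val_closed)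
  have "foldr (\<lambda>l a. letter_val l \<otimes> a) (x @ y) \<one>
      = foldr (\<lambda>l a. letter_val l \<otimes> a) x \<one> \<otimes> foldr (\<lambda>l a. letter_val l \<otimes> a) y \<one>" for x y
    by (induction x) (simp_all add: c letter_val_closed m_assoc del: foldr_append)
  then show ?thesis by (simp add: word_val_def plus_word_def del: foldr_append)
qed

lemma Phi_closed: "Phi x \<in> carrier E"
  unfolding Phi_def by (rule lin_ext_closed[OF word_val_Pi])

lemma Phi_add: "Phi (x + y) = Phi x \<oplus> Phi y"
  unfolding Phi_def by (rule lin_ext_add[OF word_val_Pi])

lemma Phi_diff: "Phi (x - y) = Phi x \<ominus> Phi y"
  unfolding Phi_def by (rule lin_ext_diff[OF word_val_Pi])

lemma Phi_zero: "Phi 0 = \<zero>"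
  by (simp add: Phi_def)

lemma Phi_uminus: "Phi (- x) = \<ominus> Phi x"
  using Phi_diff[of 0 x] Phi_closed[of x] by (simp add: Phi_zero a_minus_def)

lemma Phi_mult: "Phi (x * y) = Phi x \<otimes> Phi y"
  unfolding Phi_def by (rule lin_ext_mult[OF word_val_Pi]) (rule word_val_add)

lemma Phi_gen: "Phi (gen l) = letter_val l"
  by (simp add: Phi_def lin_ext_frag_of word_val_closed) (simp add: word_val_def letter_val_closed)

lemma Phi_Nil: "Phi (wrd []) = \<one>"
  by (simp add: Phi_def lin_ext_frag_of word_val_closed) (simp add: word_val_def)

lemma Phi_one: "Phi 1 = \<one>"
  using Phi_Nil by (simp only: wrd_Nil)

lemma Phi_Cons: "Phi (wrd (l # w)) = letter_val l \<otimes> Phi (wrd w)"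
  by (subst wrd_Cons) (simp only: Phi_mult Phi_gen)

lemma Phi_wrd_gr: "Phi (wrd w) \<in> gr E (wdeg w)"
proof (induction w)
  case Nil
  then show ?case by (simp add: wrd_Nil Phi_one gr_one del: single_one)
next
  case (Cons l w)
  then show ?case by (simp add: Phi_Cons gr_mult letter_val_gr)
qed

lemma Phi_homog: "x \<in> homog Y i \<Longrightarrow> Phi x \<in> gr E i"
  by (induction x rule: homog_induct) (auto simp: Phi_zero gr_zero Phi_diff gr_diff intro: Phi_wrd_gr)

lemma letter_val_simps [simp]:
  "s \<in> carrier (lring Y) \<Longrightarrow> letter_val (Sc s) = str E s"
  "s \<in> carrier (lring Y) \<Longrightarrow> letter_val (Dd s) = dif E (str E s)"
  "q \<in> carrier (lmon Y) \<Longrightarrow> letter_val (Dl q) = dlog E q"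
  by (simp_all add: letter_val_def)

text \<open>The axioms locate \<open>dif\<close> only on homogeneous elements. A general element is
  a finite sum of these, and \<open>dif\<close> is additive.\<close>

lemma dif_closed: "\<omega> \<in> carrier E \<Longrightarrow> dif E \<omega> \<in> carrier E"
proof -
  assume "\<omega> \<in> carrier E"
  then obtain c where c: "\<And>i. c i \<in> gr E i" "finite {i. c i \<noteq> \<zero>}" "\<omega> = (\<Oplus>i\<in>{i. c i \<noteq> \<zero>}. c i)"
    using ex1_implies_ex[OF gr_direct[OF \<open>\<omega> \<in> carrier E\<close>]] by blast
  have cc: "c i \<in> carrier E" for i using c(1) gr_carrier by blast
  have "dif E (\<Oplus>i\<in>K. c i) \<in> carrier E" if "finite K" for K
    using that
    by (induction K rule: finite_induct) (simp_all add: cc dif_zero dif_add dif_closed_gr[OF c(1)])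
  with c show ?thesis by simp
qed

lemma dif_minus: "\<omega> \<in> carrier E \<Longrightarrow> dif E (\<ominus> \<omega>) = \<ominus> dif E \<omega>"
  using dif_add[of "\<ominus> \<omega>" \<omega>] minus_equality[of "dif E (\<ominus> \<omega>)" "dif E \<omega>"]
  by (simp add: l_neg dif_zero dif_closed)

lemma dif_diff: "\<omega> \<in> carrier E \<Longrightarrow> \<eta> \<in> carrier E \<Longrightarrow> dif E (\<omega> \<ominus> \<eta>) = dif E \<omega> \<ominus> dif E \<eta>"
  by (simp add: a_minus_def dif_add dif_minus)

lemma dif_nat: "\<omega> \<in> carrier E \<Longrightarrow> dif E ([(n::nat)] \<cdot> \<omega>) = [n] \<cdot> dif E \<omega>"
  by (induction n) (simp_all add: dif_zero dif_add add.nat_pow_closed)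

lemma dif_leibniz0:
  "\<omega> \<in> gr E 0 \<Longrightarrow> \<eta> \<in> carrier E \<Longrightarrow> dif E (\<omega> \<otimes> \<eta>) = dif E \<omega> \<otimes> \<eta> \<oplus> \<omega> \<otimes> dif E \<eta>"
  by (simp add: dif_leibniz int_one gr_carrier dif_closed)

lemma dif_leibniz1:
  "\<omega> \<in> gr E 1 \<Longrightarrow> \<eta> \<in> carrier E \<Longrightarrow> dif E (\<omega> \<otimes> \<eta>) = dif E \<omega> \<otimes> \<eta> \<ominus> \<omega> \<otimes> dif E \<eta>"
  using dif_leibniz[of \<omega> 1 \<eta>] by (simp add: int_minus_one gr_carrier dif_closed a_minus_def)

lemma dif_one: "dif E \<one> = \<zero>"
  using dif_leibniz0[OF gr_one one_closed] dif_closed[OF one_closed] by simp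

lemma dif_base: "r \<in> carrier (lring X) \<Longrightarrow> str E (\<phi> r) \<in> carrier E \<Longrightarrow> dif E (str E (\<phi> r)) = \<zero>"
  using dif_linear[of r \<one>] by (simp add: dif_one)

text \<open>The clauses of \<open>d_word\<close> are the graded Leibniz rule for a first letter of
  degree 0 or 1, the latter kind being closed.\<close>

lemma Phi_d: "x \<in> carrier (free_ring Y) \<Longrightarrow> Phi (d_free x) = dif E (Phi x)"
proof (induction x rule: free_induct)
  case (word w)
  then show ?case unfolding d_free_wrd
  proof (induction w)
    case Nil
    then show ?case by (simp add: wrd_Nil Phi_zero Phi_one dif_one del: single_one)
  next
    case (Cons l w)
    have c: "Phi (wrd w) \<in> carrier E" "dif E (Phi (wrd w)) \<in> carrier E"
      by (simp_all add: Phi_closed dif_closed)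
    show ?case
    proof (cases l)
      case (Sc s)
      then have s: "s \<in> carrier (lring Y)" using Cons.prems by simp
      show ?thesis using Cons c s
        by (simp add: Sc Phi_Nil str_closed dif_closed Phi_add Phi_mult Phi_Cons Phi_gen dif_leibniz0 str_gr)
    next
      case (Dd s)
      then have s: "s \<in> carrier (lring Y)" using Cons.prems by simp
      show ?thesis using Cons c s
        by (simp add: Dd Phi_Nil Phi_uminus Phi_mult Phi_Cons Phi_gen dif_leibniz1 dif_str_gr[simplified] dif_dif str_closed
            a_minus_def dif_closed)
    next
      case (Dl q)
      then have s: "q \<in> carrier (lmon Y)" using Cons.prems by simp
      show ?thesis using Cons c s
        by (simp add: Dl Phi_Nil Phi_uminus Phi_mult Phi_Cons Phi_gen dif_leibniz1 dlog_gr[simplified] dif_dlog gr_carrier[OF dlog_gr]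
            a_minus_def)
    qed
  qed
next
  case (diff a b)
  then show ?case by (simp add: d_free_diff Phi_diff dif_diff Phi_closed)
qed (simp add: d_free_zero Phi_zero dif_zero)

lemma minus_eq_zero: "\<omega> \<in> carrier E \<Longrightarrow> \<omega> \<ominus> \<omega> = \<zero>"
  by (simp add: a_minus_def r_neg)

lemma str_simps:
  "a \<in> carrier (lring Y) \<Longrightarrow> b \<in> carrier (lring Y) \<Longrightarrow> str E (a \<oplus>\<^bsub>lring Y\<^esub> b) = str E a \<oplus> str E b"
  "a \<in> carrier (lring Y) \<Longrightarrow> b \<in> carrier (lring Y) \<Longrightarrow> str E (a \<otimes>\<^bsub>lring Y\<^esub> b) = str E a \<otimes> str E b"
  "str E \<one>\<^bsub>lring Y\<^esub> = \<one>"
  using str_hom by (simp_all add: ring_hom_add ring_hom_mult ring_hom_one)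

lemma str_dif_mult:
  assumes "a \<in> carrier (lring Y)" "b \<in> carrier (lring Y)"
  shows "dif E (str E a \<otimes> str E b) = str E a \<otimes> dif E (str E b) \<oplus> str E b \<otimes> dif E (str E a)"
  using str_central[OF assms(2) dif_str_gr[OF assms(1)]] assms
  by (simp add: dif_leibniz0 str_gr str_closed dif_closed a_comm)

lemma dlog_simps:
  "a \<in> carrier (lmon Y) \<Longrightarrow> b \<in> carrier (lmon Y) \<Longrightarrow> dlog E (a \<otimes>\<^bsub>lmon Y\<^esub> b) = dlog E a \<oplus> dlog E b"
  using dlog_hom by (auto simp: monoid_map_def hom_def)

lemma Phi_log_dR_rels:
  assumes "prelog_pair X Y \<phi> \<psi>" "x \<in> log_dR_rels X Y \<phi> \<psi>"
  shows "Phi x = \<zero>"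
proof -
  interpret prelog_pair X Y \<phi> \<psi> by fact
  note cl = str_closed dif_closed gr_carrier[OF dlog_gr]
  note ph = Phi_diff Phi_add Phi_mult Phi_gen Phi_one str_simps minus_eq_zero
  have 1: ?thesis if "x \<in> scalar_rels Y"
    using that by (auto simp: scalar_rels_def Let_def ph cl)
  have 2: ?thesis if "x \<in> central_rels Y"
    using that str_central[OF _ letter_val_gr]
    by (auto simp: central_rels_def ph cl letter_val_closed)
  have 3: ?thesis if "x \<in> kaehler_rels X Y \<phi>"
    using that
    by (auto simp: kaehler_rels_def Let_def ph cl dif_add str_dif_mult phi_closed dif_base)
  have 4: ?thesis if "x \<in> dlog_rels X Y \<psi>"
    using that
    by (auto simp: dlog_rels_def Let_def ph cl dlog_simps psi_closed lmap_closed dlog_base dif_lmap)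
  have 5: ?thesis if "x \<in> alternating_rels Y"
    using that by (auto simp: alternating_rels_def Phi_mult intro!: odd_square[of 1, OF _ Phi_homog])
  from 1 2 3 4 5 assms(2) show ?thesis by (auto simp: log_dR_rels_def)
qed

end

section \<open>The derivation of the free ring\<close>

text \<open>The grading involution, (-1)^i in degree i. With it the graded Leibniz rule d(xy) = dx y
  + parity(x) dy holds for arbitrary elements, without splitting into homogeneous parts.\<close>

definition parity :: "('s, 'q) free \<Rightarrow> ('s, 'q) free" where
  "parity = frag_extend (\<lambda>w. if even (wdeg (letters w)) then frag_of w else - frag_of w)"

lemma parity_wrd: "parity (wrd w) = (if even (wdeg w) then wrd w else - wrd w)"
  by (simp add: parity_def)

lemma parity_zero: "parity 0 = 0"
  by (simp add: parity_def)

lemma parity_diff: "parity (x - y) = parity x - parity y"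
  by (simp add: parity_def frag_extend_diff)

lemma parity_add: "parity (x + y) = parity x + parity y"
  by (simp add: parity_def frag_extend_add)

lemma parity_uminus: "parity (- x) = - parity x"
  by (simp add: parity_def frag_extend_uminus)

lemma parity_mult: "parity (x * y) = parity x * parity y"
proof -
  have "frag_of u * frag_of v = frag_of (Word (letters u @ letters v))" for u v :: "('a, 'b) word"
    by (simp only: frag_of_times plus_word_def)
  then show ?thesis
    unfolding parity_def by (intro frag_extend_mult) (auto simp: plus_word_def)
qed

lemma parity_one: "parity 1 = 1"
  using parity_wrd[of "[]"] by (simp add: wrd_Nil del: single_one)

lemma parity_in: "x \<in> carrier (free_ring Y) \<Longrightarrow> parity x \<in> carrier (free_ring Y)"
  by (induction x rule: free_induct)
     (auto simp: parity_zero parity_diff parity_wrd wrd_in intro: free_in)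

lemma parity_homog: "x \<in> homog Y i \<Longrightarrow> parity x = (if even i then x else - x)"
  by (induction x rule: homog_induct) (auto simp: parity_zero parity_diff parity_wrd)

lemma word_frag_induct:
  assumes "P 0" "\<And>w. P (wrd w)" "\<And>a b. P a \<Longrightarrow> P b \<Longrightarrow> P (a - b)"
  shows "P (x :: ('s, 'q) free)"
  using subset_UNIV[of "Poly_Mapping.keys x"]
proof (induction x rule: frag_induction)
  case (one w)
  show ?case using assms(2)[of "letters w"] by simp
qed (use assms in auto)

lemma parity_parity: "parity (parity x) = x"
  by (induction x rule: word_frag_induct) (auto simp: parity_zero parity_diff parity_wrd parity_uminus)

lemma parity_gen: "parity (gen (Sc s)) = gen (Sc s)" "parity (gen (Dd s)) = - gen (Dd s)"
  "parity (gen (Dl q)) = - gen (Dl q)"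
  by (simp_all add: parity_wrd)

lemma d_word_append: "d_word (u @ v) = d_word u * wrd v + parity (wrd u) * d_word v"
proof (induction u)
  case Nil
  then show ?case by (simp add: wrd_Nil parity_one del: single_one)
next
  case (Cons l u)
  have p: "parity (wrd (k # u)) = parity (gen k) * parity (wrd u)" for k
    by (subst wrd_Cons) (rule parity_mult)
  have w: "wrd (k # u @ v) = wrd (k # u) * wrd v" for k
    using wrd_append[of "k # u" v] by simp
  show ?case
    by (cases l) (simp_all only: append_Cons d_word.simps w p Cons.IH parity_gen,
      simp_all only: algebra_simps minus_mult_left[symmetric] minus_mult_right[symmetric] minus_add_distrib minus_minus)
qed

lemma d_free_mult: "d_free (x * y) = d_free x * y + parity x * d_free y"
proof -
  have 1: "d_free (wrd u * y) = d_word u * y + parity (wrd u) * d_free y" for u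
    by (induction y rule: word_frag_induct)
       (simp_all only: wrd_append[symmetric] d_free_wrd d_word_append d_free_zero d_free_diff
          right_diff_distrib mult_zero_right, simp_all add: algebra_simps)
  show ?thesis
    by (induction x rule: word_frag_induct)
       (simp_all only: 1 d_free_wrd d_free_zero d_free_diff parity_diff parity_zero
          left_diff_distrib mult_zero_left, simp_all add: algebra_simps)
qed

lemma d_free_gen: "d_free (gen (Sc s)) = gen (Dd s)" "d_free (gen (Dd s)) = 0" "d_free (gen (Dl q)) = 0"
  by (simp_all add: d_free_wrd)

lemma d_free_one: "d_free 1 = 0"
  using d_free_wrd[of "[]"] by (simp add: wrd_Nil del: single_one)

lemma parity_d_free: "parity (d_free x) = - d_free (parity x)"
proof (induction x rule: word_frag_induct)
  case (2 w)
  show ?case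
  proof (induction w)
    case Nil
    then show ?case by (simp add: wrd_Nil parity_one d_free_one parity_zero del: single_one)
  next
    case (Cons l w)
    have "parity (d_free (gen l * wrd w)) = - d_free (parity (gen l * wrd w))"
      by (cases l) (simp_all only: d_free_mult parity_mult parity_add parity_gen d_free_gen Cons.IH
          d_free_uminus parity_uminus parity_zero, simp_all add: algebra_simps)
    then show ?case by (subst (1 2) wrd_Cons)
  qed
qed (simp_all add: parity_zero d_free_zero parity_diff d_free_diff)

lemma d_free_d_free: "d_free (d_free x) = 0"
proof (induction x rule: word_frag_induct)
  case (2 w)
  show ?case
  proof (induction w)
    case Nil
    then show ?case by (simp add: wrd_Nil d_free_one d_free_zero del: single_one)
  next
    case (Cons l w)
    have "d_free (d_free (gen l * wrd w)) = 0"
      by (cases l) (simp_all only: d_free_mult d_free_add parity_gen d_free_gen Cons.IH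
          d_free_uminus parity_uminus parity_zero d_free_zero, simp_all add: algebra_simps)
    then show ?case by (subst wrd_Cons)
  qed
qed (simp_all add: d_free_zero d_free_diff)

section \<open>Ideals of the free ring that are stable under the derivation\<close>

lemma free_ideal:
  assumes "ideal I (free_ring Y)"
  shows "x \<in> I \<Longrightarrow> x \<in> carrier (free_ring Y)" "0 \<in> I"
    "x \<in> I \<Longrightarrow> y \<in> I \<Longrightarrow> x + y \<in> I" "x \<in> I \<Longrightarrow> - x \<in> I" "x \<in> I \<Longrightarrow> y \<in> I \<Longrightarrow> x - y \<in> I"
    "x \<in> I \<Longrightarrow> a \<in> carrier (free_ring Y) \<Longrightarrow> a * x \<in> I"
    "x \<in> I \<Longrightarrow> a \<in> carrier (free_ring Y) \<Longrightarrow> x * a \<in> I"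
proof -
  interpret ideal I "free_ring Y" by fact
  show c: "x \<in> carrier (free_ring Y)" if "x \<in> I" for x using that Icarr assms by simp
  show "0 \<in> I" using additive_subgroup.zero_closed[OF is_additive_subgroup] by simp
  show ad: "x + y \<in> I" if "x \<in> I" "y \<in> I" for x y using that additive_subgroup.a_closed[OF is_additive_subgroup, of x y] by simp
  show mi: "- x \<in> I" if "x \<in> I" for x using that additive_subgroup.a_inv_closed[OF is_additive_subgroup, of x] free_ring_a_inv[OF c] by simp
  show "x - y \<in> I" if "x \<in> I" "y \<in> I" for x y using ad[OF that(1) mi[OF that(2)]] by simp
  show "a * x \<in> I" if "x \<in> I" "a \<in> carrier (free_ring Y)" for a x using that I_l_closed[of x a] assms by simp
  show "x * a \<in> I" if "x \<in> I" "a \<in> carrier (free_ring Y)" for a x using that I_r_closed[of x a] assms by simp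
qed

lemma free_idealI:
  assumes "K \<subseteq> carrier (free_ring Y)" "0 \<in> K" "\<And>x y. x \<in> K \<Longrightarrow> y \<in> K \<Longrightarrow> x + y \<in> K"
    "\<And>x. x \<in> K \<Longrightarrow> - x \<in> K"
    "\<And>a x. x \<in> K \<Longrightarrow> a \<in> carrier (free_ring Y) \<Longrightarrow> a * x \<in> K"
    "\<And>a x. x \<in> K \<Longrightarrow> a \<in> carrier (free_ring Y) \<Longrightarrow> x * a \<in> K"
  shows "ideal K (free_ring Y)"
proof -
  interpret ring "free_ring Y" by (rule ring_free_ring)
  have "subgroup K (add_monoid (free_ring Y))"
  proof (rule add.subgroupI)
    fix a assume "a \<in> K"
    then show "\<ominus>\<^bsub>free_ring Y\<^esub> a \<in> K"
      using assms(1,4) by (simp add: free_ring_a_inv subset_iff)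
  qed (use assms in auto)
  then show ?thesis using assms by (intro idealI ring_free_ring) auto
qed

lemma ideal_Idl: "G \<subseteq> carrier (free_ring Y) \<Longrightarrow> ideal (Idl\<^bsub>free_ring Y\<^esub> G) (free_ring Y)"
  by (rule ring.genideal_ideal[OF ring_free_ring])

lemma Idl_gen: "G \<subseteq> carrier (free_ring Y) \<Longrightarrow> G \<subseteq> Idl\<^bsub>free_ring Y\<^esub> G"
  by (rule ring.genideal_self[OF ring_free_ring])

lemma Idl_le: "ideal K (free_ring Y) \<Longrightarrow> G \<subseteq> K \<Longrightarrow> Idl\<^bsub>free_ring Y\<^esub> G \<subseteq> K"
  by (rule ring.genideal_minimal[OF ring_free_ring])

text \<open>By the Leibniz rule, the elements x of the ideal for which parity(x) and dx also lie in
  it form an ideal: left multiples need dx, right multiples also parity(x), because d(xa) = dx a +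
  parity(x) da. So it is enough to inspect generators.\<close>

lemma Idl_d_stable:
  assumes G: "G \<subseteq> carrier (free_ring Y)"
    and p: "\<And>g. g \<in> G \<Longrightarrow> parity g \<in> Idl\<^bsub>free_ring Y\<^esub> G"
    and d: "\<And>g. g \<in> G \<Longrightarrow> d_free g \<in> Idl\<^bsub>free_ring Y\<^esub> G"
    and x: "x \<in> Idl\<^bsub>free_ring Y\<^esub> G"
  shows "parity x \<in> Idl\<^bsub>free_ring Y\<^esub> G" "d_free x \<in> Idl\<^bsub>free_ring Y\<^esub> G"
proof -
  let ?N = "Idl\<^bsub>free_ring Y\<^esub> G"
  note N = free_ideal[OF ideal_Idl[OF G]]
  have "ideal {x \<in> ?N. parity x \<in> ?N \<and> d_free x \<in> ?N} (free_ring Y)"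
    by (rule free_idealI)
       (auto simp: parity_zero d_free_zero parity_add d_free_add parity_uminus d_free_uminus
          parity_mult d_free_mult intro: N parity_in d_free_in)
  then have "?N \<subseteq> {x \<in> ?N. parity x \<in> ?N \<and> d_free x \<in> ?N}"
    by (rule Idl_le) (use Idl_gen[OF G] p d in auto)
  with x show "parity x \<in> ?N" "d_free x \<in> ?N" by auto
qed

section \<open>Graded commutativity modulo the defining relations\<close>

lemma homog_gen: "letter_in Y l \<Longrightarrow> gen l \<in> homog Y (letter_deg l)"
  by (rule homog_wrd) auto

lemma homog_one: "1 \<in> homog Y 0"
  using homog_wrd[of Y "[]"] by (simp add: wrd_Nil del: single_one)

lemma gen_in: "letter_in Y l \<Longrightarrow> gen l \<in> carrier (free_ring Y)"
  by (simp add: wrd_in)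

lemma central_in: "a \<in> carrier (lring Y) \<Longrightarrow> letter_in Y l \<Longrightarrow>
    gen (Sc a) * gen l - gen l * gen (Sc a) \<in> central_rels Y"
  by (auto simp: central_rels_def)

locale free_quotient =
  fixes Y :: "('s, 'q) prelog" and N
  assumes idl: "ideal N (free_ring Y)"
    and comm: "central_rels Y \<subseteq> N" "alternating_rels Y \<subseteq> N"
begin

lemmas N = free_ideal[OF idl]

text \<open>The sign (-1)^(ij) is expressed by applying \<open>parity\<close> to the second factor
  if the first is odd. A scalar commutes by the central relations, and two odd letters anticommute
  by the alternating ones.\<close>

lemma letters_commute:
  assumes "letter_in Y l" "letter_in Y l'"
  shows "gen l * gen l' - (if even (letter_deg l) then gen l' else parity (gen l')) * gen l \<in> N"
proof -
  have sc: "gen (Sc a) * gen k - gen k * gen (Sc a) \<in> N" if "a \<in> carrier (lring Y)" "letter_in Y k" for a k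
    using central_in[OF that] comm by blast
  have odd: "gen l * gen l' + gen l' * gen l \<in> N" if "letter_deg l = 1" "letter_deg l' = 1"
  proof -
    have h: "gen l \<in> homog Y 1" "gen l' \<in> homog Y 1"
      using homog_gen[OF assms(1)] homog_gen[OF assms(2)] that by auto
    have sq: "x * x \<in> N" if "x \<in> homog Y 1" for x
      using that comm(2) by (auto simp: alternating_rels_def)
    \<comment> \<open>Polarization: the squares of l, l' and l + l' vanish, hence so does the mixed
      term.\<close>
    have "(gen l + gen l') * (gen l + gen l') - gen l * gen l - gen l' * gen l' \<in> N"
      by (intro N(5) sq homog_add h)
    then show ?thesis by (simp only: distrib_left distrib_right) (simp add: algebra_simps)
  qed
  show ?thesis
  proof (cases l)
    case (Sc a)
    then show ?thesis using sc[of a l'] assms by simp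
  next
    case l: (Dd s)
    show ?thesis
    proof (cases l')
      case (Sc a)
      then show ?thesis using N(4)[OF sc[of a l]] assms l by (simp add: parity_gen)
    qed (use odd l in \<open>auto simp only: parity_gen letter_deg.simps\<close>, use odd l in \<open>simp_all\<close>)
  next
    case l: (Dl s)
    show ?thesis
    proof (cases l')
      case (Sc a)
      then show ?thesis using N(4)[OF sc[of a l]] assms l by (simp add: parity_gen)
    qed (use odd l in \<open>auto simp only: parity_gen letter_deg.simps\<close>, use odd l in \<open>simp_all\<close>)
  qed
qed

lemma letter_commute:
  assumes "letter_in Y l" "y \<in> carrier (free_ring Y)"
  shows "gen l * y - (if even (letter_deg l) then y else parity y) * gen l \<in> N"
  using assms(2)
proof (induction y rule: free_induct)
  case (word w)
  then show ?case
  proof (induction w)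
    case Nil
    then show ?case by (simp add: wrd_Nil parity_one N del: single_one)
  next
    case (Cons k w)
    let ?p = "\<lambda>x. if even (letter_deg l) then x else parity x"
    have c: "wrd w \<in> carrier (free_ring Y)" "?p (gen k) \<in> carrier (free_ring Y)"
      using Cons.prems by (auto simp: wrd_in intro: parity_in)
    have "gen l * (gen k * wrd w) - ?p (gen k * wrd w) * gen l =
      (gen l * gen k - ?p (gen k) * gen l) * wrd w + ?p (gen k) * (gen l * wrd w - ?p (wrd w) * gen l)"
      by (simp add: parity_mult algebra_simps)
    also have "\<dots> \<in> N"
      by (rule N(3)[OF N(7) N(6)]) (use Cons letters_commute[OF assms(1), of k] c in auto)
    finally show ?case by (subst (1 2 3) wrd_Cons)
  qed
next
  case (diff a b)
  let ?p = "\<lambda>x. if even (letter_deg l) then x else parity x"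
  have "gen l * (a - b) - ?p (a - b) * gen l = (gen l * a - ?p a * gen l) - (gen l * b - ?p b * gen l)"
    by (simp add: parity_diff algebra_simps)
  then show ?case using N(5)[OF diff(3,4)] by simp
qed (simp add: parity_zero N)

lemma word_commute:
  assumes "word_in Y w" "y \<in> carrier (free_ring Y)"
  shows "wrd w * y - (if even (wdeg w) then y else parity y) * wrd w \<in> N"
  using assms(1)
proof (induction w)
  case Nil
  then show ?case by (simp add: wrd_Nil N del: single_one)
next
  case (Cons l w)
  define z where "z = (if even (wdeg w) then y else parity y)"
  have z: "z \<in> carrier (free_ring Y)" using assms(2) by (auto simp: z_def intro: parity_in)
  have c: "gen l \<in> carrier (free_ring Y)" "wrd w \<in> carrier (free_ring Y)"
    using Cons.prems by (auto simp: wrd_in)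
  have e: "(if even (wdeg (l # w)) then y else parity y) = (if even (letter_deg l) then z else parity z)"
    by (auto simp: z_def parity_parity)
  have "gen l * wrd w * y - (if even (letter_deg l) then z else parity z) * (gen l * wrd w) =
    gen l * (wrd w * y - z * wrd w) + (gen l * z - (if even (letter_deg l) then z else parity z) * gen l) * wrd w"
    by (simp add: algebra_simps)
  also have "\<dots> \<in> N"
    by (rule N(3)[OF N(6) N(7)]) (use Cons letter_commute[of l z] z c in \<open>auto simp: z_def\<close>)
  finally show ?case unfolding e by (subst (1 2) wrd_Cons)
qed

lemma odd_commute:
  assumes "x \<in> homog Y 1" "y \<in> carrier (free_ring Y)"
  shows "x * y - parity y * x \<in> N"
  using assms(1)
proof (induction x rule: homog_induct)
  case (word w)
  then show ?case using word_commute[OF word(1) assms(2)] by simp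
next
  case (diff a b)
  have "(a - b) * y - parity y * (a - b) = (a * y - parity y * a) - (b * y - parity y * b)"
    by (simp add: algebra_simps)
  then show ?case using N(5)[OF diff(3,4)] by simp
qed (simp add: N)

text \<open>d(x^2) = dx x - x dx for x of degree 1, and dx, being even, commutes with x modulo the
  ideal.\<close>

lemma square_d:
  assumes x: "x \<in> homog Y 1"
  shows "d_free (x * x) \<in> N"
proof -
  have "parity (d_free x) = d_free x"
    using parity_homog[OF x] by (simp add: parity_d_free d_free_uminus)
  then have "- (x * d_free x - d_free x * x) \<in> N"
    using N(4)[OF odd_commute[OF x d_free_in[OF homog_in[OF x]]]] by simp
  then show ?thesis using parity_homog[OF x] by (simp add: d_free_mult)
qed

end

context prelog_pair
begin

text \<open>On a homogeneous generator \<open>parity\<close> acts by a sign, which settles its part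
  of the stability of the ideals.\<close>

lemma log_dR_rels_homog:
  assumes "g \<in> log_dR_rels X Y \<phi> \<psi>"
  shows "\<exists>i. g \<in> homog Y i"
proof -
  note h = homog_gen[of Y "Sc _", simplified] homog_gen[of Y "Dd _", simplified] homog_gen[of Y "Dl _", simplified]
  note hm = homog_mult[of _ Y 0 _ 0, simplified] homog_mult[of _ Y 0 _ 1, simplified]
  have 1: "g \<in> homog Y 0" if "g \<in> scalar_rels Y"
    using that by (auto simp: scalar_rels_def Let_def intro!: homog_diff homog_add h homog_one hm)
  have 2: "\<exists>i. g \<in> homog Y i" if c: "g \<in> central_rels Y"
  proof -
    obtain a l where al: "g = gen (Sc a) * gen l - gen l * gen (Sc a)" "a \<in> carrier (lring Y)" "letter_in Y l"
      using c unfolding central_rels_def by blast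
    have "g \<in> homog Y (letter_deg l)"
      unfolding al(1)
      using homog_mult[OF homog_gen[of Y "Sc a"] homog_gen[OF al(3)]]
        homog_mult[OF homog_gen[OF al(3)] homog_gen[of Y "Sc a"]] al
      by (intro homog_diff) auto
    then show ?thesis ..
  qed
  have 3: "g \<in> homog Y 1" if "g \<in> kaehler_rels X Y \<phi>"
    using that by (auto simp: kaehler_rels_def Let_def intro!: homog_diff homog_add h hm phi_closed)
  have 4: "g \<in> homog Y 1" if "g \<in> dlog_rels X Y \<psi>"
    using that by (auto simp: dlog_rels_def Let_def intro!: homog_diff homog_add h hm psi_closed lmap_closed)
  have 5: "g \<in> homog Y 2" if "g \<in> alternating_rels Y"
    using that homog_mult[of _ Y 1 _ 1] by (auto simp: alternating_rels_def numeral_2_eq_2)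
  from 1 2 3 4 5 assms show ?thesis by (auto simp: log_dR_rels_def)
qed

text \<open>d turns the scalar relations into Kaehler relations, up to moving scalars to the front.
  The central and product relations yield commutators and anticommutators of letters. What is left
  are the relation between d and dlog and the squares.\<close>

lemma log_dR_rels_d:
  assumes NI: "ideal N (free_ring Y)" "log_dR_rels X Y \<phi> \<psi> \<subseteq> N" and g: "g \<in> log_dR_rels X Y \<phi> \<psi>"
  shows "d_free g \<in> N"
proof -
  interpret free_quotient Y N
    using NI by (intro free_quotient.intro) (auto simp: log_dR_rels_def)
  note ds = d_free_diff d_free_add d_free_mult d_free_gen parity_gen d_free_one
  have lc: "gen l * gen l' + gen l' * gen l \<in> N" if "letter_in Y l" "letter_in Y l'"
    "letter_deg l = 1" "letter_deg l' = 1" for l l'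
    using letters_commute[OF that(1,2)] that(3,4) by (cases l') (auto simp: parity_gen)
  have cen: "gen (Sc a) * gen l - gen l * gen (Sc a) \<in> N" if "a \<in> carrier (lring Y)" "letter_in Y l" for a l
    using central_in[OF that] NI(2) by (auto simp: log_dR_rels_def)
  have ka: "x \<in> N" if "x \<in> kaehler_rels X Y \<phi>" for x using that NI(2) by (auto simp: log_dR_rels_def)
  have 1: ?thesis if "g \<in> scalar_rels Y"
  proof -
    consider (add) a b where "a \<in> carrier (lring Y)" "b \<in> carrier (lring Y)"
        "g = gen (Sc (a \<oplus>\<^bsub>lring Y\<^esub> b)) - (gen (Sc a) + gen (Sc b))"
      | (mult) a b where "a \<in> carrier (lring Y)" "b \<in> carrier (lring Y)"
        "g = gen (Sc (a \<otimes>\<^bsub>lring Y\<^esub> b)) - gen (Sc a) * gen (Sc b)"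
      | (one) "g = gen (Sc \<one>\<^bsub>lring Y\<^esub>) - 1"
      using \<open>g \<in> scalar_rels Y\<close> unfolding scalar_rels_def Let_def by blast
    then show ?thesis
    proof cases
      case add
      then have "gen (Dd (a \<oplus>\<^bsub>lring Y\<^esub> b)) - (gen (Dd a) + gen (Dd b)) \<in> kaehler_rels X Y \<phi>"
        unfolding kaehler_rels_def Let_def by blast
      from ka[OF this] show ?thesis by (simp only: add ds)
    next
      case mult
      have "gen (Dd (a \<otimes>\<^bsub>lring Y\<^esub> b)) - (gen (Sc a) * gen (Dd b) + gen (Sc b) * gen (Dd a)) \<in> N"
        by (intro ka) (use mult in \<open>unfold kaehler_rels_def Let_def, blast\<close>)
      from N(3)[OF this cen[of b "Dd a"]] mult show ?thesis
        by (simp only: ds letter_in.simps) (simp add: algebra_simps)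
    next
      case one
      obtain r where "r \<in> carrier (lring X)" "\<phi> r = \<one>\<^bsub>lring Y\<^esub>" using phi_one by blast
      then have "gen (Dd \<one>\<^bsub>lring Y\<^esub>) \<in> N"
        by (intro ka) (unfold kaehler_rels_def Let_def, force)
      then show ?thesis by (simp add: one ds)
    qed
  qed
  have 2: ?thesis if c: "g \<in> central_rels Y"
  proof -
    obtain a l where al: "g = gen (Sc a) * gen l - gen l * gen (Sc a)" "a \<in> carrier (lring Y)" "letter_in Y l"
      using c unfolding central_rels_def by blast
    show ?thesis
    proof (cases l)
      case (Sc b)
      have "- (gen (Sc b) * gen (Dd a) - gen (Dd a) * gen (Sc b))
          + (gen (Sc a) * gen (Dd b) - gen (Dd b) * gen (Sc a)) \<in> N"
        using al Sc by (intro N(3) N(4) cen) auto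
      then show ?thesis by (simp add: al(1) Sc ds algebra_simps)
    next
      case (Dd b)
      then show ?thesis using lc[of "Dd a" "Dd b"] al by (simp add: ds)
    next
      case (Dl b)
      then show ?thesis using lc[of "Dd a" "Dl b"] al by (simp add: ds)
    qed
  qed
  have 3: ?thesis if "g \<in> kaehler_rels X Y \<phi>"
  proof -
    have "- (gen (Dd a) * gen (Dd b) + gen (Dd b) * gen (Dd a)) \<in> N"
      if "a \<in> carrier (lring Y)" "b \<in> carrier (lring Y)" for a b
      using that by (intro N(4) lc) auto
    with that show ?thesis by (auto simp: kaehler_rels_def Let_def ds N)
  qed
  have 4: ?thesis if "g \<in> dlog_rels X Y \<psi>"
  proof -
    \<comment> \<open>Applying d to the relation between d\<alpha>(q) and dlog q leaves
      -d\<alpha>(q) dlog q; by the same relation this is -\<alpha>(q) times the square of dlog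
      q.\<close>
    have "- (gen (Dd (lmap Y q)) * gen (Dl q)) \<in> N" if q: "q \<in> carrier (lmon Y)" for q
    proof -
      have "gen (Dd (lmap Y q)) - gen (Sc (lmap Y q)) * gen (Dl q) \<in> dlog_rels X Y \<psi>"
        unfolding dlog_rels_def Let_def using q by blast
      then have "gen (Dd (lmap Y q)) - gen (Sc (lmap Y q)) * gen (Dl q) \<in> N"
        using NI(2) by (auto simp only: log_dR_rels_def)
      moreover have "gen (Dl q) * gen (Dl q) \<in> N"
        using q comm(2) homog_gen[of Y "Dl q"] by (auto simp: alternating_rels_def)
      ultimately have "- ((gen (Dd (lmap Y q)) - gen (Sc (lmap Y q)) * gen (Dl q)) * gen (Dl q)
          + gen (Sc (lmap Y q)) * (gen (Dl q) * gen (Dl q))) \<in> N"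
        by (intro N(4) N(3)[OF N(7) N(6)] gen_in) (use q lmap_closed in auto)
      then show ?thesis by (simp add: algebra_simps)
    qed
    with that show ?thesis by (auto simp: dlog_rels_def Let_def ds N)
  qed
  have 5: ?thesis if "g \<in> alternating_rels Y"
    using that square_d by (auto simp: alternating_rels_def)
  from 1 2 3 4 5 g show ?thesis by (auto simp: log_dR_rels_def)
qed

end

section \<open>The ideals defining the log de Rham-Witt complex\<close>

lemma witt_prelog_simps [simp]:
  "lring (witt_prelog p m Y) = witt p m (lring Y)" "lmon (witt_prelog p m Y) = lmon Y"
  "lmap (witt_prelog p m Y) q = teich m (lring Y) (lmap Y q)"
  by (simp_all add: witt_prelog_def)

lemma V_free_uminus: "V_free p m Y (- x) = - V_free p m Y x"
  by (simp add: V_free_def frag_extend_uminus)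

lemma wdeg_V_letter: "wdeg (concat (map (V_letter S) w)) = wdeg w"
proof (induction w)
  case (Cons l w)
  then show ?case by (cases l) auto
qed simp

lemma parity_V_free: "parity (V_free p m Y x) = V_free p m Y (parity x)"
  by (induction x rule: word_frag_induct)
     (auto simp: V_free_zero V_free_diff parity_diff parity_zero V_free_wrd parity_wrd wdeg_V_letter
       V_free_uminus)

lemma parity_power: "parity (x ^ n) = parity x ^ n"
  by (induction n) (simp_all add: parity_one parity_mult)

lemma parity_free_hom:
  assumes "\<And>l. parity (h l) = (if even (letter_deg l) then h l else - h l)"
  shows "parity (free_hom h x) = free_hom h (parity x)"
proof (induction x rule: word_frag_induct)
  case (2 w)
  have "parity (prod_list (map h w)) = (if even (wdeg w) then prod_list (map h w) else - prod_list (map h w))"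
    by (induction w) (auto simp: parity_one parity_mult assms)
  moreover have "free_hom h (- wrd w) = - prod_list (map h w)"
    using free_hom_diff[of h 0 "wrd w"] by (simp add: free_hom_zero free_hom_wrd)
  ultimately show ?case by (simp add: free_hom_wrd parity_wrd)
qed (simp_all add: free_hom_zero free_hom_diff parity_zero parity_diff)

lemma parity_F_free: "parity (F_free p m Y x) = F_free p m Y (parity x)"
  unfolding F_free_def
proof (rule parity_free_hom)
  fix l :: "('a list, 'b) letter"
  show "parity (F_letter p m Y l) = (if even (letter_deg l) then F_letter p m Y l else - F_letter p m Y l)"
    by (cases l)
       (simp_all only: F_letter.simps Let_def parity_add parity_mult parity_power parity_gen
         letter_deg.simps, simp_all)
qed

locale drw =
  fixes p :: nat and X :: "('r, 'p) prelog" and Y :: "('s, 'q) prelog"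
    and \<phi> :: "'r \<Rightarrow> 's" and \<psi> :: "'p \<Rightarrow> 'q"
  assumes prime: "Factorial_Ring.prime p"
    and Z_local: "Z_local_algebra p (lring X)"
    and prelog_hom: "prelog_hom X Y \<phi> \<psi>"
begin

declare dRW_ideal.simps [simp del]

abbreviation "S \<equiv> lring Y"
abbreviation "A m \<equiv> wfree p m Y"

lemma cring_X: "cring (lring X)" and cring_S: "cring S"
  and phi_hom: "\<phi> \<in> ring_hom (lring X) S"
  using prelog_hom by (auto simp: prelog_hom_def prelog_ring_def)

sublocale S: witt_base S p
  by (intro witt_base.intro plain_cring.intro cring_S witt_base_axioms.intro prime)

sublocale R: witt_base "lring X" p
  by (intro witt_base.intro plain_cring.intro cring_X witt_base_axioms.intro prime)

sublocale W: cring "witt p m S" for m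
  by (rule S.cring_witt)

lemma comm_monoid_Y: "comm_monoid (lmon Y)"
  using prelog_hom by (auto simp: prelog_hom_def prelog_ring_def fine_monoid_def)

lemma map_teich: "x \<in> carrier (lring X) \<Longrightarrow> map \<phi> (teich m (lring X) x) = teich m S (\<phi> x)"
  using ring_hom_zero[OF phi_hom R.ring_axioms S.ring_axioms] by (simp add: teich_def)

lemma prelog_pair_witt: "prelog_pair (witt_prelog p m X) (witt_prelog p m Y) (map \<phi>) \<psi>"
proof (rule prelog_pair.intro)
  interpret M: comm_monoid "lmon Y" by (rule comm_monoid_Y)
  show "Group.monoid (lmon (witt_prelog p m Y))" by simp (rule M.monoid_axioms)
  show "map \<phi> r \<in> carrier (lring (witt_prelog p m Y))" if "r \<in> carrier (lring (witt_prelog p m X))" for r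
    using that ring_hom_closed[OF phi_hom] by (auto simp: witt_simps)
  show "\<exists>r\<in>carrier (lring (witt_prelog p m X)). map \<phi> r = \<one>\<^bsub>lring (witt_prelog p m Y)\<^esub>"
    using map_teich[of "\<one>\<^bsub>lring X\<^esub>" m] ring_hom_one[OF phi_hom]
    by (intro bexI[of _ "teich m (lring X) \<one>\<^bsub>lring X\<^esub>"]) (auto simp: R.teich_closed witt_simps(3))
  show "\<psi> a \<in> carrier (lmon (witt_prelog p m Y))" if "a \<in> carrier (lmon (witt_prelog p m X))" for a
    using that prelog_hom by (auto simp: prelog_hom_def monoid_map_def hom_def)
  show "lmap (witt_prelog p m Y) q \<in> carrier (lring (witt_prelog p m Y))"
    if "q \<in> carrier (lmon (witt_prelog p m Y))" for q
    using that prelog_hom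
    by (auto simp: prelog_hom_def prelog_ring_def monoid_map_def hom_def intro!: S.teich_closed)
  show "cring (lring (witt_prelog p m Y))" by (simp add: S.cring_witt)
qed

sublocale P: prelog_pair "witt_prelog p m X" "witt_prelog p m Y" "map \<phi>" \<psi> for m
  by (rule prelog_pair_witt)

lemma inverts_S: "inverts p S"
  using Z_local phi_hom S.ring_axioms prime by (rule inverts_Z_local_algebra)

lemma inverts_witt: "inverts p (witt p m S)"
  using inverts_S by (rule S.inverts_witt)

text \<open>Division-free form of p^(n-1)/n! = p^(n-1-k)/u: multiplied by the
  prime-to-\<open>p\<close> part u of n!, the coefficient becomes a power of \<open>p\<close>. The
  numbers k and u are the same for all levels m.\<close>

lemma pd_coefficient:
  assumes "n \<ge> 1"
  obtains k u where "(fact n :: nat) = p ^ k * u" "\<not> p dvd u" "k \<le> n - 1"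
    "n \<ge> 2 \<Longrightarrow> p \<noteq> 2 \<or> odd n \<Longrightarrow> k \<le> n - 2"
    "\<And>m. rat_in (witt p m S) (of_nat p ^ (n - 1) / fact n) \<in> carrier (witt p m S)"
    "\<And>m. [u] \<cdot>\<^bsub>witt p m S\<^esub> rat_in (witt p m S) (of_nat p ^ (n - 1) / fact n)
      = [(p ^ (n - 1 - k))] \<cdot>\<^bsub>witt p m S\<^esub> \<one>\<^bsub>witt p m S\<^esub>"
proof -
  obtain k u where ku: "(fact n :: nat) = p ^ k * u" "\<not> p dvd u" "k \<le> n - 1"
    "n \<ge> 2 \<Longrightarrow> p \<noteq> 2 \<or> odd n \<Longrightarrow> k \<le> n - 2"
    using fact_decomp[OF prime assms] by metis
  have p0: "(of_nat p :: rat) \<noteq> 0" using S.p_pos by simp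
  have "(fact n :: rat) = of_nat (p ^ k * u)" by (simp only: ku(1)[symmetric] of_nat_fact)
  moreover have "(of_nat p :: rat) ^ (n - 1) = of_nat p ^ k * of_nat p ^ (n - 1 - k)"
    by (subst power_add[symmetric]) (use ku(3) assms in \<open>simp only: le_add_diff_inverse\<close>)
  ultimately have eq: "(of_nat p ^ (n - 1) / fact n :: rat) = of_nat (p ^ (n - 1 - k)) / of_nat u"
    using p0 by simp
  note r = rat_in_spec[OF S.cring_witt inverts_witt ku(2), of _ "p ^ (n - 1 - k)", folded eq]
  show ?thesis by (rule that[OF ku r]) simp_all
qed

lemma witt_pd_closed:
  assumes "\<xi> \<in> carrier (witt p m S)"
  shows "witt_pd p m S n \<xi> \<in> carrier (witt p (Suc m) S)"
proof (cases "n = 0")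
  case False
  then have "n \<ge> 1" by simp
  then have "rat_in (witt p (Suc m) S) (of_nat p ^ (n - 1) / fact n) \<in> carrier (witt p (Suc m) S)"
    using pd_coefficient by metis
  with assms False show ?thesis by (simp add: witt_pd_def S.witt_V_closed W.m_closed W.nat_pow_closed)
qed (simp add: witt_pd_def)

lemma hd_tl_closed:
  assumes "\<xi> \<in> carrier (witt p (Suc m) S)"
  shows "hd \<xi> \<in> carrier S" "tl \<xi> \<in> carrier (witt p m S)" "butlast \<xi> \<in> carrier (witt p m S)"
  using assms by (cases \<xi>; auto simp: witt_simps dest: in_set_butlastD)+

lemma F_free_in:
  assumes "x \<in> carrier (A (Suc m))"
  shows "F_free p m Y x \<in> carrier (A m)"
  unfolding F_free_def
proof (rule free_hom_in[OF assms])
  fix l assume "letter_in (witt_prelog p (Suc m) Y) l"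
  then show "F_letter p m Y l \<in> carrier (A m)"
    by (cases l) (auto simp: Let_def S.witt_F_closed hd_tl_closed S.teich_closed simp del: power_Suc
        intro!: free_in gen_in)
qed

lemma res_free_in:
  assumes "x \<in> carrier (A (Suc m))"
  shows "res_free x \<in> carrier (A m)"
  unfolding res_free_def
proof (rule free_hom_in[OF assms])
  fix l assume "letter_in (witt_prelog p (Suc m) Y) l"
  then show "res_letter l \<in> carrier (A m)"
    by (cases l) (auto simp: hd_tl_closed intro!: gen_in)
qed

lemma scalar_part_simps [simp]:
  "scalar_part B [] = \<one>\<^bsub>B\<^esub>" "scalar_part B (Sc \<xi> # w) = \<xi> \<otimes>\<^bsub>B\<^esub> scalar_part B w"
  "scalar_part B (Dd \<xi> # w) = scalar_part B w" "scalar_part B (Dl q # w) = scalar_part B w"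
  by (simp_all add: scalar_part_def)

lemma scalar_part_closed:
  "word_in (witt_prelog p m Y) w \<Longrightarrow> scalar_part (witt p m S) w \<in> carrier (witt p m S)"
proof (induction w)
  case (Cons l w)
  then show ?case by (cases l) auto
qed simp

lemma V_letter_in:
  "word_in (witt_prelog p m Y) w \<Longrightarrow> word_in (witt_prelog p (Suc m) Y) (concat (map (V_letter S) w))"
proof (induction w)
  case (Cons l w)
  then show ?case by (cases l) (auto simp: S.witt_V_closed)
qed simp

lemma V_free_in: "x \<in> carrier (A m) \<Longrightarrow> V_free p m Y x \<in> carrier (A (Suc m))"
  by (induction x rule: free_induct)
     (auto simp: V_free_zero V_free_diff V_free_wrd wrd_in scalar_part_closed S.witt_V_closed V_letter_in
       intro: free_in)

section \<open>Generators of the ideals I and J in terms of V on the free ring\<close>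

definition term_word :: "'s list \<times> 'q list \<times> 's list list \<Rightarrow> ('s list, 'q) letter list" where
  "term_word t = (case t of (\<xi>, qs, \<eta>s) \<Rightarrow> Sc \<xi> # map Dl qs @ map Dd \<eta>s)"

lemma terms_ok_word:
  assumes "terms_ok p m Y i L" "t \<in> set L"
  shows "word_in (witt_prelog p m Y) (term_word t)" "wdeg (term_word t) = i"
proof -
  have "wdeg (map Dl qs :: ('s list, 'q) letter list) = length qs"
    "wdeg (map Dd \<eta>s :: ('s list, 'q) letter list) = length \<eta>s" for qs :: "'q list" and \<eta>s :: "'s list list"
    by (induction qs; simp) (induction \<eta>s; simp)
  moreover obtain \<xi> qs \<eta>s where t: "t = (\<xi>, qs, \<eta>s)" by (cases t)
  moreover have "\<xi> \<in> carrier (witt p m S)" "set qs \<subseteq> carrier (lmon Y)"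
    "set \<eta>s \<subseteq> carrier (witt p m S)" "length qs + length \<eta>s = i"
    using bspec[OF assms(1)[unfolded terms_ok_def] assms(2)] by (simp_all add: t)
  ultimately show "word_in (witt_prelog p m Y) (term_word t)" "wdeg (term_word t) = i"
    by (auto simp: term_word_def word_in_def subset_iff)
qed

lemma terms_sum_word: "terms_sum L = (\<Sum>t\<leftarrow>L. wrd (term_word t))"
  unfolding terms_sum_def term_word_def
  by (rule arg_cong[of _ _ "\<lambda>f. sum_list (map f L)"]) auto

lemma terms_homog:
  assumes "terms_ok p m Y i L"
  shows "terms_sum L \<in> homog (witt_prelog p m Y) i"
  unfolding terms_sum_word using terms_ok_word[OF assms]
proof (induction L)
  case (Cons t L)
  have "wrd (term_word t) \<in> homog (witt_prelog p m Y) i"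
    by (rule homog_wrd) (use Cons.prems in auto)
  with Cons show ?case by (simp add: homog_add)
qed (simp add: homog_zero)

lemma V_free_term:
  assumes "word_in (witt_prelog p m Y) (term_word (\<xi>, qs, \<eta>s))"
  shows "V_free p m Y (wrd (term_word (\<xi>, qs, \<eta>s)))
    = wrd (Sc (witt_V S \<xi>) # map Dl qs @ map (\<lambda>\<eta>. Dd (witt_V S \<eta>)) \<eta>s)"
proof -
  have 1: "scalar_part B (map Dl qs @ map Dd \<eta>s) = \<one>\<^bsub>B\<^esub>" for B :: "'s list ring"
    by (induction qs; simp) (induction \<eta>s; simp)
  have 2: "concat (map (V_letter S) (map Dl qs @ map Dd \<eta>s)) = map Dl qs @ map (\<lambda>\<eta>. Dd (witt_V S \<eta>)) \<eta>s"
    by (induction qs; simp) (induction \<eta>s; simp)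
  have "\<xi> \<in> carrier (witt p m S)" using assms by (simp add: term_word_def)
  then show ?thesis using 2 by (simp add: V_free_wrd term_word_def 1)
qed

lemma V_free_add: "V_free p m Y (x + y) = V_free p m Y x + V_free p m Y y"
  by (simp add: V_free_def frag_extend_add)

text \<open>A term has a single scalar letter, in front, which is the normal form on which V is
  given; \<open>V_free\<close> extends this to words with scalars anywhere.\<close>

lemma terms_V_eq:
  assumes "terms_ok p m Y i L"
  shows "terms_V S L = V_free p m Y (terms_sum L)"
  using terms_ok_word(1)[OF assms]
proof (induction L)
  case (Cons t L)
  obtain \<xi> qs \<eta>s where t: "t = (\<xi>, qs, \<eta>s)" by (cases t)
  have "terms_V S L = V_free p m Y (terms_sum L)" using Cons by simp
  moreover have "terms_sum (t # L) = wrd (term_word t) + terms_sum L" by (simp add: terms_sum_word)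
  ultimately show ?case
    using V_free_term[of m \<xi> qs \<eta>s] Cons.prems by (simp add: terms_V_def t V_free_add)
qed (simp add: terms_V_def terms_sum_def V_free_zero)

lemma terms_dV_eq: "terms_dV S L = d_free (terms_V S L)"
proof (induction L)
  case (Cons t L)
  obtain \<xi> qs \<eta>s where t: "t = (\<xi>, qs, \<eta>s)" by (cases t)
  have "d_word (map Dl qs @ map (\<lambda>\<eta>. Dd (witt_V S \<eta>)) \<eta>s) = 0"
    by (induction qs; simp) (induction \<eta>s; simp)
  then show ?case using Cons by (simp add: terms_V_def terms_dV_def t d_free_add d_free_wrd)
qed (simp add: terms_V_def terms_dV_def d_free_zero)

text \<open>Replaces lists of terms by homogeneous elements x of the previous ideal: the generators
  come in pairs \<open>V_free x\<close> and its d, since all letters after the scalar are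
  closed.\<close>

lemma I_gens_cases:
  assumes "g \<in> I_gens p m Y N"
  obtains i x where "x \<in> homog (witt_prelog p m Y) i" "x \<in> N"
    "g = V_free p m Y x \<or> g = d_free (V_free p m Y x)" "V_free p m Y x \<in> I_gens p m Y N"
    "d_free (V_free p m Y x) \<in> I_gens p m Y N"
proof -
  obtain L i where L: "terms_ok p m Y i L" "terms_sum L \<in> N" "g = terms_V S L \<or> g = terms_dV S L"
    using assms by (auto simp: I_gens_def)
  have "terms_V S L \<in> I_gens p m Y N" "terms_dV S L \<in> I_gens p m Y N"
    using L unfolding I_gens_def by blast+
  then show ?thesis
    using L that[OF terms_homog[OF L(1)]] terms_V_eq[OF L(1)] terms_dV_eq[of L] by auto
qed

lemma VF_defect_in:
  "\<omega> \<in> carrier (A m) \<Longrightarrow> \<eta> \<in> carrier (A (Suc m)) \<Longrightarrow> VF_defect p m Y \<omega> \<eta> \<in> carrier (A (Suc m))"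
  unfolding VF_defect_def by (intro free_in V_free_in F_free_in)

text \<open>The generators of J are not homogeneous, as \<omega> and \<eta> are arbitrary;
  \<open>parity\<close> permutes them instead.\<close>

lemma parity_VF_defect: "parity (VF_defect p m Y \<omega> \<eta>) = VF_defect p m Y (parity \<omega>) (parity \<eta>)"
  by (simp add: VF_defect_def parity_diff parity_mult parity_V_free parity_F_free)

lemma J_gens_cases:
  assumes "g \<in> J_gens p m Y"
  obtains \<omega> \<eta> where "\<omega> \<in> carrier (A m)" "\<eta> \<in> carrier (A (Suc m))"
    "g = VF_defect p m Y \<omega> \<eta> \<or> g = d_free (VF_defect p m Y \<omega> \<eta>)"
  using assms by (auto simp: J_gens_def)

lemma J_gensI:
  assumes "\<omega> \<in> carrier (A m)" "\<eta> \<in> carrier (A (Suc m))"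
  shows "VF_defect p m Y \<omega> \<eta> \<in> J_gens p m Y" "d_free (VF_defect p m Y \<omega> \<eta>) \<in> J_gens p m Y"
  using assms unfolding J_gens_def by blast+

text \<open>Generating sets for all levels at once. At level 0 the whole carrier is listed, so that
  every defining ideal is an \<open>Idl\<close> and one stability argument serves them all.\<close>

definition rels :: "nat \<Rightarrow> ('s list, 'q) free set" where
  "rels m = (case m of 0 \<Rightarrow> carrier (A 0) | Suc 0 \<Rightarrow> wdR_rels p 1 X Y \<phi> \<psi>
     | Suc (Suc k) \<Rightarrow> wdR_rels p (Suc (Suc k)) X Y \<phi> \<psi> \<union> pd_rels p (Suc k) Y
      \<union> I_gens p (Suc k) Y (dRW_ideal p X Y \<phi> \<psi> (Suc k)) \<union> J_gens p (Suc k) Y)"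

abbreviation "N m \<equiv> dRW_ideal p X Y \<phi> \<psi> m"

lemma wdR_rels_in: "wdR_rels p m X Y \<phi> \<psi> \<subseteq> carrier (A m)"
  using P.log_dR_rels_homog[of _ m] homog_in by (fastforce simp: wdR_rels_def)

lemma pd_rels_cases:
  assumes "g \<in> pd_rels p m Y"
  obtains n \<xi> where "n \<ge> 1" "\<xi> \<in> carrier (witt p m S)"
    "g = gen (Dd (witt_pd p m S n \<xi>)) - gen (Sc (witt_pd p m S (n - 1) \<xi>)) * gen (Dd (witt_V S \<xi>))"
  using assms unfolding pd_rels_def Let_def by blast

lemma pd_rels_homog: "g \<in> pd_rels p m Y \<Longrightarrow> g \<in> homog (witt_prelog p (Suc m) Y) 1"
proof (erule pd_rels_cases)
  fix n \<xi> assume \<xi>: "\<xi> \<in> carrier (witt p m S)"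
    and g: "g = gen (Dd (witt_pd p m S n \<xi>)) - gen (Sc (witt_pd p m S (n - 1) \<xi>)) * gen (Dd (witt_V S \<xi>))"
  let ?Y = "witt_prelog p (Suc m) Y"
  have "gen (Sc (witt_pd p m S (n - 1) \<xi>)) * gen (Dd (witt_V S \<xi>)) \<in> homog ?Y (0 + 1)"
    using homog_gen[of ?Y "Sc (witt_pd p m S (n - 1) \<xi>)"] homog_gen[of ?Y "Dd (witt_V S \<xi>)"] \<xi>
    by (intro homog_mult) (auto simp: witt_pd_closed S.witt_V_closed)
  then show ?thesis unfolding g
    using homog_gen[of ?Y "Dd (witt_pd p m S n \<xi>)"] \<xi> by (intro homog_diff) (auto simp: witt_pd_closed)
qed

lemma rels_in: "rels m \<subseteq> carrier (A m)"
proof -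
  consider "m = 0" | "m = 1" | k where "m = Suc (Suc k)" by (metis One_nat_def not0_implies_Suc)
  then show ?thesis
  proof cases
    case 3
    have "g \<in> carrier (A (Suc (Suc k)))" if "g \<in> pd_rels p (Suc k) Y" for g
      using pd_rels_homog[OF that] homog_in by blast
    moreover have "g \<in> carrier (A (Suc (Suc k)))" if "g \<in> I_gens p (Suc k) Y (N (Suc k))" for g
      using that by (rule I_gens_cases) (auto intro: V_free_in d_free_in homog_in)
    moreover have "g \<in> carrier (A (Suc (Suc k)))" if "g \<in> J_gens p (Suc k) Y" for g
      using that by (rule J_gens_cases) (auto intro: VF_defect_in d_free_in)
    ultimately show ?thesis using wdR_rels_in by (auto simp: rels_def 3)
  qed (use wdR_rels_in in \<open>auto simp: rels_def\<close>)
qed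

lemma N_Idl: "N m = Idl\<^bsub>A m\<^esub> (rels m)"
proof -
  consider "m = 0" | "m = 1" | k where "m = Suc (Suc k)" by (metis One_nat_def not0_implies_Suc)
  then show ?thesis
  proof cases
    case 1
    have "Idl\<^bsub>A 0\<^esub> (rels 0) \<subseteq> carrier (A 0)"
      using ideal_Idl[OF rels_in[of 0]] free_ideal(1) by blast
    then show ?thesis using 1 Idl_gen[OF rels_in[of 0]] by (auto simp: rels_def dRW_ideal.simps)
  qed (simp_all add: rels_def dRW_ideal.simps)
qed

lemma N_ideal: "ideal (N m) (A m)"
  unfolding N_Idl by (rule ideal_Idl[OF rels_in])

lemma rels_N: "rels m \<subseteq> N m"
  unfolding N_Idl by (rule Idl_gen[OF rels_in])

lemma wdR_rels_N: "wdR_rels p m X Y \<phi> \<psi> \<subseteq> N m"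
proof -
  consider "m = 0" | "m = 1" | k where "m = Suc (Suc k)" by (metis One_nat_def not0_implies_Suc)
  then show ?thesis
    using rels_N[of m] wdR_rels_in[of m] by cases (auto simp: rels_def dRW_ideal.simps)
qed

text \<open>The generators of I and J come in pairs g, dg, so d is dealt with by d^2 = 0; the
  divided power relations need the computation below.\<close>

lemma rels_stable:
  assumes g: "g \<in> rels m"
  shows "parity g \<in> N m \<and> d_free g \<in> N m"
proof -
  note I = free_ideal[OF N_ideal]
  have hom: "parity g \<in> N m" if "g \<in> homog Z i" "g \<in> N m" for Z i
    using parity_homog[OF that(1)] that(2) I(4) by (cases "even i") auto
  have wdR: "parity g \<in> N m \<and> d_free g \<in> N m" if "g \<in> wdR_rels p m X Y \<phi> \<psi>"
  proof
    have "g \<in> N m" using that wdR_rels_N by blast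
    then show "parity g \<in> N m" using P.log_dR_rels_homog[of g m] that hom by (auto simp: wdR_rels_def)
    show "d_free g \<in> N m"
      by (rule P.log_dR_rels_d[OF N_ideal]) (use wdR_rels_N that in \<open>auto simp: wdR_rels_def\<close>)
  qed
  consider "m = 0" | "m = 1" | k where "m = Suc (Suc k)" by (metis One_nat_def not0_implies_Suc)
  then show ?thesis
  proof cases
    case 1
    then show ?thesis using g by (auto simp: rels_def dRW_ideal.simps intro: parity_in d_free_in)
  next
    case 2
    then show ?thesis using g wdR by (auto simp: rels_def)
  next
    case (3 k)
    have gN: "g \<in> N m" using g rels_N by blast
    from g 3 consider "g \<in> wdR_rels p m X Y \<phi> \<psi>" | "g \<in> pd_rels p (Suc k) Y"
      | "g \<in> I_gens p (Suc k) Y (N (Suc k))" | "g \<in> J_gens p (Suc k) Y"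
      by (auto simp: rels_def)
    then show ?thesis
    proof cases
      case 1
      then show ?thesis by (rule wdR)
    next
      case 2
      interpret F: free_quotient "witt_prelog p m Y" "N m"
        using wdR_rels_N[of m] N_ideal by (intro free_quotient.intro) (auto simp: wdR_rels_def log_dR_rels_def)
      let ?\<gamma> = "witt_pd p (Suc k) S"
      have "d_free g \<in> N m" using 2
      proof (cases rule: pd_rels_cases)
        case (1 n \<xi>)
        let ?v = "gen (Dd (witt_V S \<xi>))"
        have v: "witt_V S \<xi> \<in> carrier (witt p m S)" using 1(2) S.witt_V_closed by (simp add: 3)
        have \<gamma>: "?\<gamma> j \<xi> \<in> carrier (witt p m S)" for j using 1(2) witt_pd_closed by (simp add: 3)
        \<comment> \<open>Up to sign this is d of the relation. The relation for n - 1 rewrites it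
          as \<gamma>_(n-2) times the square of dV\<xi>, which vanishes. For n = 1 the first factor
          is d of \<gamma>_0 = 1, and 1 comes from the base.\<close>
        have "gen (Dd (?\<gamma> (n - 1) \<xi>)) * ?v \<in> N m"
        proof (cases "n = 1")
          case True
          obtain r where "r \<in> carrier (witt p m (lring X))" "map \<phi> r = \<one>\<^bsub>witt p m S\<^esub>"
            using P.phi_one[of m] by auto
          then have "gen (Dd \<one>\<^bsub>witt p m S\<^esub>) \<in> wdR_rels p m X Y \<phi> \<psi>"
            unfolding wdR_rels_def log_dR_rels_def kaehler_rels_def Let_def witt_prelog_simps by force
          then have "gen (Dd (?\<gamma> 0 \<xi>)) \<in> N m" using wdR_rels_N by (auto simp: witt_pd_def 3)
          then show ?thesis using True v by (intro I(7) gen_in) auto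
        next
          case False
          then have n1: "n - 1 \<ge> 1" using 1(1) by simp
          have "gen (Dd (?\<gamma> (n - 1) \<xi>)) - gen (Sc (?\<gamma> (n - 1 - 1) \<xi>)) * ?v \<in> pd_rels p (Suc k) Y"
            unfolding pd_rels_def Let_def using n1 1(2) by blast
          then have "gen (Dd (?\<gamma> (n - 1) \<xi>)) - gen (Sc (?\<gamma> (n - 1 - 1) \<xi>)) * ?v \<in> N m"
            using rels_N[of m] by (auto simp: rels_def 3)
          moreover have "?v * ?v \<in> N m"
            using F.comm(2) homog_gen[of "witt_prelog p m Y" "Dd (witt_V S \<xi>)"] v
            by (auto simp: alternating_rels_def)
          ultimately have "(gen (Dd (?\<gamma> (n - 1) \<xi>)) - gen (Sc (?\<gamma> (n - 1 - 1) \<xi>)) * ?v) * ?v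
              + gen (Sc (?\<gamma> (n - 1 - 1) \<xi>)) * (?v * ?v) \<in> N m"
            by (intro I(3)[OF I(7) I(6)] gen_in) (use v \<gamma> in auto)
          then show ?thesis by (simp add: algebra_simps)
        qed
        then have "- (gen (Dd (?\<gamma> (n - 1) \<xi>)) * ?v) \<in> N m" by (rule I(4))
        then show ?thesis by (simp add: 1(3) d_free_diff d_free_mult d_free_gen)
      qed
      moreover have "parity g \<in> N m" using hom pd_rels_homog[OF 2] gN by blast
      ultimately show ?thesis by simp
    next
      case A: 3
      have sub: "I_gens p (Suc k) Y (N (Suc k)) \<subseteq> N m" using rels_N[of m] by (auto simp: rels_def 3)
      from A show ?thesis
      proof (cases rule: I_gens_cases)
        case (1 i x)
        have v: "V_free p (Suc k) Y x \<in> N m" "d_free (V_free p (Suc k) Y x) \<in> N m"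
          using 1 sub by auto
        have "parity (V_free p (Suc k) Y x) = V_free p (Suc k) Y x \<or>
            parity (V_free p (Suc k) Y x) = - V_free p (Suc k) Y x"
          using parity_homog[OF 1(1)] by (simp add: parity_V_free V_free_uminus)
        then show ?thesis using 1(3) v
          by (auto simp: parity_d_free d_free_uminus d_free_d_free I)
      qed
    next
      case B: 4
      have sub: "J_gens p (Suc k) Y \<subseteq> N m" using rels_N[of m] by (auto simp: rels_def 3)
      from B show ?thesis
      proof (cases rule: J_gens_cases)
        case (1 \<omega> \<eta>)
        have "VF_defect p (Suc k) Y (parity \<omega>) (parity \<eta>) \<in> N m"
          "d_free (VF_defect p (Suc k) Y (parity \<omega>) (parity \<eta>)) \<in> N m"
          "d_free (VF_defect p (Suc k) Y \<omega> \<eta>) \<in> N m"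
          using J_gensI[of "parity \<omega>" "Suc k" "parity \<eta>"] J_gensI[OF 1(1,2)] 1 sub parity_in by blast+
        then show ?thesis using 1(3)
          by (auto simp: parity_d_free parity_VF_defect d_free_d_free I)
      qed
    qed
  qed
qed

lemma d_N:
  assumes "x \<in> N m"
  shows "d_free x \<in> N m"
  using assms Idl_d_stable(2)[OF rels_in, of m x] rels_stable[of _ m] unfolding N_Idl by blast

end

section \<open>Divided powers in a procomplex\<close>

context ring
begin

lemma nat_mult_assoc: "x \<in> carrier R \<Longrightarrow> [(a::nat)] \<cdot> ([b] \<cdot> x) = [(a * b)] \<cdot> x"
  using add.nat_pow_pow[of x a b] by (simp add: mult.commute)

lemma inverts_cancel_eq:
  assumes "inverts p R" "\<not> p dvd b" "x \<in> carrier R" "y \<in> carrier R" "[(b::nat)] \<cdot> x = [b] \<cdot> y"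
  shows "x = y"
proof -
  obtain u where u: "u \<in> carrier R" "[b] \<cdot> u = \<one>" using assms by (auto simp: inverts_def)
  have "z = u \<otimes> ([b] \<cdot> z)" if "z \<in> carrier R" for z
  proof -
    have "z = ([b] \<cdot> u) \<otimes> z" by (simp only: u l_one that)
    then show ?thesis using u(1) that by (simp add: add_pow_ldistr add_pow_rdistr)
  qed
  then show ?thesis using assms(3-5) by metis
qed

end

locale drw_target = drw p X Y \<phi> \<psi> + log_FV_procomplex p X Y \<phi> \<psi> C
  for p :: nat and X :: "('r, 'p) prelog" and Y :: "('s, 'q) prelog"
    and \<phi> :: "'r \<Rightarrow> 's" and \<psi> :: "'p \<Rightarrow> 'q" and C :: "('e, 's, 'q) procomplex"
begin

sublocale L: log_dga "witt_prelog p m X" "witt_prelog p m Y" "map \<phi>" \<psi> "lev C m" for m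
  by (rule lev_dga)

abbreviation "D m \<equiv> dif (lev C m)"
abbreviation "e m \<equiv> str (lev C m)"

lemma e_closed: "\<xi> \<in> carrier (witt p m S) \<Longrightarrow> e m \<xi> \<in> carrier (lev C m)"
  using L.str_closed[of \<xi> m] by simp

lemma e_gr: "\<xi> \<in> carrier (witt p m S) \<Longrightarrow> e m \<xi> \<in> gr (lev C m) 0"
  using L.str_gr[of \<xi> m] by simp

lemma e_hom: "ring_hom_ring (witt p m S) (lev C m) (e m)"
  using L.str_hom[of m] by (intro ring_hom_ringI2 W.ring_axioms L.ring_axioms) simp

lemma e_pow: "\<xi> \<in> carrier (witt p m S) \<Longrightarrow> e m (\<xi> [^]\<^bsub>witt p m S\<^esub> (n::nat)) = e m \<xi> [^]\<^bsub>lev C m\<^esub> n"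
  using ring_hom_ring.hom_nat_pow[OF e_hom] .

lemma e_mult: "\<xi> \<in> carrier (witt p m S) \<Longrightarrow> \<eta> \<in> carrier (witt p m S) \<Longrightarrow>
    e m (\<xi> \<otimes>\<^bsub>witt p m S\<^esub> \<eta>) = e m \<xi> \<otimes>\<^bsub>lev C m\<^esub> e m \<eta>"
  using L.str_simps(2)[of \<xi> m \<eta>] by simp

lemma e_one: "e m \<one>\<^bsub>witt p m S\<^esub> = \<one>\<^bsub>lev C m\<^esub>"
  using L.str_simps(3)[of m] by simp

lemma e_nat:
  assumes "\<xi> \<in> carrier (witt p m S)"
  shows "e m ([(n::nat)] \<cdot>\<^bsub>witt p m S\<^esub> \<xi>) = [n] \<cdot>\<^bsub>lev C m\<^esub> e m \<xi>"
proof -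
  interpret h: ring_hom_ring "witt p m S" "lev C m" "e m" by (rule e_hom)
  show ?thesis using assms by (induction n) simp_all
qed

lemma D_closed: "\<omega> \<in> carrier (lev C m) \<Longrightarrow> D m \<omega> \<in> carrier (lev C m)"
  by (rule L.dif_closed)

lemma V_closed: "\<omega> \<in> carrier (lev C m) \<Longrightarrow> Ver C m \<omega> \<in> carrier (lev C (Suc m))"
  using V_graded[of m] by (auto simp: graded_hom_def hom_def)

lemma V_add: "\<omega> \<in> carrier (lev C m) \<Longrightarrow> \<eta> \<in> carrier (lev C m) \<Longrightarrow>
    Ver C m (\<omega> \<oplus>\<^bsub>lev C m\<^esub> \<eta>) = Ver C m \<omega> \<oplus>\<^bsub>lev C (Suc m)\<^esub> Ver C m \<eta>"
  using V_graded[of m] by (auto simp: graded_hom_def hom_def)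

lemma V_zero: "Ver C m \<zero>\<^bsub>lev C m\<^esub> = \<zero>\<^bsub>lev C (Suc m)\<^esub>"
  using V_add[of "\<zero>\<^bsub>lev C m\<^esub>" m "\<zero>\<^bsub>lev C m\<^esub>"] V_closed[OF L.zero_closed[of m]] by simp

lemma V_diff:
  assumes "\<omega> \<in> carrier (lev C m)" "\<eta> \<in> carrier (lev C m)"
  shows "Ver C m (\<omega> \<ominus>\<^bsub>lev C m\<^esub> \<eta>) = Ver C m \<omega> \<ominus>\<^bsub>lev C (Suc m)\<^esub> Ver C m \<eta>"
proof -
  have "Ver C m \<omega> = Ver C m (\<omega> \<ominus>\<^bsub>lev C m\<^esub> \<eta>) \<oplus>\<^bsub>lev C (Suc m)\<^esub> Ver C m \<eta>"
    using assms by (simp add: V_add[symmetric] a_minus_def L.a_assoc L.l_neg)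
  then show ?thesis
    using assms V_closed by (simp add: a_minus_def L.a_assoc L.r_neg)
qed

lemma V_nat: "\<omega> \<in> carrier (lev C m) \<Longrightarrow> Ver C m ([(n::nat)] \<cdot>\<^bsub>lev C m\<^esub> \<omega>) = [n] \<cdot>\<^bsub>lev C (Suc m)\<^esub> Ver C m \<omega>"
  by (induction n) (simp_all add: V_zero V_add)

lemma V_gr: "\<omega> \<in> gr (lev C m) i \<Longrightarrow> Ver C m \<omega> \<in> gr (lev C (Suc m)) i"
  using V_graded[of m] by (auto simp: graded_hom_def)

lemma V_one_gr: "Ver C m \<one>\<^bsub>lev C m\<^esub> \<in> gr (lev C (Suc m)) 0"
  by (rule V_gr[OF L.gr_one])

text \<open>\<open>V(1)\<close> comes from the base \<open>W(R)\<close>.\<close>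

lemma D_V_one: "D (Suc m) (Ver C m \<one>\<^bsub>lev C m\<^esub>) = \<zero>\<^bsub>lev C (Suc m)\<^esub>"
proof -
  let ?r = "witt_V (lring X) \<one>\<^bsub>witt p m (lring X)\<^esub>"
  have r: "?r \<in> carrier (witt p (Suc m) (lring X))"
    using R.cring_witt[of m] by (intro R.witt_V_closed) (simp add: cring.cring_simprules)
  have "map \<phi> ?r = witt_V S \<one>\<^bsub>witt p m S\<^esub>"
    using map_teich[of "\<one>\<^bsub>lring X\<^esub>" m] ring_hom_one[OF phi_hom]
      ring_hom_zero[OF phi_hom R.ring_axioms S.ring_axioms]
    by (simp add: witt_V_def witt_simps(3))
  then have eq: "Ver C m \<one>\<^bsub>lev C m\<^esub> = e (Suc m) (map \<phi> ?r)"
    using V_str[of "\<one>\<^bsub>witt p m S\<^esub>" m] by (simp add: e_one)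
  have "e (Suc m) (map \<phi> ?r) \<in> carrier (lev C (Suc m))"
    unfolding eq[symmetric] by (rule L.gr_carrier[OF V_one_gr])
  then show ?thesis
    unfolding eq by (intro L.dif_base) (simp_all add: r)
qed

text \<open>In other words dVF = VFd, because V(1) \<omega> = V(F \<omega>) and V(1) is a constant
  for d.\<close>

lemma D_V_one_mult:
  assumes "\<omega> \<in> carrier (lev C (Suc m))"
  shows "D (Suc m) (Ver C m \<one>\<^bsub>lev C m\<^esub> \<otimes>\<^bsub>lev C (Suc m)\<^esub> \<omega>) = Ver C m (Frob C m (D (Suc m) \<omega>))"
proof -
  have F: "Frob C m (D (Suc m) \<omega>) \<in> carrier (lev C m)"
    by (intro ring_hom_closed[OF F_ring_hom] D_closed assms)
  have "D (Suc m) (Ver C m \<one>\<^bsub>lev C m\<^esub> \<otimes>\<^bsub>lev C (Suc m)\<^esub> \<omega>)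
      = Ver C m \<one>\<^bsub>lev C m\<^esub> \<otimes>\<^bsub>lev C (Suc m)\<^esub> D (Suc m) \<omega>"
    using L.dif_leibniz0[OF V_one_gr assms] assms L.gr_carrier[OF V_one_gr, of m] by (simp add: D_V_one D_closed)
  also have "\<dots> = Ver C m (\<one>\<^bsub>lev C m\<^esub> \<otimes>\<^bsub>lev C m\<^esub> Frob C m (D (Suc m) \<omega>))"
    using assms by (simp only: V_F[OF L.one_closed D_closed])
  finally show ?thesis using F by simp
qed

text \<open>p V\<omega> = V(FV\<omega>) = V(1) V\<omega>, so differentiating gives V(F dV\<omega>) =
  V(d\<omega>).\<close>

lemma V_D:
  assumes "\<omega> \<in> carrier (lev C m)"
  shows "[p] \<cdot>\<^bsub>lev C (Suc m)\<^esub> D (Suc m) (Ver C m \<omega>) = Ver C m (D m \<omega>)"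
proof -
  have "[p] \<cdot>\<^bsub>lev C (Suc m)\<^esub> Ver C m \<omega> = Ver C m (\<one>\<^bsub>lev C m\<^esub> \<otimes>\<^bsub>lev C m\<^esub> Frob C m (Ver C m \<omega>))"
    using assms by (simp add: F_V V_nat)
  also have "\<dots> = Ver C m \<one>\<^bsub>lev C m\<^esub> \<otimes>\<^bsub>lev C (Suc m)\<^esub> Ver C m \<omega>"
    using assms by (intro V_F) (auto intro: V_closed)
  finally have "D (Suc m) ([p] \<cdot>\<^bsub>lev C (Suc m)\<^esub> Ver C m \<omega>) = Ver C m (Frob C m (D (Suc m) (Ver C m \<omega>)))"
    using D_V_one_mult[OF V_closed[OF assms]] by simp
  then show ?thesis using assms by (simp add: L.dif_nat V_closed F_d_V)
qed

text \<open>[x^p] = F[x] makes V[x^p] equal to V(1) [x], whose differential is V(F d[x]). This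
  formula carries no factor \<open>p\<close> and starts the treatment of V(\<xi>^2) for p =
  2.\<close>

lemma D_V_teich:
  assumes "x \<in> carrier S"
  shows "D (Suc m) (Ver C m (e m (teich m S (x [^]\<^bsub>S\<^esub> p)))) =
    Ver C m (e m (teich m S (x [^]\<^bsub>S\<^esub> (p - 1))) \<otimes>\<^bsub>lev C m\<^esub> D m (e m (teich m S x)))"
proof -
  let ?t = "teich (Suc m) S x"
  have t: "?t \<in> carrier (witt p (Suc m) S)" using assms by (rule S.teich_closed)
  have F: "Frob C m (e (Suc m) ?t) = e m (teich m S (x [^]\<^bsub>S\<^esub> p))"
    using F_str[OF t] assms by (simp add: S.witt_F_teich)
  have "Ver C m (e m (teich m S (x [^]\<^bsub>S\<^esub> p))) = Ver C m (\<one>\<^bsub>lev C m\<^esub> \<otimes>\<^bsub>lev C m\<^esub> Frob C m (e (Suc m) ?t))"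
    using assms by (simp add: F e_closed S.teich_closed)
  also have "\<dots> = Ver C m \<one>\<^bsub>lev C m\<^esub> \<otimes>\<^bsub>lev C (Suc m)\<^esub> e (Suc m) ?t"
    by (intro V_F) (auto intro: e_closed t)
  finally show ?thesis
    using D_V_one_mult[OF e_closed[OF t]] F_d_teich[OF assms, of m] by simp
qed

text \<open>For \<open>p = 2\<close>, \<open>V(\<xi>\<^sup>2)\<close> is the divided square of \<open>V \<xi>\<close>, and \<open>dV(\<xi>\<^sup>2) = V(\<xi> d\<xi>)\<close> does not
  follow from \<open>p dV = V d\<close>; it is proved by induction along \<open>\<xi> = [x] + V \<eta>\<close>.\<close>

lemma D_V_square:
  assumes "p = 2"
  shows "\<xi> \<in> carrier (witt p m S) \<Longrightarrow>
    D (Suc m) (Ver C m (e m \<xi> \<otimes>\<^bsub>lev C m\<^esub> e m \<xi>)) = Ver C m (e m \<xi> \<otimes>\<^bsub>lev C m\<^esub> D m (e m \<xi>))"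
proof (induction m arbitrary: \<xi>)
  case 0
  have z: "\<omega> = \<zero>\<^bsub>lev C 0\<^esub>" if "\<omega> \<in> carrier (lev C 0)" for \<omega> using that lev_0 by auto
  have "e 0 \<xi> \<otimes>\<^bsub>lev C 0\<^esub> e 0 \<xi> = \<zero>\<^bsub>lev C 0\<^esub>" "e 0 \<xi> \<otimes>\<^bsub>lev C 0\<^esub> D 0 (e 0 \<xi>) = \<zero>\<^bsub>lev C 0\<^esub>"
    using e_closed[OF 0] D_closed by (intro z; simp)+
  then show ?case by (simp add: V_zero L.dif_zero)
next
  case (Suc k)
  let ?m = "Suc k"
  let ?E = "lev C ?m" and ?E' = "lev C (Suc ?m)"
  let ?x = "teich ?m S (hd \<xi>)"
  note ht = hd_tl_closed[OF Suc.prems]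
  define x where "x = e ?m ?x"
  define y where "y = e k (tl \<xi>)"
  define Vy where "Vy = Ver C k y"
  have xc: "?x \<in> carrier (witt p ?m S)" using ht by (intro S.teich_closed)
  have x: "x \<in> gr ?E 0" "x \<in> carrier ?E" using e_gr[OF xc] e_closed[OF xc] by (auto simp: x_def)
  have y: "y \<in> carrier (lev C k)" using e_closed ht by (simp add: y_def)
  have Vy_e: "Vy = e ?m (witt_V S (tl \<xi>))" using V_str ht by (simp add: Vy_def y_def)
  have v: "Vy \<in> gr ?E 0" "Vy \<in> carrier ?E"
    using S.witt_V_closed[OF ht(2)] by (auto simp: Vy_e e_gr e_closed)
  have xi: "e ?m \<xi> = x \<oplus>\<^bsub>?E\<^esub> Vy"
    using S.witt_decomp[OF Suc.prems] L.str_simps(1)[of ?x ?m "witt_V S (tl \<xi>)"] xc S.witt_V_closed[OF ht(2)]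
    by (simp add: x_def Vy_e)
  have cm: "x \<otimes>\<^bsub>?E\<^esub> Vy = Vy \<otimes>\<^bsub>?E\<^esub> x" "D ?m x \<otimes>\<^bsub>?E\<^esub> Vy = Vy \<otimes>\<^bsub>?E\<^esub> D ?m x"
    using L.str_central[of ?x ?m Vy 0] L.str_central[of "witt_V S (tl \<xi>)" ?m "D ?m x" 1] xc v
      S.witt_V_closed[OF ht(2)] L.dif_gr[OF x(1)]
    by (auto simp: x_def Vy_e)
  note c = x(2) v(2) y D_closed V_closed L.m_closed L.a_closed
  have 1: "D (Suc ?m) (Ver C ?m (x \<otimes>\<^bsub>?E\<^esub> x)) = Ver C ?m (x \<otimes>\<^bsub>?E\<^esub> D ?m x)"
  proof -
    have "hd \<xi> [^]\<^bsub>S\<^esub> p = hd \<xi> \<otimes>\<^bsub>S\<^esub> hd \<xi>" "hd \<xi> [^]\<^bsub>S\<^esub> (p - 1) = hd \<xi>"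
      using assms ht by (simp_all add: numeral_2_eq_2)
    then show ?thesis
      using D_V_teich[OF ht(1), of ?m] ht xc by (simp add: x_def S.teich_mult e_mult)
  qed
  \<comment> \<open>The cross term occurs twice, and since p = 2 this doubling is the factor needed
    to pass from dV to V d.\<close>
  have 2: "D (Suc ?m) (Ver C ?m (x \<otimes>\<^bsub>?E\<^esub> Vy \<oplus>\<^bsub>?E\<^esub> x \<otimes>\<^bsub>?E\<^esub> Vy))
      = Ver C ?m (Vy \<otimes>\<^bsub>?E\<^esub> D ?m x \<oplus>\<^bsub>?E\<^esub> x \<otimes>\<^bsub>?E\<^esub> D ?m Vy)"
  proof -
    have "[p] \<cdot>\<^bsub>?E'\<^esub> D (Suc ?m) (Ver C ?m (x \<otimes>\<^bsub>?E\<^esub> Vy)) = Ver C ?m (D ?m (x \<otimes>\<^bsub>?E\<^esub> Vy))"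
      by (intro V_D c)
    also have "D ?m (x \<otimes>\<^bsub>?E\<^esub> Vy) = Vy \<otimes>\<^bsub>?E\<^esub> D ?m x \<oplus>\<^bsub>?E\<^esub> x \<otimes>\<^bsub>?E\<^esub> D ?m Vy"
      using L.dif_leibniz0[OF x(1) v(2)] by (simp add: cm(2))
    finally show ?thesis
      using assms by (simp add: numeral_2_eq_2 V_add L.dif_add c)
  qed
  \<comment> \<open>(Vy)^2 = V(y FVy) = p V(y^2). The factor \<open>p\<close> trades the outer dV
    for V d, the induction hypothesis handles dV(y^2), and V(y dy) = Vy dVy.\<close>
  have 3: "D (Suc ?m) (Ver C ?m (Vy \<otimes>\<^bsub>?E\<^esub> Vy)) = Ver C ?m (Vy \<otimes>\<^bsub>?E\<^esub> D ?m Vy)"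
  proof -
    have "Vy \<otimes>\<^bsub>?E\<^esub> Vy = Ver C k (y \<otimes>\<^bsub>lev C k\<^esub> Frob C k Vy)"
      using V_F[OF y v(2)] by (simp add: Vy_def)
    also have "\<dots> = [p] \<cdot>\<^bsub>?E\<^esub> Ver C k (y \<otimes>\<^bsub>lev C k\<^esub> y)"
      using y by (simp add: Vy_def F_V L.add_pow_rdistr V_nat)
    finally have "D (Suc ?m) (Ver C ?m (Vy \<otimes>\<^bsub>?E\<^esub> Vy)) = Ver C ?m (D ?m (Ver C k (y \<otimes>\<^bsub>lev C k\<^esub> y)))"
      using y by (simp add: V_nat L.dif_nat V_closed V_D)
    also have "\<dots> = Ver C ?m (Ver C k (y \<otimes>\<^bsub>lev C k\<^esub> D k y))"
      using Suc.IH[OF ht(2)] by (simp add: y_def)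
    also have "Ver C k (y \<otimes>\<^bsub>lev C k\<^esub> D k y) = Vy \<otimes>\<^bsub>?E\<^esub> D ?m Vy"
      using V_F[OF y D_closed[OF v(2)]] y by (simp add: Vy_def F_d_V)
    finally show ?thesis .
  qed
  let ?a = "x \<otimes>\<^bsub>?E\<^esub> x" and ?b = "x \<otimes>\<^bsub>?E\<^esub> Vy" and ?c = "Vy \<otimes>\<^bsub>?E\<^esub> Vy"
  have "(x \<oplus>\<^bsub>?E\<^esub> Vy) \<otimes>\<^bsub>?E\<^esub> (x \<oplus>\<^bsub>?E\<^esub> Vy) = ?a \<oplus>\<^bsub>?E\<^esub> (?b \<oplus>\<^bsub>?E\<^esub> ?b) \<oplus>\<^bsub>?E\<^esub> ?c"
    using c cm(1) by (simp add: L.l_distr L.r_distr L.a_assoc)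
  then have "D (Suc ?m) (Ver C ?m ((x \<oplus>\<^bsub>?E\<^esub> Vy) \<otimes>\<^bsub>?E\<^esub> (x \<oplus>\<^bsub>?E\<^esub> Vy))) =
      D (Suc ?m) (Ver C ?m ?a) \<oplus>\<^bsub>?E'\<^esub> D (Suc ?m) (Ver C ?m (?b \<oplus>\<^bsub>?E\<^esub> ?b)) \<oplus>\<^bsub>?E'\<^esub> D (Suc ?m) (Ver C ?m ?c)"
    by (simp only: V_add L.dif_add c)
  also have "\<dots> = Ver C ?m (x \<otimes>\<^bsub>?E\<^esub> D ?m x \<oplus>\<^bsub>?E\<^esub> (Vy \<otimes>\<^bsub>?E\<^esub> D ?m x \<oplus>\<^bsub>?E\<^esub> x \<otimes>\<^bsub>?E\<^esub> D ?m Vy) \<oplus>\<^bsub>?E\<^esub> Vy \<otimes>\<^bsub>?E\<^esub> D ?m Vy)"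
    by (simp only: 1 2 3) (simp only: V_add c)
  also have "x \<otimes>\<^bsub>?E\<^esub> D ?m x \<oplus>\<^bsub>?E\<^esub> (Vy \<otimes>\<^bsub>?E\<^esub> D ?m x \<oplus>\<^bsub>?E\<^esub> x \<otimes>\<^bsub>?E\<^esub> D ?m Vy) \<oplus>\<^bsub>?E\<^esub> Vy \<otimes>\<^bsub>?E\<^esub> D ?m Vy
      = (x \<oplus>\<^bsub>?E\<^esub> Vy) \<otimes>\<^bsub>?E\<^esub> D ?m (x \<oplus>\<^bsub>?E\<^esub> Vy)"
    using c by (simp add: L.dif_add L.l_distr L.r_distr L.a_assoc)
  finally show ?case by (simp add: xi)
qed

lemma D_pow:
  assumes "\<xi> \<in> carrier (witt p m S)"
  shows "D m (e m \<xi> [^]\<^bsub>lev C m\<^esub> Suc n) = [(Suc n)] \<cdot>\<^bsub>lev C m\<^esub> (e m \<xi> [^]\<^bsub>lev C m\<^esub> n \<otimes>\<^bsub>lev C m\<^esub> D m (e m \<xi>))"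
proof (induction n)
  case 0
  then show ?case using e_closed[OF assms] D_closed by simp
next
  case (Suc n)
  let ?E = "lev C m" and ?x = "e m \<xi>"
  have c: "?x \<in> carrier ?E" "D m ?x \<in> carrier ?E" using e_closed[OF assms] D_closed by auto
  have g: "?x [^]\<^bsub>?E\<^esub> j \<in> gr ?E 0" for j :: nat
    using e_gr[OF W.nat_pow_closed[OF assms], of j] by (simp add: e_pow assms)
  have cm: "D m ?x \<otimes>\<^bsub>?E\<^esub> ?x = ?x \<otimes>\<^bsub>?E\<^esub> D m ?x"
    using L.str_central[of \<xi> m "D m ?x" 1] assms L.dif_gr[OF e_gr[OF assms]] by simp
  have "D m (?x [^]\<^bsub>?E\<^esub> Suc (Suc n)) = D m (?x [^]\<^bsub>?E\<^esub> Suc n) \<otimes>\<^bsub>?E\<^esub> ?x \<oplus>\<^bsub>?E\<^esub> ?x [^]\<^bsub>?E\<^esub> Suc n \<otimes>\<^bsub>?E\<^esub> D m ?x"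
    using L.dif_leibniz0[OF g[of "Suc n"] c(1)] by simp
  also have "D m (?x [^]\<^bsub>?E\<^esub> Suc n) \<otimes>\<^bsub>?E\<^esub> ?x = [(Suc n)] \<cdot>\<^bsub>?E\<^esub> (?x [^]\<^bsub>?E\<^esub> Suc n \<otimes>\<^bsub>?E\<^esub> D m ?x)"
    using c by (simp only: Suc.IH L.add_pow_ldistr L.m_closed L.nat_pow_closed L.m_assoc cm)
      (simp add: L.m_assoc del: L.add.nat_pow_Suc)
  finally show ?case using c by simp
qed

text \<open>Writing x for the image of \<xi>, this is p^(n-1)/n! dV(x^n) = p^(n-2)/(n-1)! V(x^(n-1)
  dx) after multiplication by u u', with n! = p^k u and (n-1)! = p^k' u'.\<close>

lemma D_V_pow:
  assumes \<xi>: "\<xi> \<in> carrier (witt p m S)" and n: "n \<ge> 2"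
    and f: "(fact n :: nat) = p ^ k * u" "k \<le> n - 1" "p \<noteq> 2 \<or> odd n \<Longrightarrow> k \<le> n - 2"
    and f': "(fact (n - 1) :: nat) = p ^ k' * u'" "k' \<le> n - 2"
  shows "[(p ^ (n - 1 - k) * u')] \<cdot>\<^bsub>lev C (Suc m)\<^esub> D (Suc m) (Ver C m (e m \<xi> [^]\<^bsub>lev C m\<^esub> n)) =
    [(p ^ (n - 2 - k') * u)] \<cdot>\<^bsub>lev C (Suc m)\<^esub> Ver C m (e m \<xi> [^]\<^bsub>lev C m\<^esub> (n - 1) \<otimes>\<^bsub>lev C m\<^esub> D m (e m \<xi>))"
proof -
  let ?E = "lev C m" and ?E' = "lev C (Suc m)" and ?x = "e m \<xi>"
  define \<omega> where "\<omega> = ?x [^]\<^bsub>?E\<^esub> (n - 1) \<otimes>\<^bsub>?E\<^esub> D m ?x"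
  have c: "?x \<in> carrier ?E" "D m ?x \<in> carrier ?E" using e_closed[OF \<xi>] D_closed by auto
  have \<omega>: "\<omega> \<in> carrier ?E" "Ver C m \<omega> \<in> carrier ?E'" using c V_closed by (auto simp: \<omega>_def)
  have xn: "?x [^]\<^bsub>?E\<^esub> n \<in> carrier ?E" using c by simp
  have Dx: "D m (?x [^]\<^bsub>?E\<^esub> n) = [n] \<cdot>\<^bsub>?E\<^esub> \<omega>" using D_pow[OF \<xi>, of "n - 1"] n by (simp add: \<omega>_def)
  have DV: "D (Suc m) (Ver C m (?x [^]\<^bsub>?E\<^esub> n)) \<in> carrier ?E'" by (intro D_closed V_closed xn)
  have nf: "(fact n :: nat) = n * fact (n - 1)" using n by (simp add: fact_reduce)
  have p0: "p > 0" by (rule S.p_pos)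
  \<comment> \<open>Both sides, times p^(k+k'), are p^(n-1) n!.\<close>
  have key: "p ^ (n - 1 - k) * u' * n = p * (p ^ (n - 2 - k') * u)"
  proof -
    have "p ^ (k + k') * (p ^ (n - 1 - k) * u' * n) = p ^ (k + (n - 1 - k)) * (n * (p ^ k' * u'))"
      by (simp add: power_add mult_ac)
    also have "\<dots> = p ^ (n - 1) * (p ^ k * u)"
      using f(2) by (simp only: le_add_diff_inverse f'(1)[symmetric] nf[symmetric] f(1)[symmetric])
    also have "\<dots> = p ^ Suc (k' + (n - 2 - k')) * (p ^ k * u)"
    proof -
      have "Suc (k' + (n - 2 - k')) = n - 1" using f'(2) n by simp
      then show ?thesis by (simp only:)
    qed
    finally have "p ^ (k + k') * (p ^ (n - 1 - k) * u' * n) = p ^ (k + k') * (p * (p ^ (n - 2 - k') * u))"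
      by (simp add: power_add mult_ac)
    then show ?thesis using p0 by simp
  qed
  show ?thesis
  proof (cases "k \<le> n - 2")
    case True
    \<comment> \<open>A factor \<open>p\<close> is available here: it turns dV(x^n) into V(d(x^n)) =
      n V(x^(n-1) dx), and the coefficients agree by \<open>key\<close> with \<open>p\<close>
      cancelled.\<close>
    then have "n - 1 - k = Suc (n - 2 - k)" using n by linarith
    then have s: "p ^ (n - 1 - k) = p ^ (n - 2 - k) * p" by (simp only: power_Suc2)
    have "[(p ^ (n - 1 - k) * u')] \<cdot>\<^bsub>?E'\<^esub> D (Suc m) (Ver C m (?x [^]\<^bsub>?E\<^esub> n))
        = [(p ^ (n - 2 - k) * u')] \<cdot>\<^bsub>?E'\<^esub> ([p] \<cdot>\<^bsub>?E'\<^esub> D (Suc m) (Ver C m (?x [^]\<^bsub>?E\<^esub> n)))"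
      using DV by (simp only: L.nat_mult_assoc s) (simp only: mult_ac)
    also have "\<dots> = [(p ^ (n - 2 - k) * u' * n)] \<cdot>\<^bsub>?E'\<^esub> Ver C m \<omega>"
      using \<omega> by (simp add: V_D[OF xn] Dx V_nat L.nat_mult_assoc mult.assoc)
    also have "p ^ (n - 2 - k) * u' * n = p ^ (n - 2 - k') * u"
      using key[unfolded s] p0 by simp
    finally show ?thesis by (simp add: \<omega>_def)
  next
    case False
    \<comment> \<open>No factor \<open>p\<close> is left, but p = 2 and n = 2j. Applying the square
      formula to \<xi>^j yields j V(x^(n-1) dx), and \<open>key\<close> is divided by 2.\<close>
    with f(3) have p2: "p = 2" "even n" by auto
    then obtain j where j: "n = j + j" by (metis evenE mult_2)
    then have j1: "j \<ge> 1" using n by simp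
    let ?y = "\<xi> [^]\<^bsub>witt p m S\<^esub> j"
    have y: "?y \<in> carrier (witt p m S)" using \<xi> by simp
    have "?x [^]\<^bsub>?E\<^esub> n = e m ?y \<otimes>\<^bsub>?E\<^esub> e m ?y"
      using c \<xi> by (simp add: e_pow L.nat_pow_mult j)
    then have "D (Suc m) (Ver C m (?x [^]\<^bsub>?E\<^esub> n)) = Ver C m (e m ?y \<otimes>\<^bsub>?E\<^esub> D m (e m ?y))"
      using D_V_square[OF p2(1) y] by simp
    also have "e m ?y \<otimes>\<^bsub>?E\<^esub> D m (e m ?y) = [j] \<cdot>\<^bsub>?E\<^esub> (?x [^]\<^bsub>?E\<^esub> j \<otimes>\<^bsub>?E\<^esub> (?x [^]\<^bsub>?E\<^esub> (j - 1) \<otimes>\<^bsub>?E\<^esub> D m ?x))"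
      using D_pow[OF \<xi>, of "j - 1"] j1 c \<xi> by (simp add: e_pow L.add_pow_rdistr)
    also have "?x [^]\<^bsub>?E\<^esub> j \<otimes>\<^bsub>?E\<^esub> (?x [^]\<^bsub>?E\<^esub> (j - 1) \<otimes>\<^bsub>?E\<^esub> D m ?x) = \<omega>"
      using c j1 by (simp add: L.m_assoc[symmetric] L.nat_pow_mult \<omega>_def j)
    finally have "D (Suc m) (Ver C m (?x [^]\<^bsub>?E\<^esub> n)) = [j] \<cdot>\<^bsub>?E'\<^esub> Ver C m \<omega>" using \<omega> by (simp add: V_nat)
    moreover have "p ^ (n - 1 - k) * u' * j = p ^ (n - 2 - k') * u"
    proof -
      have "a * n = 2 * (a * j)" for a :: nat using j by simp
      then have "2 * (p ^ (n - 1 - k) * u' * j) = 2 * (p ^ (n - 2 - k') * u)"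
        using key p2(1) by metis
      then show ?thesis by simp
    qed
    ultimately show ?thesis using \<omega> by (simp add: L.nat_mult_assoc \<omega>_def)
  qed
qed

lemma inverts_lev: "inverts p (lev C m)"
  using inverts_hom[OF W.ring_axioms L.ring_axioms _ inverts_witt[of m]] L.str_hom[of m] by simp

text \<open>The prime-to-\<open>p\<close> parts u and u' of n! and (n-1)! clear the denominators of
  \<gamma>_n and \<gamma>_(n-1). Multiplied by u u', the claim becomes the previous identity, and u
  u' is invertible in every level.\<close>

lemma D_witt_pd:
  assumes \<xi>: "\<xi> \<in> carrier (witt p m S)" and n: "n \<ge> 1"
  shows "D (Suc m) (e (Suc m) (witt_pd p m S n \<xi>)) =
    e (Suc m) (witt_pd p m S (n - 1) \<xi>) \<otimes>\<^bsub>lev C (Suc m)\<^esub> D (Suc m) (e (Suc m) (witt_V S \<xi>))"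
proof -
  let ?E = "lev C m" and ?E' = "lev C (Suc m)" and ?W = "witt p (Suc m) S" and ?x = "e m \<xi>"
  have V\<xi>: "e (Suc m) (witt_V S \<xi>) = Ver C m ?x" using V_str[OF \<xi>] by simp
  have c: "?x \<in> carrier ?E" "Ver C m ?x \<in> carrier ?E'" "D (Suc m) (Ver C m ?x) \<in> carrier ?E'" "D m ?x \<in> carrier ?E"
    using e_closed[OF \<xi>] V_closed D_closed by auto
  note pdc = e_closed[OF witt_pd_closed[OF \<xi>]]
  have pd: "[u] \<cdot>\<^bsub>?E'\<^esub> e (Suc m) (witt_pd p m S j \<xi>) = [(p ^ (j - 1 - k))] \<cdot>\<^bsub>?E'\<^esub> Ver C m (?x [^]\<^bsub>?E\<^esub> j)"
    if "j \<ge> 1" and r: "rat_in ?W (of_nat p ^ (j - 1) / fact j) \<in> carrier ?W"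
      "[u] \<cdot>\<^bsub>?W\<^esub> rat_in ?W (of_nat p ^ (j - 1) / fact j) = [(p ^ (j - 1 - k))] \<cdot>\<^bsub>?W\<^esub> \<one>\<^bsub>?W\<^esub>" for j u k :: nat
  proof -
    let ?v = "witt_V S (\<xi> [^]\<^bsub>witt p m S\<^esub> j)"
    have v: "?v \<in> carrier ?W" using \<xi> by (intro S.witt_V_closed) simp
    have "[u] \<cdot>\<^bsub>?W\<^esub> witt_pd p m S j \<xi> = [(p ^ (j - 1 - k))] \<cdot>\<^bsub>?W\<^esub> ?v"
      using that v W.add_pow_ldistr[OF r(1) v, of u] W.add_pow_ldistr[OF W.one_closed v, of "p ^ (j - 1 - k)"]
      by (simp add: witt_pd_def)
    then have "[u] \<cdot>\<^bsub>?E'\<^esub> e (Suc m) (witt_pd p m S j \<xi>) = [(p ^ (j - 1 - k))] \<cdot>\<^bsub>?E'\<^esub> e (Suc m) ?v"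
      using v witt_pd_closed[OF \<xi>] by (simp only: e_nat[symmetric])
    then show ?thesis using V_str[of "\<xi> [^]\<^bsub>witt p m S\<^esub> j" m] \<xi> by (simp add: e_pow)
  qed
  show ?thesis
  proof (cases "n = 1")
    case True
    obtain k u where ku: "(fact (1::nat) :: nat) = p ^ k * u"
      "\<And>m. rat_in (witt p m S) (of_nat p ^ (1 - 1) / fact 1) \<in> carrier (witt p m S)"
      "\<And>m. [u] \<cdot>\<^bsub>witt p m S\<^esub> rat_in (witt p m S) (of_nat p ^ (1 - 1) / fact 1)
        = [(p ^ (1 - 1 - k))] \<cdot>\<^bsub>witt p m S\<^esub> \<one>\<^bsub>witt p m S\<^esub>"
      using pd_coefficient[of 1] by (metis order_refl)
    \<comment> \<open>1! = p^k u forces u = 1, and the exponent 1 - 1 - k is zero, so \<gamma>_1 is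
      the identity.\<close>
    have "u = 1" using ku(1) by simp
    then have "e (Suc m) (witt_pd p m S 1 \<xi>) = Ver C m ?x"
      using pd[of 1 u k] ku(2,3)[of "Suc m"] pdc c by simp
    then show ?thesis using True c by (simp add: witt_pd_def V\<xi> e_one)
  next
    case False
    then have n2: "n \<ge> 2" "n - 1 \<ge> 1" using n by auto
    obtain k u where ku: "(fact n :: nat) = p ^ k * u" "\<not> p dvd u" "k \<le> n - 1"
      "p \<noteq> 2 \<or> odd n \<Longrightarrow> k \<le> n - 2"
      "\<And>m. rat_in (witt p m S) (of_nat p ^ (n - 1) / fact n) \<in> carrier (witt p m S)"
      "\<And>m. [u] \<cdot>\<^bsub>witt p m S\<^esub> rat_in (witt p m S) (of_nat p ^ (n - 1) / fact n)
        = [(p ^ (n - 1 - k))] \<cdot>\<^bsub>witt p m S\<^esub> \<one>\<^bsub>witt p m S\<^esub>"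
      using pd_coefficient[OF n] n2(1) by metis
    obtain k' u' where ku': "(fact (n - 1) :: nat) = p ^ k' * u'" "\<not> p dvd u'" "k' \<le> n - 1 - 1"
      "\<And>m. rat_in (witt p m S) (of_nat p ^ (n - 1 - 1) / fact (n - 1)) \<in> carrier (witt p m S)"
      "\<And>m. [u'] \<cdot>\<^bsub>witt p m S\<^esub> rat_in (witt p m S) (of_nat p ^ (n - 1 - 1) / fact (n - 1))
        = [(p ^ (n - 1 - 1 - k'))] \<cdot>\<^bsub>witt p m S\<^esub> \<one>\<^bsub>witt p m S\<^esub>"
      using pd_coefficient[OF n2(2)] by metis
    note q = pd[OF n ku(5,6)] and q' = pd[OF n2(2) ku'(4,5)]
    let ?g = "e (Suc m) (witt_pd p m S n \<xi>)" and ?g' = "e (Suc m) (witt_pd p m S (n - 1) \<xi>)"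
    have xc: "?x [^]\<^bsub>?E\<^esub> j \<in> carrier ?E" for j :: nat using c by simp
    have "[(u' * u)] \<cdot>\<^bsub>?E'\<^esub> D (Suc m) ?g = [u'] \<cdot>\<^bsub>?E'\<^esub> D (Suc m) ([u] \<cdot>\<^bsub>?E'\<^esub> ?g)"
      using pdc D_closed by (simp add: L.dif_nat L.nat_mult_assoc)
    also have "\<dots> = [(p ^ (n - 1 - k) * u')] \<cdot>\<^bsub>?E'\<^esub> D (Suc m) (Ver C m (?x [^]\<^bsub>?E\<^esub> n))"
      using xc V_closed D_closed by (simp add: q L.dif_nat L.nat_mult_assoc mult.commute)
    also have "\<dots> = [(p ^ (n - 2 - k') * u)] \<cdot>\<^bsub>?E'\<^esub> Ver C m (?x [^]\<^bsub>?E\<^esub> (n - 1) \<otimes>\<^bsub>?E\<^esub> D m ?x)"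
      using ku' by (intro D_V_pow[OF \<xi> n2(1) ku(1,3,4)]) auto
    \<comment> \<open>V(x^(n-1) dx) = V(x^(n-1) F dVx) by F dV = d, to which the projection formula
      applies.\<close>
    also have "Ver C m (?x [^]\<^bsub>?E\<^esub> (n - 1) \<otimes>\<^bsub>?E\<^esub> D m ?x) = Ver C m (?x [^]\<^bsub>?E\<^esub> (n - 1)) \<otimes>\<^bsub>?E'\<^esub> D (Suc m) (Ver C m ?x)"
      using V_F[OF xc c(3)] c by (simp add: F_d_V)
    also have "[(p ^ (n - 2 - k') * u)] \<cdot>\<^bsub>?E'\<^esub> \<dots> = [u] \<cdot>\<^bsub>?E'\<^esub> ([(p ^ (n - 2 - k'))] \<cdot>\<^bsub>?E'\<^esub> Ver C m (?x [^]\<^bsub>?E\<^esub> (n - 1)) \<otimes>\<^bsub>?E'\<^esub> D (Suc m) (Ver C m ?x))"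
      using xc V_closed c by (simp add: L.add_pow_ldistr L.nat_mult_assoc mult.commute)
    also have "[(p ^ (n - 2 - k'))] \<cdot>\<^bsub>?E'\<^esub> Ver C m (?x [^]\<^bsub>?E\<^esub> (n - 1)) = [u'] \<cdot>\<^bsub>?E'\<^esub> ?g'"
      using q' by (simp add: numeral_2_eq_2)
    also have "[u] \<cdot>\<^bsub>?E'\<^esub> ([u'] \<cdot>\<^bsub>?E'\<^esub> ?g' \<otimes>\<^bsub>?E'\<^esub> D (Suc m) (Ver C m ?x)) = [(u' * u)] \<cdot>\<^bsub>?E'\<^esub> (?g' \<otimes>\<^bsub>?E'\<^esub> D (Suc m) (Ver C m ?x))"
      using pdc c by (simp add: L.add_pow_ldistr L.nat_mult_assoc mult.commute)
    finally have eq: "[(u' * u)] \<cdot>\<^bsub>?E'\<^esub> D (Suc m) ?g = [(u' * u)] \<cdot>\<^bsub>?E'\<^esub> (?g' \<otimes>\<^bsub>?E'\<^esub> D (Suc m) (Ver C m ?x))" .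
    have nd: "\<not> p dvd u' * u" using ku(2) ku'(2) by (simp add: prime_dvd_mult_iff[OF prime])
    have "D (Suc m) ?g = ?g' \<otimes>\<^bsub>?E'\<^esub> D (Suc m) (Ver C m ?x)"
      by (rule L.inverts_cancel_eq[OF inverts_lev nd _ _ eq]) (use pdc c D_closed in auto)
    then show ?thesis by (simp add: V\<xi>)
  qed
qed

end

section \<open>The universal property\<close>

lemma quot_dga_simps:
  "carrier (quot_dga Y I) = carrier (free_ring Y Quot I)"
  "monoid.mult (quot_dga Y I) = monoid.mult (free_ring Y Quot I)"
  "one (quot_dga Y I) = one (free_ring Y Quot I)"
  "add (quot_dga Y I) = add (free_ring Y Quot I)"
  "gr (quot_dga Y I) i = {I +>\<^bsub>free_ring Y\<^esub> x | x. x \<in> homog Y i}"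
  "str (quot_dga Y I) s = I +>\<^bsub>free_ring Y\<^esub> gen (Sc s)"
  "dif (quot_dga Y I) = induced Y I d_free"
  "dlog (quot_dga Y I) q = I +>\<^bsub>free_ring Y\<^esub> gen (Dl q)"
  by (simp_all add: quot_dga_def Let_def)

context
  fixes Y :: "('s, 'q) prelog" and I :: "('s, 'q) free set"
  assumes I: "ideal I (free_ring Y)"
begin

abbreviation (input) cst :: "('s, 'q) free \<Rightarrow> ('s, 'q) free set" where
  "cst x \<equiv> I +>\<^bsub>free_ring Y\<^esub> x"

lemma coset_iff: "y \<in> cst x \<longleftrightarrow> (\<exists>h\<in>I. y = h + x)"
  by (auto simp: a_r_coset_def' )

lemma cst_carrier: "x \<in> carrier (free_ring Y) \<Longrightarrow> cst x \<in> carrier (quot_dga Y I)"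
  by (auto simp: quot_dga_simps FactRing_def A_RCOSETS_def')

lemma cst_cases:
  assumes "c \<in> carrier (quot_dga Y I)"
  obtains x where "x \<in> carrier (free_ring Y)" "c = cst x"
  using assms by (auto simp: quot_dga_simps FactRing_def A_RCOSETS_def')

lemma cst_hom: "cst \<in> ring_hom (free_ring Y) (free_ring Y Quot I)"
  by (rule ideal.rcos_ring_hom[OF I])

lemma cst_add: "x \<in> carrier (free_ring Y) \<Longrightarrow> y \<in> carrier (free_ring Y) \<Longrightarrow>
    cst (x + y) = cst x \<oplus>\<^bsub>quot_dga Y I\<^esub> cst y"
  using ring_hom_add[OF cst_hom] by (simp add: quot_dga_simps)

lemma cst_mult: "x \<in> carrier (free_ring Y) \<Longrightarrow> y \<in> carrier (free_ring Y) \<Longrightarrow>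
    cst (x * y) = cst x \<otimes>\<^bsub>quot_dga Y I\<^esub> cst y"
  using ring_hom_mult[OF cst_hom] by (simp add: quot_dga_simps)

lemma cst_one: "cst 1 = \<one>\<^bsub>quot_dga Y I\<^esub>"
  using ring_hom_one[OF cst_hom] by (simp add: quot_dga_simps)

lemma cst_some:
  assumes "x \<in> carrier (free_ring Y)"
  shows "\<exists>h\<in>I. (SOME y. y \<in> cst x) = h + x"
proof -
  have "x \<in> cst x" unfolding coset_iff using free_ideal(2)[OF I] by (intro bexI[of _ 0]) auto
  then have "(SOME y. y \<in> cst x) \<in> cst x" by (rule someI)
  then show ?thesis by (simp only: coset_iff)
qed

lemma cst_some_in:
  assumes "x \<in> carrier (free_ring Y)"
  shows "(SOME y. y \<in> cst x) \<in> carrier (free_ring Y)"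
  using cst_some[OF assms] assms free_ideal(1)[OF I] free_add_in by metis

lemma cst_absorb:
  assumes "x \<in> carrier (free_ring Y)" "h \<in> I"
  shows "cst (h + x) = cst x"
proof -
  have "y \<in> cst (h + x) \<longleftrightarrow> y \<in> cst x" for y
  proof
    assume "y \<in> cst (h + x)"
    then obtain k where "k \<in> I" "y = k + (h + x)" by (auto simp only: coset_iff)
    then show "y \<in> cst x"
      unfolding coset_iff using free_ideal(3)[OF I] assms(2) by (intro bexI[of _ "k + h"]) (auto simp: add.assoc)
  next
    assume "y \<in> cst x"
    then obtain k where "k \<in> I" "y = k + x" by (auto simp only: coset_iff)
    then show "y \<in> cst (h + x)"
      unfolding coset_iff using free_ideal(5)[OF I] assms(2) by (intro bexI[of _ "k - h"]) auto
  qed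
  then show ?thesis by blast
qed

end

lemma (in log_dga) Phi_power: "Phi (x ^ n) = Phi x [^] n"
proof (induction n)
  case (Suc n)
  then show ?case by (simp only: power_Suc Phi_mult nat_pow_Suc2[OF Phi_closed])
qed (simp add: Phi_one)

section \<open>Compatibility of the evaluation with restriction, F and V\<close>

context drw_target
begin

text \<open>Both sides are multiplicative in x, so comparing letters suffices. Restriction and F are
  of this kind; V is not multiplicative and is treated separately.\<close>

lemma Phi_free_hom:
  assumes f: "f \<in> ring_hom (lev C m) (lev C m')"
    and h: "\<And>l. letter_in (witt_prelog p m Y) l \<Longrightarrow> L.Phi m' (h l) = f (L.letter_val m l)"
    and x: "x \<in> carrier (A m)"
  shows "L.Phi m' (free_hom h x) = f (L.Phi m x)"
proof -
  interpret f: ring_hom_ring "lev C m" "lev C m'" f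
    by (intro ring_hom_ringI2 L.ring_axioms f)
  from x show ?thesis
  proof (induction x rule: free_induct)
    case (word w)
    then show ?case unfolding free_hom_wrd
    proof (induction w)
      case Nil
      then show ?case by (simp only: list.map prod_list.Nil L.Phi_one L.Phi_Nil f.hom_one)
    next
      case (Cons l w)
      then show ?case
        by (simp add: L.Phi_mult L.Phi_Cons h L.letter_val_closed L.Phi_closed)
    qed
  next
    case (diff a b)
    then show ?case by (simp add: free_hom_diff L.Phi_diff a_minus_def L.Phi_closed)
  qed (simp add: free_hom_zero L.Phi_zero)
qed

lemma Phi_res:
  assumes "x \<in> carrier (A (Suc m))"
  shows "L.Phi m (res_free x) = res C m (L.Phi (Suc m) x)"
  unfolding res_free_def
proof (rule Phi_free_hom[OF _ _ assms])
  show "res C m \<in> ring_hom (lev C (Suc m)) (lev C m)"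
    using res_map[of m] by (simp add: log_dga_map_def)
  fix l assume l: "letter_in (witt_prelog p (Suc m) Y) l"
  show "L.Phi m (res_letter l) = res C m (L.letter_val (Suc m) l)"
    using l res_map[of m]
    by (cases l) (auto simp: L.Phi_gen hd_tl_closed log_dga_map_def e_closed)
qed

text \<open>Splitting \<xi> as [x_0] + V(x_1, x_2, ...) and applying the rules for F d[x] and F dV
  gives the formula by which \<open>F_letter\<close> is defined.\<close>

lemma F_D:
  assumes "\<xi> \<in> carrier (witt p (Suc m) S)"
  shows "Frob C m (D (Suc m) (e (Suc m) \<xi>)) =
    e m (teich m S (hd \<xi>)) [^]\<^bsub>lev C m\<^esub> (p - 1) \<otimes>\<^bsub>lev C m\<^esub> D m (e m (teich m S (hd \<xi>)))
      \<oplus>\<^bsub>lev C m\<^esub> D m (e m (tl \<xi>))"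
proof -
  note ht = hd_tl_closed[OF assms]
  let ?t = "teich (Suc m) S (hd \<xi>)"
  have t: "?t \<in> carrier (witt p (Suc m) S)" "teich m S (hd \<xi>) \<in> carrier (witt p m S)"
    using ht by (auto intro: S.teich_closed)
  have v: "witt_V S (tl \<xi>) \<in> carrier (witt p (Suc m) S)" using ht by (intro S.witt_V_closed)
  have "e (Suc m) \<xi> = e (Suc m) ?t \<oplus>\<^bsub>lev C (Suc m)\<^esub> Ver C m (e m (tl \<xi>))"
    using S.witt_decomp[OF assms] L.str_simps(1)[of ?t "Suc m" "witt_V S (tl \<xi>)"] t v V_str[OF ht(2)] by simp
  then have "Frob C m (D (Suc m) (e (Suc m) \<xi>)) = Frob C m (D (Suc m) (e (Suc m) ?t))
      \<oplus>\<^bsub>lev C m\<^esub> Frob C m (D (Suc m) (Ver C m (e m (tl \<xi>))))"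
    using t ht by (simp add: L.dif_add e_closed V_closed D_closed ring_hom_add[OF F_ring_hom])
  then show ?thesis
    using ht t by (simp add: F_d_teich F_d_V e_closed S.teich_pow e_pow)
qed

lemma Phi_F:
  assumes "x \<in> carrier (A (Suc m))"
  shows "L.Phi m (F_free p m Y x) = Frob C m (L.Phi (Suc m) x)"
  unfolding F_free_def
proof (rule Phi_free_hom[OF F_ring_hom _ assms])
  fix l assume l: "letter_in (witt_prelog p (Suc m) Y) l"
  show "L.Phi m (F_letter p m Y l) = Frob C m (L.letter_val (Suc m) l)"
  proof (cases l)
    case (Sc \<xi>)
    then show ?thesis using l by (simp add: L.Phi_gen S.witt_F_closed F_str)
  next
    case (Dd \<xi>)
    then have \<xi>: "\<xi> \<in> carrier (witt p (Suc m) S)" using l by simp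
    note ht = hd_tl_closed[OF \<xi>]
    show ?thesis using ht \<xi> S.teich_closed[OF ht(1), of m]
      by (simp add: Dd Let_def L.Phi_add L.Phi_mult L.Phi_power L.Phi_gen F_D)
  next
    case (Dl q)
    then show ?thesis using l by (simp add: L.Phi_gen F_dlog)
  qed
qed

definition nonscalar :: "('s list, 'q) letter \<Rightarrow> bool" where
  "nonscalar l \<longleftrightarrow> (case l of Sc _ \<Rightarrow> False | _ \<Rightarrow> True)"

lemma nonscalar_simps [simp]: "\<not> nonscalar (Sc \<xi>)" "nonscalar (Dd \<xi>)" "nonscalar (Dl q)"
  by (simp_all add: nonscalar_def)

text \<open>Scalars are central in E, so they may be collected in front of the remaining letters, as
  in the definition of \<open>V_free\<close>.\<close>

lemma Phi_scalar_part:
  assumes "word_in (witt_prelog p m Y) w"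
  shows "L.Phi m (wrd w) = e m (scalar_part (witt p m S) w) \<otimes>\<^bsub>lev C m\<^esub> L.Phi m (wrd (filter nonscalar w))"
  using assms
proof (induction w)
  case Nil
  then show ?case by (simp add: L.Phi_Nil e_one)
next
  case (Cons l w)
  let ?s = "scalar_part (witt p m S) w" and ?r = "L.Phi m (wrd (filter nonscalar w))"
  have s: "?s \<in> carrier (witt p m S)" using scalar_part_closed Cons.prems by simp
  have c: "e m ?s \<in> carrier (lev C m)" "?r \<in> carrier (lev C m)" "L.letter_val m l \<in> carrier (lev C m)"
    using s by (auto simp: e_closed L.Phi_closed L.letter_val_closed)
  have cm: "L.letter_val m l \<otimes>\<^bsub>lev C m\<^esub> (e m ?s \<otimes>\<^bsub>lev C m\<^esub> ?r) =
      e m ?s \<otimes>\<^bsub>lev C m\<^esub> (L.letter_val m l \<otimes>\<^bsub>lev C m\<^esub> ?r)"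
    using L.str_central[of ?s m "L.letter_val m l", OF _ L.letter_val_gr] s c
    by (simp add: L.m_assoc[symmetric])
  have IH: "L.Phi m (wrd (l # w)) = L.letter_val m l \<otimes>\<^bsub>lev C m\<^esub> (e m ?s \<otimes>\<^bsub>lev C m\<^esub> ?r)"
    using Cons by (simp add: L.Phi_Cons)
  show ?case
  proof (cases l)
    case (Sc \<xi>)
    then have "\<xi> \<in> carrier (witt p m S)" using Cons.prems by simp
    then show ?thesis using IH s c by (simp add: Sc e_mult L.m_assoc e_closed)
  qed (use IH cm in \<open>simp_all add: L.Phi_Cons\<close>)
qed

text \<open>F undoes the effect of V on the non-scalar letters, by F dV = d and F dlog =
  dlog.\<close>

lemma Phi_V_letters:
  assumes "word_in (witt_prelog p m Y) w"
  shows "Frob C m (L.Phi (Suc m) (wrd (concat (map (V_letter S) w)))) = L.Phi m (wrd (filter nonscalar w))"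
  using assms
proof (induction w)
  case Nil
  then show ?case by (simp add: L.Phi_Nil ring_hom_one[OF F_ring_hom])
next
  case (Cons l w)
  show ?case
  proof (cases l)
    case (Sc \<xi>)
    then show ?thesis using Cons by simp
  next
    case (Dd \<xi>)
    then have \<xi>: "\<xi> \<in> carrier (witt p m S)" using Cons.prems by simp
    have "Frob C m (D (Suc m) (e (Suc m) (witt_V S \<xi>))) = D m (e m \<xi>)"
      using F_d_V[OF e_closed[OF \<xi>]] V_str[OF \<xi>] by simp
    then show ?thesis using Cons Dd \<xi>
      by (simp add: L.Phi_Cons S.witt_V_closed ring_hom_mult[OF F_ring_hom] L.Phi_closed D_closed e_closed)
  next
    case (Dl q)
    then have q: "q \<in> carrier (lmon Y)" using Cons.prems by simp
    then show ?thesis using Cons Dl L.gr_carrier[OF L.dlog_gr]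
      by (simp add: L.Phi_Cons ring_hom_mult[OF F_ring_hom] L.Phi_closed F_dlog)
  qed
qed

text \<open>A word evaluates under \<open>V_free\<close> to V(s) y, where s is its scalar part and F
  y is the value of its other letters. The projection formula V(s) y = V(s F y) then recovers V of
  the value of the word.\<close>

lemma Phi_V:
  assumes "x \<in> carrier (A m)"
  shows "L.Phi (Suc m) (V_free p m Y x) = Ver C m (L.Phi m x)"
  using assms
proof (induction x rule: free_induct)
  case (word w)
  let ?s = "scalar_part (witt p m S) w" and ?y = "L.Phi (Suc m) (wrd (concat (map (V_letter S) w)))"
  have s: "?s \<in> carrier (witt p m S)" using scalar_part_closed word by simp
  have "L.Phi (Suc m) (V_free p m Y (wrd w)) = e (Suc m) (witt_V S ?s) \<otimes>\<^bsub>lev C (Suc m)\<^esub> ?y"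
    using s by (simp add: V_free_wrd L.Phi_Cons S.witt_V_closed)
  also have "\<dots> = Ver C m (e m ?s \<otimes>\<^bsub>lev C m\<^esub> Frob C m ?y)"
    using V_F[OF e_closed[OF s] L.Phi_closed] V_str[OF s] by simp
  also have "\<dots> = Ver C m (L.Phi m (wrd w))"
    by (simp only: Phi_V_letters[OF word] Phi_scalar_part[OF word])
  finally show ?case .
next
  case (diff a b)
  then show ?case by (simp add: V_free_diff L.Phi_diff V_diff L.Phi_closed)
qed (simp add: V_free_zero L.Phi_zero V_zero)

section \<open>Vanishing of the evaluation on the defining ideals\<close>

definition kern :: "nat \<Rightarrow> ('s list, 'q) free set" where
  "kern m = {x \<in> carrier (A m). L.Phi m x = \<zero>\<^bsub>lev C m\<^esub>}"

lemma kern_ideal: "ideal (kern m) (A m)"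
  by (rule free_idealI)
     (auto simp: kern_def L.Phi_zero L.Phi_add L.Phi_uminus L.Phi_mult L.Phi_closed intro: free_in)

text \<open>The induction on the level is forced by I, whose generators arise from the relations one
  level below. The kernel is closed under d, so of each pair g, dg in I and J only g has to be
  checked, by compatibility with V and by the projection formula respectively.\<close>

lemma N_kern: "N m \<subseteq> kern m"
proof (induction m)
  case 0
  show ?case using lev_0 L.Phi_closed[of 0] by (auto simp: kern_def dRW_ideal.simps)
next
  case (Suc m)
  have wdR: "wdR_rels p n X Y \<phi> \<psi> \<subseteq> kern n" for n
    using wdR_rels_in[of n] L.Phi_log_dR_rels[OF prelog_pair_witt, of _ n]
    by (auto simp: kern_def wdR_rels_def)
  have dk: "d_free x \<in> kern n" if "x \<in> kern n" for x n
    using that by (auto simp: kern_def L.Phi_d L.dif_zero intro: d_free_in)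
  have "rels (Suc m) \<subseteq> kern (Suc m)"
  proof (cases m)
    case 0
    then show ?thesis using wdR[of 1] by (simp add: rels_def)
  next
    case (Suc k)
    have "g \<in> kern (Suc (Suc k))" if "g \<in> pd_rels p (Suc k) Y" for g
      using that
    proof (cases rule: pd_rels_cases)
      case (1 n \<xi>)
      have "g \<in> carrier (A (Suc (Suc k)))" using pd_rels_homog[OF that] homog_in by blast
      moreover have "L.Phi (Suc (Suc k)) g = \<zero>\<^bsub>lev C (Suc (Suc k))\<^esub>"
        using D_witt_pd[OF 1(2,1)] witt_pd_closed[OF 1(2)] S.witt_V_closed[OF 1(2)]
        by (simp add: 1(3) L.Phi_diff L.Phi_mult L.Phi_gen L.minus_eq_zero e_closed D_closed)
      ultimately show ?thesis by (simp add: kern_def)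
    qed
    moreover have "g \<in> kern (Suc (Suc k))" if "g \<in> I_gens p (Suc k) Y (N (Suc k))" for g
      using that
    proof (cases rule: I_gens_cases)
      case (1 i x)
      have "x \<in> kern (Suc k)" using 1(2) Suc.IH Suc by auto
      then have "V_free p (Suc k) Y x \<in> kern (Suc (Suc k))"
        by (auto simp: kern_def Phi_V V_zero intro: V_free_in)
      then show ?thesis using 1(3) dk by auto
    qed
    moreover have "g \<in> kern (Suc (Suc k))" if "g \<in> J_gens p (Suc k) Y" for g
      using that
    proof (cases rule: J_gens_cases)
      case (1 \<omega> \<eta>)
      have "L.Phi (Suc (Suc k)) (VF_defect p (Suc k) Y \<omega> \<eta>) = \<zero>\<^bsub>lev C (Suc (Suc k))\<^esub>"
        unfolding VF_defect_def L.Phi_diff L.Phi_mult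
        using 1 by (simp add: Phi_V Phi_F F_free_in free_mult_in L.Phi_mult V_F L.Phi_closed
            L.minus_eq_zero V_closed)
      then have "VF_defect p (Suc k) Y \<omega> \<eta> \<in> kern (Suc (Suc k))"
        using VF_defect_in[OF 1(1,2)] by (simp add: kern_def)
      then show ?thesis using 1(3) dk by auto
    qed
    ultimately show ?thesis using wdR by (auto simp: rels_def Suc)
  qed
  then show ?case unfolding N_Idl by (rule Idl_le[OF kern_ideal])
qed

section \<open>Construction of the morphism\<close>

abbreviation "W\<Lambda> \<equiv> dRW p X Y \<phi> \<psi>"

lemma dRW_simps:
  "lev W\<Lambda> m = quot_dga (witt_prelog p m Y) (N m)"
  "res W\<Lambda> m = induced (witt_prelog p m Y) (N m) res_free"
  "Frob W\<Lambda> m = induced (witt_prelog p m Y) (N m) (F_free p m Y)"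
  "Ver W\<Lambda> m = induced (witt_prelog p (Suc m) Y) (N (Suc m)) (V_free p m Y)"
  by (simp_all add: dRW_def Let_def)

definition univ :: "nat \<Rightarrow> ('s list, 'q) free set \<Rightarrow> 'e" where
  "univ m = (\<lambda>c\<in>carrier (lev W\<Lambda> m). L.Phi m (SOME x. x \<in> c))"

text \<open>The representative chosen by \<open>SOME\<close> differs from x by an element of the
  ideal, on which \<open>Phi\<close> vanishes.\<close>

lemma univ_coset:
  assumes "x \<in> carrier (A m)"
  shows "univ m (N m +>\<^bsub>A m\<^esub> x) = L.Phi m x"
proof -
  obtain h where h: "h \<in> N m" "(SOME y. y \<in> N m +>\<^bsub>A m\<^esub> x) = h + x"
    using cst_some[OF N_ideal assms] by blast
  have "L.Phi m h = \<zero>\<^bsub>lev C m\<^esub>" using h(1) N_kern by (auto simp: kern_def)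
  then show ?thesis
    using cst_carrier[OF N_ideal assms] h(2) by (simp add: univ_def dRW_simps L.Phi_add L.Phi_closed)
qed

lemma univ_some:
  assumes "c \<in> carrier (lev W\<Lambda> m)"
  shows "univ m c = L.Phi m (SOME x. x \<in> c)" "(SOME x. x \<in> c) \<in> carrier (A m)"
proof -
  show "univ m c = L.Phi m (SOME x. x \<in> c)" using assms by (simp add: univ_def)
  obtain x where x: "x \<in> carrier (A m)" "c = N m +>\<^bsub>A m\<^esub> x"
    using cst_cases[OF N_ideal] assms unfolding dRW_simps by metis
  show "(SOME x. x \<in> c) \<in> carrier (A m)" unfolding x(2) by (rule cst_some_in[OF N_ideal x(1)])
qed

lemma univ_log_dga_map: "log_dga_map (witt_prelog p m Y) id (lev W\<Lambda> m) (lev C m) (univ m)"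
  unfolding log_dga_map_def
proof (intro conjI allI ballI)
  note cs = cst_cases[OF N_ideal, of _ m]
  show "univ m \<in> ring_hom (lev W\<Lambda> m) (lev C m)"
  proof (rule ring_hom_memI)
    fix c assume "c \<in> carrier (lev W\<Lambda> m)"
    then show "univ m c \<in> carrier (lev C m)" by (simp add: univ_some L.Phi_closed)
    fix c' assume "c' \<in> carrier (lev W\<Lambda> m)"
    with \<open>c \<in> _\<close> obtain x y where xy: "x \<in> carrier (A m)" "c = N m +>\<^bsub>A m\<^esub> x"
      "y \<in> carrier (A m)" "c' = N m +>\<^bsub>A m\<^esub> y" unfolding dRW_simps by (metis cs)
    show "univ m (c \<otimes>\<^bsub>lev W\<Lambda> m\<^esub> c') = univ m c \<otimes>\<^bsub>lev C m\<^esub> univ m c'"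
      unfolding xy dRW_simps cst_mult[OF N_ideal xy(1,3), symmetric]
      using xy by (simp only: univ_coset free_mult_in L.Phi_mult)
    show "univ m (c \<oplus>\<^bsub>lev W\<Lambda> m\<^esub> c') = univ m c \<oplus>\<^bsub>lev C m\<^esub> univ m c'"
      unfolding xy dRW_simps cst_add[OF N_ideal xy(1,3), symmetric]
      using xy by (simp only: univ_coset free_add_in L.Phi_add)
  next
    show "univ m \<one>\<^bsub>lev W\<Lambda> m\<^esub> = \<one>\<^bsub>lev C m\<^esub>"
      unfolding dRW_simps cst_one[OF N_ideal, symmetric] by (simp only: univ_coset free_one_in L.Phi_one)
  qed
  show "univ m ` gr (lev W\<Lambda> m) i \<subseteq> gr (lev C m) i" for i
    by (auto simp: dRW_simps quot_dga_simps univ_coset homog_in intro: L.Phi_homog)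
  show "univ m (str (lev W\<Lambda> m) s) = e m (id s)" if "s \<in> carrier (lring (witt_prelog p m Y))" for s
    unfolding dRW_simps quot_dga_simps using that by (subst univ_coset) (auto simp: L.Phi_gen intro: gen_in)
  show "univ m (dlog (lev W\<Lambda> m) q) = dlog (lev C m) q" if "q \<in> carrier (lmon (witt_prelog p m Y))" for q
    unfolding dRW_simps quot_dga_simps using that by (subst univ_coset) (auto simp: L.Phi_gen intro: gen_in)
  show "univ m (dif (lev W\<Lambda> m) c) = D m (univ m c)" if "c \<in> carrier (lev W\<Lambda> m)" for c
    unfolding univ_some(1)[OF that] L.Phi_d[OF univ_some(2)[OF that], symmetric]
    unfolding dRW_simps quot_dga_simps induced_def
    by (rule univ_coset[OF d_free_in[OF univ_some(2)[OF that]]])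
qed

text \<open>\<open>univ\<close> and \<open>induced\<close> use the same chosen representative of a
  class, so each square reduces to the corresponding compatibility of \<open>Phi\<close> on that
  representative.\<close>

lemma univ_morphism: "FV_morphism p Y W\<Lambda> C univ"
  unfolding FV_morphism_def
proof (intro allI conjI ballI)
  fix m
  show "univ m \<in> extensional (carrier (lev W\<Lambda> m))" by (simp add: univ_def)
  show "log_dga_map (witt_prelog p m Y) id (lev W\<Lambda> m) (lev C m) (univ m)" by (rule univ_log_dga_map)
  fix c assume c: "c \<in> carrier (lev W\<Lambda> (Suc m))"
  note s = univ_some[OF c]
  show "univ m (res W\<Lambda> m c) = res C m (univ (Suc m) c)"
    unfolding s(1) dRW_simps induced_def Phi_res[OF s(2), symmetric] by (rule univ_coset[OF res_free_in[OF s(2)]])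
  show "univ m (Frob W\<Lambda> m c) = Frob C m (univ (Suc m) c)"
    unfolding s(1) dRW_simps induced_def Phi_F[OF s(2), symmetric] by (rule univ_coset[OF F_free_in[OF s(2)]])
next
  fix m c assume c: "c \<in> carrier (lev W\<Lambda> m)"
  note s = univ_some[OF c]
  show "univ (Suc m) (Ver W\<Lambda> m c) = Ver C m (univ m c)"
    unfolding s(1) dRW_simps induced_def Phi_V[OF s(2), symmetric] by (rule univ_coset[OF V_free_in[OF s(2)]])
qed

text \<open>Since \<open>d\<close> preserves the ideals, \<open>d\<close> of the class of \<open>s\<close> is the class of \<open>ds\<close>, whatever
  representative is chosen.\<close>

lemma dif_coset_Sc:
  assumes "s \<in> carrier (witt p m S)"
  shows "dif (lev W\<Lambda> m) (N m +>\<^bsub>A m\<^esub> gen (Sc s)) = N m +>\<^bsub>A m\<^esub> gen (Dd s)"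
proof -
  have g: "gen (Sc s) \<in> carrier (A m)" "gen (Dd s) \<in> carrier (A m)" using assms by (auto intro!: gen_in)
  obtain h where h: "h \<in> N m" "(SOME y. y \<in> N m +>\<^bsub>A m\<^esub> gen (Sc s)) = h + gen (Sc s)"
    using cst_some[OF N_ideal g(1)] by blast
  have "d_free (h + gen (Sc s)) = d_free h + gen (Dd s)" by (simp only: d_free_add d_free_gen)
  then show ?thesis
    unfolding dRW_simps quot_dga_simps induced_def h(2)
    using cst_absorb[OF N_ideal g(2) d_N[OF h(1)]] by simp
qed

text \<open>The values on the classes of s and dlog q are prescribed, and the value on the class of
  ds follows from compatibility with the differential. These classes generate the quotient as a
  ring, which determines all other values.\<close>

lemma morphism_coset:
  assumes f: "FV_morphism p Y W\<Lambda> C f" and x: "x \<in> carrier (A m)"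
  shows "f m (N m +>\<^bsub>A m\<^esub> x) = L.Phi m x"
proof -
  let ?c = "\<lambda>x. N m +>\<^bsub>A m\<^esub> x"
  have fm: "f m \<in> ring_hom (lev W\<Lambda> m) (lev C m)"
    "\<And>s. s \<in> carrier (witt p m S) \<Longrightarrow> f m (?c (gen (Sc s))) = e m s"
    "\<And>\<omega>. \<omega> \<in> carrier (lev W\<Lambda> m) \<Longrightarrow> f m (dif (lev W\<Lambda> m) \<omega>) = D m (f m \<omega>)"
    "\<And>q. q \<in> carrier (lmon Y) \<Longrightarrow> f m (?c (gen (Dl q))) = dlog (lev C m) q"
    using f unfolding FV_morphism_def log_dga_map_def
    by (auto simp: dRW_simps quot_dga_simps(6,8))
  have cl: "?c y \<in> carrier (lev W\<Lambda> m)" if "y \<in> carrier (A m)" for y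
    unfolding dRW_simps by (rule cst_carrier[OF N_ideal that])
  have fcl: "f m (?c y) \<in> carrier (lev C m)" if "y \<in> carrier (A m)" for y
    by (rule ring_hom_closed[OF fm(1) cl[OF that]])
  have add: "f m (?c (y + z)) = f m (?c y) \<oplus>\<^bsub>lev C m\<^esub> f m (?c z)"
    if "y \<in> carrier (A m)" "z \<in> carrier (A m)" for y z
    using ring_hom_add[OF fm(1) cl[OF that(1)] cl[OF that(2)]]
    by (simp only: cst_add[OF N_ideal that] dRW_simps)
  have mult: "f m (?c (y * z)) = f m (?c y) \<otimes>\<^bsub>lev C m\<^esub> f m (?c z)"
    if "y \<in> carrier (A m)" "z \<in> carrier (A m)" for y z
    using ring_hom_mult[OF fm(1) cl[OF that(1)] cl[OF that(2)]]
    by (simp only: cst_mult[OF N_ideal that] dRW_simps)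
  have letter: "f m (?c (gen l)) = L.letter_val m l" if l: "letter_in (witt_prelog p m Y) l" for l
  proof (cases l)
    case (Dd s)
    then have s: "s \<in> carrier (witt p m S)" using l by simp
    then have "gen (Sc s) \<in> carrier (A m)" by (auto intro!: gen_in)
    from fm(3)[OF cl[OF this]] show ?thesis using s Dd by (simp add: dif_coset_Sc fm(2))
  qed (use l fm in simp_all)
  from x show ?thesis
  proof (induction x rule: free_induct)
    case zero
    show ?case using add[OF free_zero_in free_zero_in] fcl[OF free_zero_in] by (simp add: L.Phi_zero)
  next
    case (word w)
    then show ?case
    proof (induction w)
      case Nil
      show ?case
        using ring_hom_one[OF fm(1)] by (simp only: wrd_Nil L.Phi_one dRW_simps cst_one[OF N_ideal])
    next
      case (Cons l w)
      have "gen l \<in> carrier (A m)" "wrd w \<in> carrier (A m)" using Cons.prems by (auto simp: wrd_in)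
      then have "f m (?c (gen l * wrd w)) = f m (?c (gen l)) \<otimes>\<^bsub>lev C m\<^esub> f m (?c (wrd w))" by (rule mult)
      then show ?case using Cons letter by (subst wrd_Cons) (simp add: L.Phi_Cons)
    qed
  next
    case (diff a b)
    have "f m (?c a) = f m (?c (a - b)) \<oplus>\<^bsub>lev C m\<^esub> f m (?c b)"
      using add[OF free_diff_in[OF diff(1,2)] diff(2)] by simp
    then show ?case
      using diff fcl[OF free_diff_in[OF diff(1,2)]]
      by (simp add: L.Phi_diff a_minus_def L.a_assoc L.r_neg L.Phi_closed)
  qed
qed

lemma morphism_unique:
  assumes f: "FV_morphism p Y W\<Lambda> C f"
  shows "f = univ"
proof
  fix m
  show "f m = univ m"
  proof (rule extensionalityI)
    show "f m \<in> extensional (carrier (lev W\<Lambda> m))" using f by (simp add: FV_morphism_def)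
    show "univ m \<in> extensional (carrier (lev W\<Lambda> m))" by (simp add: univ_def)
    fix c assume "c \<in> carrier (lev W\<Lambda> m)"
    then obtain x where "x \<in> carrier (A m)" "c = N m +>\<^bsub>A m\<^esub> x"
      using cst_cases[OF N_ideal] unfolding dRW_simps by metis
    then show "f m c = univ m c" by (simp add: morphism_coset[OF f] univ_coset)
  qed
qed

end

theorem proposition3p5:
  fixes p :: nat
    and RP :: "('r, 'p) prelog" and SQ :: "('s, 'q) prelog"
    and \<phi> :: "'r \<Rightarrow> 's" and \<psi> :: "'p \<Rightarrow> 'q"
    and E :: "('e, 's, 'q) procomplex"
  assumes "Factorial_Ring.prime p"
    and "Z_local_algebra p (lring RP)"
    and "prelog_hom RP SQ \<phi> \<psi>"
    and "log_FV_procomplex p RP SQ \<phi> \<psi> E"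
  shows "\<exists>!f. FV_morphism p SQ (dRW p RP SQ \<phi> \<psi>) E f"
proof -
  interpret drw_target p RP SQ \<phi> \<psi> E
    using assms by (intro drw_target.intro drw.intro)
  show ?thesis using univ_morphism morphism_unique by blast
qed

end
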